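(* Let $H(g)=H_0+igV$ be the operator in $L^2(\mathbb R^2)$ with domain $D(H_0)$, where $H_0=\frac12\left[-\frac{d^2}{dx_1^2}+x_1^2\right]+\frac12\left[-\frac{d^2}{dx_2^2}+x_2^2\right]$ and $V=a_2^\ast a_1$. Then for every $g\in\mathbb R$ with $|g|<2$: 1. $H(g)$ has discrete spectrum. 2. All eigenvalues of $H(g)$ are $\lambda_m=m+1$, $m=0,1,2,\ldots$. Each eigenvalue $\lambda_m$ has geometric multiplicity $1$ but algebraic multiplicity $m+1$. More precisely, for each $m$ there is an $(m+1)$-dimensional subspace $\mathcal H_m$, invariant under $H(g)$, such that we have the orthogonal decomposition $L^2(\mathbb R^2)=\bigoplus_{m=0}^\infty \mathcal H_m$; if $\tilde H_m:=H(g)|_{\mathcal H_m}$ denotes the restriction of $H(g)$ to $\mathcal H_m$, then $H(g)=\bigoplus_{m=0}^\infty \tilde H_m$, and (with respect to a suitable orthonormal basis of $\mathcal H_m$) $\tilde H_m$ is represented by the $(m+1)\times(m+1)$ matrix $$\tilde H_m=(m+1)I_{(m+1)\times(m+1)}+ig\,D_m,$$ where $D_m$ is nilpotent of order $m+1$. Explicitly, $D_m$ is the matrix whose only nonzero entries are on the first superdiagonal, these being, from top to bottom, $\sqrt m,\sqrt{2(m-1)},\sqrt{3(m-2)},\ldots,\sqrt m$ (i.e. $\sqrt{h(m-h+1)}$, $h=1,\ldots,m$), so that $D_m^{m+1}=0$.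
   Context: For $i=1,2$, $a_i=\frac1{\sqrt2}\left(x_i+\frac{d}{dx_i}\right)$ and $a_i^\ast=\frac1{\sqrt2}\left(x_i-\frac{d}{dx_i}\right)$ are the destruction and creation operators, so $H_0=a_1^\ast a_1+a_2^\ast a_2+1$ and formally $H(g)=a_1^\ast a_1+a_2^\ast a_2+ig\,a_2^\ast a_1+1$. The domain is $D(H_0)=D(-\Delta)\cap D(x_1^2+x_2^2)\subset L^2(\mathbb R^2)$; for $u\in D(H_0)$ one has $Vu=a_2^\ast a_1u\in L^2(\mathbb R^2)$. Discrete spectrum means that the spectrum consists of isolated eigenvalues of finite algebraic multiplicity. The geometric multiplicity of an eigenvalue is the dimension of its eigenspace; its algebraic multiplicity is the dimension of the corresponding generalized eigenspace (range of the Riesz projection).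
   Formalization: Geometric multiplicity 1 is claimed only for g ≠ 0: at g = 0 the operator H(0)=H_0 is self-adjoint and λ_m has geometric multiplicity m+1, so the claim as printed fails there; all other claims are proved for every |g|<2. *)

theory Defs
  imports
    "HOL-Complex_Analysis.Complex_Analysis"
    "Jordan_Normal_Form.Matrix"
begin

section \<open>The complex Hilbert space of square-integrable functions on the plane\<close>

definition sq_integrable :: "(real \<times> real \<Rightarrow> complex) \<Rightarrow> bool" where
  "sq_integrable f \<longleftrightarrow>
     f \<in> borel_measurable lborel \<and> integrable lborel (\<lambda>x. (norm (f x))\<^sup>2)"

lemma sq_integrable_zero: "sq_integrable (\<lambda>x. 0)"
  by (simp add: sq_integrable_def)

lemma sq_integrable_scale:
  assumes "sq_integrable f"
  shows "sq_integrable (\<lambda>x. c * f x)"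
  using assms by (auto simp: sq_integrable_def norm_mult power_mult_distrib)

lemma sq_integrable_add:
  assumes f: "sq_integrable f" and g: "sq_integrable g"
  shows "sq_integrable (\<lambda>x. f x + g x)"
proof -
  have [measurable]: "f \<in> borel_measurable lborel" "g \<in> borel_measurable lborel"
    using f g by (auto simp: sq_integrable_def)
  have bound: "(norm (f x + g x))\<^sup>2 \<le> 2 * (norm (f x))\<^sup>2 + 2 * (norm (g x))\<^sup>2" for x
  proof -
    have "(norm (f x + g x))\<^sup>2 \<le> (norm (f x) + norm (g x))\<^sup>2"
      by (intro power_mono norm_triangle_ineq norm_ge_zero)
    also have "\<dots> \<le> 2 * (norm (f x))\<^sup>2 + 2 * (norm (g x))\<^sup>2"
      using sum_squares_bound[of "norm (f x)" "norm (g x)"] by (simp add: power2_sum)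
    finally show ?thesis .
  qed
  have "integrable lborel (\<lambda>x. (norm (f x + g x))\<^sup>2)"
  proof (rule Bochner_Integration.integrable_bound)
    show "integrable lborel (\<lambda>x. 2 * (norm (f x))\<^sup>2 + 2 * (norm (g x))\<^sup>2)"
      using f g by (auto simp: sq_integrable_def)
    show "AE x in lborel. norm ((norm (f x + g x))\<^sup>2)
            \<le> norm (2 * (norm (f x))\<^sup>2 + 2 * (norm (g x))\<^sup>2)"
      using bound by auto
  qed measurable
  then show ?thesis by (simp add: sq_integrable_def)
qed

lemma borel_measurable_cnj [measurable (raw)]:
  assumes "f \<in> borel_measurable M"
  shows "(\<lambda>x. cnj (f x)) \<in> borel_measurable M"
  using assms
  by (rule measurable_compose) (intro borel_measurable_continuous_onI continuous_intros)

lemma sq_integrable_cnj_mult: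
  assumes f: "sq_integrable f" and g: "sq_integrable g"
  shows "integrable lborel (\<lambda>x. cnj (f x) * g x)"
proof (rule Bochner_Integration.integrable_bound)
  have [measurable]: "f \<in> borel_measurable lborel" "g \<in> borel_measurable lborel"
    using f g by (auto simp: sq_integrable_def)
  show "(\<lambda>x. cnj (f x) * g x) \<in> borel_measurable lborel" by measurable
  show "integrable lborel (\<lambda>x. (norm (f x))\<^sup>2 + (norm (g x))\<^sup>2)"
    using f g by (auto simp: sq_integrable_def)
  have "norm (f x) * norm (g x) \<le> (norm (f x))\<^sup>2 + (norm (g x))\<^sup>2" for x
  proof -
    have "0 \<le> norm (f x) * norm (g x)" by simp
    with sum_squares_bound[of "norm (f x)" "norm (g x)"] show ?thesis by linarith
  qed
  then show "AE x in lborel. norm (cnj (f x) * g x)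
          \<le> norm ((norm (f x))\<^sup>2 + (norm (g x))\<^sup>2)"
    by (auto simp: norm_mult)
qed

definition l2_eq :: "(real \<times> real \<Rightarrow> complex) \<Rightarrow> (real \<times> real \<Rightarrow> complex) \<Rightarrow> bool" where
  "l2_eq f g \<longleftrightarrow> sq_integrable f \<and> sq_integrable g \<and> (AE x in lborel. f x = g x)"

quotient_type l2 = "real \<times> real \<Rightarrow> complex" / partial: l2_eq
proof (rule part_equivpI)
  show "\<exists>x. l2_eq x x"
    using sq_integrable_zero by (auto simp: l2_eq_def)
  show "symp l2_eq"
    by (auto simp: symp_def l2_eq_def)
  show "transp l2_eq"
    by (auto simp: transp_def l2_eq_def)
qed

instantiation l2 :: real_inner
begin

lift_definition zero_l2 :: l2 is "\<lambda>x. 0"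
  by (simp add: l2_eq_def sq_integrable_zero)

lift_definition plus_l2 :: "l2 \<Rightarrow> l2 \<Rightarrow> l2" is "\<lambda>f g x. f x + g x"
  by (auto simp: l2_eq_def intro: sq_integrable_add)

lift_definition uminus_l2 :: "l2 \<Rightarrow> l2" is "\<lambda>f x. - f x"
  using sq_integrable_scale[of _ "-1"] by (auto simp: l2_eq_def)

definition minus_l2 :: "l2 \<Rightarrow> l2 \<Rightarrow> l2" where
  "minus_l2 u v = u + (- v)"

lift_definition scaleR_l2 :: "real \<Rightarrow> l2 \<Rightarrow> l2" is "\<lambda>r f x. complex_of_real r * f x"
  by (auto simp: l2_eq_def intro: sq_integrable_scale)

lift_definition inner_l2 :: "l2 \<Rightarrow> l2 \<Rightarrow> real" is "\<lambda>f g. Re (LINT x|lborel. cnj (f x) * g x)"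
  by (intro arg_cong[of _ _ Re] integral_cong_AE)
     (auto simp: l2_eq_def sq_integrable_def intro!: borel_measurable_times borel_measurable_cnj)

definition norm_l2 :: "l2 \<Rightarrow> real" where
  "norm_l2 u = sqrt (inner u u)"

definition sgn_l2 :: "l2 \<Rightarrow> l2" where
  "sgn_l2 u = inverse (norm u) *\<^sub>R u"

definition dist_l2 :: "l2 \<Rightarrow> l2 \<Rightarrow> real" where
  "dist_l2 u v = norm (u - v)"

definition uniformity_l2 :: "(l2 \<times> l2) filter" where
  "uniformity_l2 = (INF e\<in>{0 <..}. principal {(u, v). dist u v < e})"

definition open_l2 :: "l2 set \<Rightarrow> bool" where
  "open_l2 U \<longleftrightarrow> (\<forall>u\<in>U. eventually (\<lambda>(u', v). u' = u \<longrightarrow> v \<in> U) uniformity)"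

instance
proof
  fix a b c :: l2 and r s :: real and U :: "l2 set"
  show "a + b + c = a + (b + c)"
    by transfer (auto simp: l2_eq_def add.assoc intro!: sq_integrable_add)
  show "a + b = b + a"
    by transfer (auto simp: l2_eq_def add.commute intro!: sq_integrable_add)
  show "0 + a = a"
    by transfer (auto simp: l2_eq_def)
  show "- a + a = 0"
    by transfer (auto simp: l2_eq_def sq_integrable_zero)
  show "a - b = a + - b"
    by (simp add: minus_l2_def)
  show "r *\<^sub>R (a + b) = r *\<^sub>R a + r *\<^sub>R b"
    by transfer
       (auto simp: l2_eq_def distrib_left distrib_right mult.assoc intro!: sq_integrable_add sq_integrable_scale)
  show "(r + s) *\<^sub>R a = r *\<^sub>R a + s *\<^sub>R a"
    by transfer
       (auto simp: l2_eq_def distrib_left distrib_right mult.assoc intro!: sq_integrable_add sq_integrable_scale)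
  show "r *\<^sub>R s *\<^sub>R a = (r * s) *\<^sub>R a"
    by transfer
       (auto simp: l2_eq_def distrib_left distrib_right mult.assoc intro!: sq_integrable_scale)
  show "1 *\<^sub>R a = a"
    by transfer (auto simp: l2_eq_def)
  show "dist a b = norm (a - b)"
    by (rule dist_l2_def)
  show "sgn a = inverse (norm a) *\<^sub>R a"
    by (rule sgn_l2_def)
  show "(uniformity :: (l2 \<times> l2) filter) = (INF e\<in>{0 <..}. principal {(u, v). dist u v < e})"
    by (rule uniformity_l2_def)
  show "open U \<longleftrightarrow> (\<forall>u\<in>U. eventually (\<lambda>(u', v). u' = u \<longrightarrow> v \<in> U) uniformity)"
    by (rule open_l2_def)
  show "norm a = sqrt (inner a a)"
    by (rule norm_l2_def)
  show "inner a b = inner b a"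
  proof transfer
    fix f g :: "real \<times> real \<Rightarrow> complex"
    have "(LINT x|lborel. cnj (f x) * g x) = (LINT x|lborel. cnj (cnj (g x) * f x))"
      by (simp add: mult.commute)
    also have "\<dots> = cnj (LINT x|lborel. cnj (g x) * f x)"
      by (rule Bochner_Integration.integral_cnj)
    finally have "(LINT x|lborel. cnj (f x) * g x) = cnj (LINT x|lborel. cnj (g x) * f x)" .
    then show "Re (LINT x|lborel. cnj (f x) * g x) = Re (LINT x|lborel. cnj (g x) * f x)"
      by simp
  qed
  show "inner (a + b) c = inner a c + inner b c"
  proof transfer
    fix f g h assume "l2_eq f f" "l2_eq g g" "l2_eq h h"
    then show "Re (LINT x|lborel. cnj (f x + g x) * h x) =
      Re (LINT x|lborel. cnj (f x) * h x) + Re (LINT x|lborel. cnj (g x) * h x)"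
      by (simp add: l2_eq_def distrib_right sq_integrable_cnj_mult)
  qed
  show "inner (r *\<^sub>R a) b = r * inner a b"
    by transfer (simp add: mult.assoc)
  have sq: "Re (LINT x|lborel. cnj (f x) * f x) = (LINT x|lborel. (norm (f x))\<^sup>2)" for f
  proof -
    have "(LINT x|lborel. cnj (f x) * f x) = (LINT x|lborel. complex_of_real ((norm (f x))\<^sup>2))"
      by (rule Bochner_Integration.integral_cong)
         (simp_all add: complex_norm_square mult.commute del: of_real_power)
    then show ?thesis by (simp del: of_real_power)
  qed
  show "0 \<le> inner a a"
    by transfer (simp add: sq)
  show "inner a a = 0 \<longleftrightarrow> a = 0"
  proof transfer
    fix f assume f: "l2_eq f f"
    then have "integrable lborel (\<lambda>x. (norm (f x))\<^sup>2)"
      by (simp add: l2_eq_def sq_integrable_def)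
    then have "(LINT x|lborel. (norm (f x))\<^sup>2) = 0 \<longleftrightarrow> (AE x in lborel. (norm (f x))\<^sup>2 = 0)"
      by (intro integral_nonneg_eq_0_iff_AE) auto
    with f show "Re (LINT x|lborel. cnj (f x) * f x) = 0 \<longleftrightarrow> l2_eq f (\<lambda>x. 0)"
      by (simp add: sq l2_eq_def sq_integrable_zero)
  qed
qed

end

lift_definition scaleC :: "complex \<Rightarrow> l2 \<Rightarrow> l2" (infixr \<open>*\<^sub>C\<close> 75) is "\<lambda>c f x. c * f x"
  by (auto simp: l2_eq_def intro: sq_integrable_scale)

lift_definition cinner :: "l2 \<Rightarrow> l2 \<Rightarrow> complex" is "\<lambda>f g. LINT x|lborel. cnj (f x) * g x"
  by (intro integral_cong_AE)
     (auto simp: l2_eq_def sq_integrable_def intro!: borel_measurable_times borel_measurable_cnj)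

interpretation L2: vector_space scaleC
proof
  fix c d :: complex and u v :: l2
  show "c *\<^sub>C (u + v) = c *\<^sub>C u + c *\<^sub>C v"
    by transfer
       (auto simp: l2_eq_def distrib_left distrib_right mult.assoc intro!: sq_integrable_add sq_integrable_scale)
  show "(c + d) *\<^sub>C u = c *\<^sub>C u + d *\<^sub>C u"
    by transfer
       (auto simp: l2_eq_def distrib_left distrib_right mult.assoc intro!: sq_integrable_add sq_integrable_scale)
  show "c *\<^sub>C d *\<^sub>C u = (c * d) *\<^sub>C u"
    by transfer (auto simp: l2_eq_def distrib_left distrib_right mult.assoc intro!: sq_integrable_scale)
  show "1 *\<^sub>C u = u"
    by transfer (auto simp: l2_eq_def)
qed

lemma scaleR_eq_scaleC: "r *\<^sub>R u = complex_of_real r *\<^sub>C u"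
  by transfer (auto simp: l2_eq_def intro: sq_integrable_scale)

lemma norm_l2_eq_cinner: "norm u = sqrt (Re (cinner u u))"
  unfolding norm_l2_def by transfer simp


section \<open>Multiplication and weak differentiation operators\<close>

definition pd :: "real \<times> real \<Rightarrow> (real \<times> real \<Rightarrow> complex) \<Rightarrow> real \<times> real \<Rightarrow> complex" where
  "pd v f x = frechet_derivative f (at x) v"

fun C_k :: "nat \<Rightarrow> (real \<times> real \<Rightarrow> complex) \<Rightarrow> bool" where
  "C_k 0 f \<longleftrightarrow> continuous_on UNIV f"
| "C_k (Suc k) f \<longleftrightarrow> (\<forall>x. f differentiable (at x)) \<and> (\<forall>v. C_k k (pd v f))"

definition test_functions :: "(real \<times> real \<Rightarrow> complex) set" where
  "test_functions = {f. (\<forall>k. C_k k f) \<and> compact (closure {x. f x \<noteq> 0})}"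

text \<open>
  An unbounded operator is given by a domain and a total function on \<^typ>\<open>l2\<close>; only the values
  on the domain matter. Outside their natural domains, the operators below take unspecified values.
\<close>

definition mult_dom :: "(real \<times> real \<Rightarrow> real) \<Rightarrow> l2 set" where
  "mult_dom m = {u. sq_integrable (\<lambda>x. complex_of_real (m x) * rep_l2 u x)}"

definition mult_op :: "(real \<times> real \<Rightarrow> real) \<Rightarrow> l2 \<Rightarrow> l2" where
  "mult_op m u = abs_l2 (\<lambda>x. complex_of_real (m x) * rep_l2 u x)"

definition has_weak_deriv :: "real \<times> real \<Rightarrow> l2 \<Rightarrow> l2 \<Rightarrow> bool" where
  "has_weak_deriv v u w \<longleftrightarrow>
     (\<forall>\<phi>\<in>test_functions.
        (LINT x|lborel. rep_l2 u x * pd v \<phi> x) = - (LINT x|lborel. rep_l2 w x * \<phi> x))"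

definition weak_deriv :: "real \<times> real \<Rightarrow> l2 \<Rightarrow> l2" where
  "weak_deriv v u = (THE w. has_weak_deriv v u w)"

definition has_weak_laplacian :: "l2 \<Rightarrow> l2 \<Rightarrow> bool" where
  "has_weak_laplacian u w \<longleftrightarrow>
     (\<forall>\<phi>\<in>test_functions.
        (LINT x|lborel. rep_l2 u x * (pd (1, 0) (pd (1, 0) \<phi>) x + pd (0, 1) (pd (0, 1) \<phi>) x))
          = (LINT x|lborel. rep_l2 w x * \<phi> x))"

definition laplacian_dom :: "l2 set" where
  "laplacian_dom = {u. \<exists>w. has_weak_laplacian u w}"

abbreviation X1 :: "l2 \<Rightarrow> l2" where "X1 \<equiv> mult_op fst"
abbreviation X2 :: "l2 \<Rightarrow> l2" where "X2 \<equiv> mult_op snd"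
abbreviation D1 :: "l2 \<Rightarrow> l2" where "D1 \<equiv> weak_deriv (1, 0)"
abbreviation D2 :: "l2 \<Rightarrow> l2" where "D2 \<equiv> weak_deriv (0, 1)"


section \<open>The operators of the model\<close>

definition H0_dom :: "l2 set" where
  "H0_dom = laplacian_dom \<inter> mult_dom (\<lambda>x. (fst x)\<^sup>2 + (snd x)\<^sup>2)"

definition H0 :: "l2 \<Rightarrow> l2" where
  "H0 u = (1/2) *\<^sub>C (- D1 (D1 u) + mult_op (\<lambda>x. (fst x)\<^sup>2) u)
        + (1/2) *\<^sub>C (- D2 (D2 u) + mult_op (\<lambda>x. (snd x)\<^sup>2) u)"

definition a1 :: "l2 \<Rightarrow> l2" where
  "a1 u = complex_of_real (1 / sqrt 2) *\<^sub>C (X1 u + D1 u)"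

definition a2_star :: "l2 \<Rightarrow> l2" where
  "a2_star u = complex_of_real (1 / sqrt 2) *\<^sub>C (X2 u - D2 u)"

definition V :: "l2 \<Rightarrow> l2" where
  "V u = a2_star (a1 u)"

definition H :: "real \<Rightarrow> l2 \<Rightarrow> l2" where
  "H g u = H0 u + (\<i> * complex_of_real g) *\<^sub>C V u"


section \<open>Spectral theory of unbounded operators\<close>

definition resolvent :: "l2 set \<Rightarrow> (l2 \<Rightarrow> l2) \<Rightarrow> complex \<Rightarrow> l2 \<Rightarrow> l2" where
  "resolvent D T z = inv_into D (\<lambda>u. z *\<^sub>C u - T u)"

definition resolvent_set :: "l2 set \<Rightarrow> (l2 \<Rightarrow> l2) \<Rightarrow> complex set" where
  "resolvent_set D T =
     {z. bij_betw (\<lambda>u. z *\<^sub>C u - T u) D UNIV \<and> bounded_linear (resolvent D T z)}"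

definition spectrum :: "l2 set \<Rightarrow> (l2 \<Rightarrow> l2) \<Rightarrow> complex set" where
  "spectrum D T = - resolvent_set D T"

definition eigenspace :: "l2 set \<Rightarrow> (l2 \<Rightarrow> l2) \<Rightarrow> complex \<Rightarrow> l2 set" where
  "eigenspace D T z = {u \<in> D. T u = z *\<^sub>C u}"

definition eigenvalues :: "l2 set \<Rightarrow> (l2 \<Rightarrow> l2) \<Rightarrow> complex set" where
  "eigenvalues D T = {z. \<exists>u \<in> eigenspace D T z. u \<noteq> 0}"

text \<open>
  The integrand has values in \<^typ>\<open>l2\<close>, so the library's complex-valued contour integral does not
  apply; the formula is the one by which the library's contour integral is computed.
\<close>

definition contour_integral_l2 :: "(real \<Rightarrow> complex) \<Rightarrow> (complex \<Rightarrow> l2) \<Rightarrow> l2" where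
  "contour_integral_l2 \<gamma> F = integral {0..1} (\<lambda>t. vector_derivative \<gamma> (at t) *\<^sub>C F (\<gamma> t))"

text \<open>For an isolated point \<open>z\<close> of the spectrum, any admissible radius gives the same projection.\<close>

definition riesz_radius :: "l2 set \<Rightarrow> (l2 \<Rightarrow> l2) \<Rightarrow> complex \<Rightarrow> real" where
  "riesz_radius D T z = (SOME r. 0 < r \<and> cball z r \<inter> spectrum D T \<subseteq> {z})"

definition riesz_projection :: "l2 set \<Rightarrow> (l2 \<Rightarrow> l2) \<Rightarrow> complex \<Rightarrow> l2 \<Rightarrow> l2" where
  "riesz_projection D T z u =
     (1 / (2 * complex_of_real pi * \<i>)) *\<^sub>C
       contour_integral_l2 (circlepath z (riesz_radius D T z)) (\<lambda>\<zeta>. resolvent D T \<zeta> u)"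

definition generalized_eigenspace :: "l2 set \<Rightarrow> (l2 \<Rightarrow> l2) \<Rightarrow> complex \<Rightarrow> l2 set" where
  "generalized_eigenspace D T z = range (riesz_projection D T z)"

definition finite_dim :: "l2 set \<Rightarrow> bool" where
  "finite_dim S \<longleftrightarrow> (\<exists>B. finite B \<and> S \<subseteq> L2.span B)"

text \<open>
  \<^const>\<open>L2.dim\<close> returns 0 on infinite-dimensional spaces, so a positive value also asserts
  finite-dimensionality.
\<close>

definition geometric_multiplicity :: "l2 set \<Rightarrow> (l2 \<Rightarrow> l2) \<Rightarrow> complex \<Rightarrow> nat" where
  "geometric_multiplicity D T z = L2.dim (eigenspace D T z)"

definition algebraic_multiplicity :: "l2 set \<Rightarrow> (l2 \<Rightarrow> l2) \<Rightarrow> complex \<Rightarrow> nat" where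
  "algebraic_multiplicity D T z = L2.dim (generalized_eigenspace D T z)"

definition discrete_spectrum :: "l2 set \<Rightarrow> (l2 \<Rightarrow> l2) \<Rightarrow> bool" where
  "discrete_spectrum D T \<longleftrightarrow>
     (\<forall>z \<in> spectrum D T. z isolated_in spectrum D T \<and> z \<in> eigenvalues D T
        \<and> finite_dim (generalized_eigenspace D T z))"


section \<open>Orthogonal decompositions\<close>

definition orthogonal_decomposition :: "(nat \<Rightarrow> l2 set) \<Rightarrow> bool" where
  "orthogonal_decomposition S \<longleftrightarrow>
     (\<forall>m. L2.subspace (S m) \<and> closed (S m))
     \<and> (\<forall>m n u v. m \<noteq> n \<longrightarrow> u \<in> S m \<longrightarrow> v \<in> S n \<longrightarrow> cinner u v = 0)
     \<and> (\<forall>u. \<exists>w. (\<forall>m. w m \<in> S m) \<and> w sums u)"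

definition invariant_subspace :: "l2 set \<Rightarrow> (l2 \<Rightarrow> l2) \<Rightarrow> l2 set \<Rightarrow> bool" where
  "invariant_subspace D T S \<longleftrightarrow> L2.subspace S \<and> S \<subseteq> D \<and> T ` S \<subseteq> S"

text \<open>
  The operator \<open>T\<close> with domain \<open>D\<close> is the orthogonal sum of its restrictions to the subspaces
  \<open>S m\<close>, each of which is contained in \<open>D\<close>: besides acting componentwise, it has the maximal
  domain of the orthogonal sum.
\<close>

definition operator_direct_sum :: "l2 set \<Rightarrow> (l2 \<Rightarrow> l2) \<Rightarrow> (nat \<Rightarrow> l2 set) \<Rightarrow> bool" where
  "operator_direct_sum D T S \<longleftrightarrow>
     (\<forall>m. invariant_subspace D T (S m))
     \<and> (\<forall>w u. (\<forall>m. w m \<in> S m) \<longrightarrow> w sums u \<longrightarrow>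
          (u \<in> D \<longleftrightarrow> summable (\<lambda>m. (norm (T (w m)))\<^sup>2))
          \<and> (u \<in> D \<longrightarrow> (\<lambda>m. T (w m)) sums T u))"

definition orthonormal_basis :: "l2 set \<Rightarrow> nat \<Rightarrow> (nat \<Rightarrow> l2) \<Rightarrow> bool" where
  "orthonormal_basis S n e \<longleftrightarrow>
     (\<forall>i<n. \<forall>j<n. cinner (e i) (e j) = (if i = j then 1 else 0))
     \<and> L2.span (e ` {..<n}) = S"

definition represented_by :: "(l2 \<Rightarrow> l2) \<Rightarrow> nat \<Rightarrow> (nat \<Rightarrow> l2) \<Rightarrow> complex mat \<Rightarrow> bool" where
  "represented_by T n e M \<longleftrightarrow>
     M \<in> carrier_mat n n \<and> (\<forall>j<n. T (e j) = (\<Sum>i<n. (M $$ (i, j)) *\<^sub>C e i))"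

text \<open>
  Rows and columns are numbered from 0, so the entry \<open>sqrt (h * (m - h + 1))\<close> of row \<open>h\<close> in the
  numbering from 1 appears here with \<open>h = i + 1\<close>.
\<close>

definition D_mat :: "nat \<Rightarrow> complex mat" where
  "D_mat m = mat (m + 1) (m + 1)
     (\<lambda>(i, j). if j = i + 1 then complex_of_real (sqrt (real ((i + 1) * (m - i)))) else 0)"

definition H_mat :: "real \<Rightarrow> nat \<Rightarrow> complex mat" where
  "H_mat g m = of_nat (m + 1) \<cdot>\<^sub>m 1\<^sub>m (m + 1) + (\<i> * complex_of_real g) \<cdot>\<^sub>m D_mat m"

end

theory Submission
  imports Defs "HOL-Probability.Levy" "HOL-Real_Asymp.Real_Asymp"
begin

text \<open>
  In the basis of products of Hermite functions, \<open>H g\<close> is block diagonal: \<open>H0\<close> acts as \<open>m + 1\<close> on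
  the span \<open>Level m\<close> of the products \<open>h p (x) * h q (y)\<close> with \<open>p + q = m\<close>, and \<open>V\<close> maps such a
  product to a multiple of the one with indices \<open>p - 1\<close> and \<open>q + 1\<close>, so it is nilpotent there. Multiplying a product of
  Hermite functions by slowly varying cutoffs makes it an admissible test function; this turns the weak definitions
  of the domain and of the operators into statements about coefficients, and the domain becomes the set of functions
  whose coefficients \<open>c\<close> satisfy \<open>\<Sum> (p + q + 1)\<^sup>2 \<bar>c p q\<bar>\<^sup>2 < \<infinity>\<close>. Completeness of the Hermite functions comes
  from the uniqueness theorem for characteristic functions. Since \<open>\<parallel>V v\<parallel> \<le> (m + 1) / 2 * \<parallel>v\<parallel>\<close> on the
  level \<open>m\<close>, for \<open>\<bar>g\<bar> < 2\<close> the resolvents of the blocks are uniformly bounded away from the numbers \<open>m + 1\<close>,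
  and integrating the finite Neumann series of the blocks along a small circle gives the orthogonal projection onto a level.
\<close>

section \<open>The Hilbert space structure\<close>

text \<open>Every block has the single eigenvalue \<open>m + 1\<close> whatever \<open>g\<close> is,
  but the spectrum of an infinite orthogonal sum can exceed the union of the spectra of its blocks:
  nilpotent parts of growing size can make the block resolvents unbounded. The threshold 2 comes
  from the weights \<open>sqrt (q * (p + 1))\<close> of \<open>V\<close>. On
  \<open>p + q = m\<close> they are at most half of the diagonal entry \<open>m + 1\<close>, so the
  perturbation is bounded by \<open>H0\<close> with relative constant \<open>|g| / 2\<close>. That
  this constant is below 1 gives both the bounded resolvents and the fact that \<open>H g\<close>
  with domain \<open>H0_dom\<close> is the maximal orthogonal sum of its blocks. The other obstacle
  lies in the definitions. They test only against compactly supported functions, whereas Hermite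
  functions have full support, and membership in \<open>laplacian_dom\<close> controls only the sum
  of the two second derivatives. The operator \<open>r^2 - Laplacian\<close> is diagonal in the
  Hermite functions, so the size of the coefficients can be read off from this sum directly, without
  elliptic regularity.\<close>

lemma sq_integrable_rep_l2: "sq_integrable (rep_l2 u)"
  using Quotient_rep_reflp[OF Quotient_l2, of u] by (simp add: l2_eq_def)

lemma borel_measurable_rep_l2 [measurable]: "rep_l2 u \<in> borel_measurable borel"
  using sq_integrable_rep_l2[of u] by (simp add: sq_integrable_def)

lemma abs_rep_l2: "abs_l2 (rep_l2 u) = u"
  using Quotient_abs_rep[OF Quotient_l2] by blast

lemma abs_l2_eq_iff:
  assumes "sq_integrable f" "sq_integrable g"
  shows "abs_l2 f = abs_l2 g \<longleftrightarrow> (AE x in lborel. f x = g x)"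
  using Quotient_rel[OF Quotient_l2, of f g] assms by (auto simp: l2_eq_def)

lemma AE_rep_abs_l2:
  assumes "sq_integrable f"
  shows "AE x in lborel. rep_l2 (abs_l2 f) x = f x"
  using Quotient_rep_abs[OF Quotient_l2, of f] assms by (auto simp: l2_eq_def)

lemma l2_eq_iff_AE: "u = v \<longleftrightarrow> (AE x in lborel. rep_l2 u x = rep_l2 v x)"
  using abs_l2_eq_iff[OF sq_integrable_rep_l2 sq_integrable_rep_l2, of u v]
  by (simp add: abs_rep_l2)

lemma AE_rep_l2_add: "AE x in lborel. rep_l2 (u + v) x = rep_l2 u x + rep_l2 v x"
proof -
  have "u + v = abs_l2 (\<lambda>x. rep_l2 u x + rep_l2 v x)"
    using plus_l2.abs_eq[of "rep_l2 u" "rep_l2 v"]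
    by (simp add: l2_eq_def sq_integrable_rep_l2 abs_rep_l2)
  then show ?thesis
    using AE_rep_abs_l2 sq_integrable_add[OF sq_integrable_rep_l2 sq_integrable_rep_l2, of u v] by auto
qed

lemma AE_rep_l2_scaleC: "AE x in lborel. rep_l2 (c *\<^sub>C u) x = c * rep_l2 u x"
proof -
  have "c *\<^sub>C u = abs_l2 (\<lambda>x. c * rep_l2 u x)"
    using scaleC.abs_eq[of "rep_l2 u" c]
    by (simp add: l2_eq_def sq_integrable_rep_l2 abs_rep_l2)
  then show ?thesis
    using AE_rep_abs_l2 sq_integrable_scale[OF sq_integrable_rep_l2, of c u] by auto
qed

lemma AE_rep_l2_zero: "AE x in lborel. rep_l2 0 x = 0"
  unfolding zero_l2_def using AE_rep_abs_l2[OF sq_integrable_zero] by auto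

lemma uminus_l2_eq_scaleC: "- u = (-1) *\<^sub>C u" for u :: l2
  using L2.scale_minus_left[of 1 u] by simp

lemma AE_rep_l2_uminus: "AE x in lborel. rep_l2 (- u) x = - rep_l2 u x"
  using AE_rep_l2_scaleC[of "-1" u] by (simp add: uminus_l2_eq_scaleC[symmetric])

lemma AE_rep_l2_diff: "AE x in lborel. rep_l2 (u - v) x = rep_l2 u x - rep_l2 v x"
  using AE_rep_l2_add[of u "- v"] AE_rep_l2_uminus[of v] by auto

lemma cinner_eq: "cinner u v = (LINT x|lborel. cnj (rep_l2 u x) * rep_l2 v x)"
  using cinner.abs_eq[of "rep_l2 u" "rep_l2 v"]
  by (simp add: abs_rep_l2 l2_eq_def sq_integrable_rep_l2)

lemma cinner_abs_l2:
  assumes "sq_integrable f" "sq_integrable g"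
  shows "cinner (abs_l2 f) (abs_l2 g) = (LINT x|lborel. cnj (f x) * g x)"
  using cinner.abs_eq[of f g] assms by (simp add: l2_eq_def)

lemma cinner_abs_l2_left:
  assumes "sq_integrable f"
  shows "cinner (abs_l2 f) u = (LINT x|lborel. cnj (f x) * rep_l2 u x)"
  using cinner_abs_l2[OF assms sq_integrable_rep_l2[of u]] by (simp add: abs_rep_l2)

lemma integrable_cnj_rep_l2_mult: "integrable lborel (\<lambda>x. cnj (rep_l2 u x) * rep_l2 v x)"
  by (intro sq_integrable_cnj_mult sq_integrable_rep_l2)

lemma sq_integrable_cnj: "sq_integrable f \<Longrightarrow> sq_integrable (\<lambda>x. cnj (f x))"
  by (auto simp: sq_integrable_def)

lemma integrable_mult_sq_integrable:
  assumes "sq_integrable f" "sq_integrable g"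
  shows "integrable lborel (\<lambda>x. f x * g x)"
  using sq_integrable_cnj_mult[OF sq_integrable_cnj[OF assms(1)] assms(2)] by simp

lemma cinner_commute: "cinner u v = cnj (cinner v u)"
proof -
  have "cinner u v = (LINT x|lborel. cnj (cnj (rep_l2 v x) * rep_l2 u x))"
    by (simp add: cinner_eq mult.commute)
  then show ?thesis
    by (simp only: Bochner_Integration.integral_cnj cinner_eq)
qed

lemma cinner_add_right: "cinner u (v + w) = cinner u v + cinner u w"
proof -
  have "cinner u (v + w) = (LINT x|lborel. cnj (rep_l2 u x) * rep_l2 v x + cnj (rep_l2 u x) * rep_l2 w x)"
    unfolding cinner_eq
    by (rule integral_cong_AE) (use AE_rep_l2_add[of v w] in \<open>auto simp: distrib_left\<close>)
  also have "\<dots> = cinner u v + cinner u w"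
    by (simp add: cinner_eq integrable_cnj_rep_l2_mult)
  finally show ?thesis .
qed

lemma cinner_scaleC_right: "cinner u (c *\<^sub>C v) = c * cinner u v"
proof -
  have "cinner u (c *\<^sub>C v) = (LINT x|lborel. c * (cnj (rep_l2 u x) * rep_l2 v x))"
    unfolding cinner_eq
    by (rule integral_cong_AE) (use AE_rep_l2_scaleC[of c v] in auto)
  then show ?thesis
    by (simp add: cinner_eq)
qed

lemma cinner_add_left: "cinner (u + v) w = cinner u w + cinner v w"
  using cinner_commute cinner_add_right by (metis complex_cnj_add)

lemma cinner_scaleC_left: "cinner (c *\<^sub>C u) v = cnj c * cinner u v"
  using cinner_commute cinner_scaleC_right by (metis complex_cnj_mult)

lemma cinner_zero_right [simp]: "cinner u 0 = 0"
  using cinner_add_right[of u 0 0] by simp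

lemma cinner_zero_left [simp]: "cinner 0 u = 0"
  using cinner_add_left[of 0 0 u] by simp

lemma cinner_minus_right: "cinner u (- v) = - cinner u v"
  using cinner_add_right[of u v "- v"] by (simp add: eq_neg_iff_add_eq_0 add.commute)

lemma cinner_diff_right: "cinner u (v - w) = cinner u v - cinner u w"
  using cinner_add_right[of u v "- w"] by (simp add: cinner_minus_right)

lemma cinner_sum_right: "cinner u (\<Sum>i\<in>A. f i) = (\<Sum>i\<in>A. cinner u (f i))"
  by (induction A rule: infinite_finite_induct) (auto simp: cinner_add_right)

lemma cinner_sum_left: "cinner (\<Sum>i\<in>A. f i) u = (\<Sum>i\<in>A. cinner (f i) u)"
  by (induction A rule: infinite_finite_induct) (auto simp: cinner_add_left)

lemma Re_cinner: "Re (cinner u v) = inner u v"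
  by transfer simp

lemma cinner_self: "cinner u u = complex_of_real ((norm u)\<^sup>2)"
proof -
  have "Im (cinner u u) = 0"
    using arg_cong[OF cinner_commute[of u u], of Im] by simp
  then show ?thesis
    by (simp add: complex_eq_iff Re_cinner power2_norm_eq_inner)
qed

lemma norm_scaleC: "norm (c *\<^sub>C u) = cmod c * norm u"
proof -
  have "complex_of_real ((norm (c *\<^sub>C u))\<^sup>2) = cnj c * c * complex_of_real ((norm u)\<^sup>2)"
    by (simp only: cinner_self[symmetric] cinner_scaleC_right cinner_scaleC_left mult.assoc mult.left_commute)
  also have "\<dots> = complex_of_real ((cmod c * norm u)\<^sup>2)"
    by (simp add: power_mult_distrib complex_norm_square mult.commute del: of_real_power)
  finally have "(norm (c *\<^sub>C u))\<^sup>2 = (cmod c * norm u)\<^sup>2"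
    using of_real_eq_iff by blast
  then show ?thesis
    by (metis norm_ge_zero mult_nonneg_nonneg power2_eq_imp_eq)
qed

text \<open>Multiplying \<open>v\<close> by a unimodular phase \<open>t\<close> makes the product
  real and nonnegative, so the Cauchy-Schwarz inequality of the underlying real inner product
  applies.\<close>

lemma norm_cinner_le: "cmod (cinner u v) \<le> norm u * norm v"
proof -
  obtain t where t: "cmod t = 1" "t * cinner u v = complex_of_real (cmod (cinner u v))"
  proof (cases "cinner u v = 0")
    case False
    then show ?thesis
      by (intro that[of "cnj (sgn (cinner u v))"])
         (auto simp: norm_sgn sgn_eq norm_divide complex_norm_square[symmetric] power2_eq_square mult.commute)
  qed (auto intro: that[of 1])
  have "cmod (cinner u v) = Re (cinner u (t *\<^sub>C v))"
    by (simp add: cinner_scaleC_right t)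
  also have "\<dots> \<le> norm u * norm (t *\<^sub>C v)"
    by (simp only: Re_cinner norm_cauchy_schwarz)
  finally show ?thesis by (simp add: norm_scaleC t)
qed

lemma bounded_linear_cinner_right: "bounded_linear (cinner u)"
  by (rule bounded_linear_intro[where K = "norm u"])
     (auto simp: cinner_add_right scaleR_eq_scaleC cinner_scaleC_right scaleR_conv_of_real
        mult.commute intro: order_trans[OF norm_cinner_le])

lemma bounded_linear_scaleC_left: "bounded_linear (\<lambda>c. c *\<^sub>C u)"
  by (rule bounded_linear_intro[where K = "norm u"])
     (auto simp: L2.scale_left_distrib scaleR_eq_scaleC norm_scaleC scaleR_conv_of_real)

lemma norm_l2_squared: "(norm u)\<^sup>2 = (LINT x|lborel. (cmod (rep_l2 u x))\<^sup>2)"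
proof -
  have "complex_of_real ((norm u)\<^sup>2) = (LINT x|lborel. complex_of_real ((cmod (rep_l2 u x))\<^sup>2))"
    unfolding cinner_self[symmetric] cinner_eq
    by (rule Bochner_Integration.integral_cong) (simp_all add: complex_norm_square mult.commute del: of_real_power)
  then show ?thesis
    by (simp only: integral_complex_of_real of_real_eq_iff)
qed

lemma nn_integral_rep_l2: "(\<integral>\<^sup>+x. ennreal ((cmod (rep_l2 u x))\<^sup>2) \<partial>lborel) = ennreal ((norm u)\<^sup>2)"
  unfolding norm_l2_squared
  by (rule nn_integral_eq_integral) (use sq_integrable_rep_l2[of u] in \<open>auto simp: sq_integrable_def\<close>)

lemma nn_integral_rep_l2_diff:
  "(\<integral>\<^sup>+x. ennreal ((cmod (rep_l2 u x - rep_l2 v x))\<^sup>2) \<partial>lborel) = ennreal ((dist u v)\<^sup>2)"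
  unfolding dist_norm nn_integral_rep_l2[symmetric]
  by (rule nn_integral_cong_AE) (use AE_rep_l2_diff[of u v] in auto)

section \<open>Completeness\<close>

lemma Cauchy_fast_subseq:
  fixes X :: "nat \<Rightarrow> 'a::metric_space"
  assumes "Cauchy X"
  obtains r where "strict_mono r" "\<And>k m n. m \<ge> r k \<Longrightarrow> n \<ge> r k \<Longrightarrow> dist (X m) (X n) < (1/2)^k"
proof -
  have "\<forall>k. \<exists>N. \<forall>m\<ge>N. \<forall>n\<ge>N. dist (X m) (X n) < (1/2)^k"
    using assms unfolding Cauchy_def by simp
  then obtain N where N: "\<And>k m n. m \<ge> N k \<Longrightarrow> n \<ge> N k \<Longrightarrow> dist (X m) (X n) < (1/2)^k"
    by metis
  \<comment> \<open>Summing all earlier thresholds makes \<open>r k\<close> dominate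
    \<open>N k\<close>; the extra summand \<open>k\<close> makes \<open>r\<close> strictly
    increasing.\<close>
  define r where "r k = (\<Sum>i\<le>k. N i) + k" for k
  have "strict_mono r"
    by (rule strict_mono_Suc_iff[THEN iffD2]) (simp add: r_def)
  moreover have "N k \<le> r k" for k
    unfolding r_def using member_le_sum[of k "{..k}" N] by simp
  ultimately show ?thesis
    using N that by (meson order_trans)
qed

text \<open>
  Along a fast subsequence the sum of \<open>2 ^ k * \<bar>f (k + 1) - f k\<bar>\<^sup>2\<close> is integrable, which forces pointwise
  convergence almost everywhere; Fatou's lemma then identifies the limit.
\<close>

lemma Cauchy_l2_convergent:
  fixes X :: "nat \<Rightarrow> l2"
  assumes "Cauchy X"
  shows "convergent X"
proof -
  obtain r where r: "strict_mono r"
    and rd: "\<And>k m n. m \<ge> r k \<Longrightarrow> n \<ge> r k \<Longrightarrow> dist (X m) (X n) < (1/2)^k"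
    using Cauchy_fast_subseq[OF assms] by blast
  define f where "f k = rep_l2 (X (r k))" for k
  have [measurable]: "f k \<in> borel_measurable borel" for k
    by (simp add: f_def)
  have fd: "(\<integral>\<^sup>+x. ennreal ((cmod (f m x - f n x))\<^sup>2) \<partial>lborel) \<le> ennreal ((1/4)^k)" if "m \<ge> k" "n \<ge> k" for k m n
  proof -
    have "dist (X (r m)) (X (r n)) < (1/2)^k"
      using rd[of k "r m" "r n"] that r by (simp add: strict_mono_less_eq)
    then have "(dist (X (r m)) (X (r n)))\<^sup>2 \<le> ((1/2)^k)\<^sup>2"
      by (intro power_mono) auto
    also have "((1/2)^k)\<^sup>2 = (1/4::real)^k"
      by (simp add: power_mult[symmetric] mult.commute[of k] power_mult power_divide)
    finally show ?thesis
      by (simp add: f_def nn_integral_rep_l2_diff ennreal_leI)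
  qed
  define G where "G x = (\<Sum>k. ennreal (2^k * (cmod (f (Suc k) x - f k x))\<^sup>2))" for x
  have [measurable]: "G \<in> borel_measurable borel"
    unfolding G_def by measurable
  have "(\<integral>\<^sup>+x. G x \<partial>lborel) = (\<Sum>k. \<integral>\<^sup>+x. ennreal (2^k * (cmod (f (Suc k) x - f k x))\<^sup>2) \<partial>lborel)"
    unfolding G_def by (rule nn_integral_suminf) measurable
  also have "\<dots> \<le> (\<Sum>k. ennreal ((1/2)^k))"
  proof (intro suminf_le summableI)
    fix k
    have "(\<integral>\<^sup>+x. ennreal (2^k * (cmod (f (Suc k) x - f k x))\<^sup>2) \<partial>lborel)
        = ennreal (2^k) * (\<integral>\<^sup>+x. ennreal ((cmod (f (Suc k) x - f k x))\<^sup>2) \<partial>lborel)"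
      by (simp add: ennreal_mult nn_integral_cmult)
    also have "\<dots> \<le> ennreal (2^k) * ennreal ((1/4)^k)"
      by (intro mult_left_mono fd) auto
    also have "\<dots> = ennreal ((1/2)^k)"
      by (simp add: ennreal_mult[symmetric] power_mult_distrib[symmetric])
    finally show "(\<integral>\<^sup>+x. ennreal (2^k * (cmod (f (Suc k) x - f k x))\<^sup>2) \<partial>lborel) \<le> ennreal ((1/2)^k)" .
  qed
  also have "\<dots> < \<infinity>"
    by (subst suminf_ennreal2) auto
  finally have "AE x in lborel. G x \<noteq> \<infinity>"
    by (intro nn_integral_PInf_AE) auto
  then have conv: "AE x in lborel. convergent (\<lambda>k. f k x)"
  proof eventually_elim
    case (elim x)
    then have "summable (\<lambda>k. 2^k * (cmod (f (Suc k) x - f k x))\<^sup>2)"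
      unfolding G_def by (intro summable_suminf_not_top) auto
    then obtain B where "\<And>k. norm (2^k * (cmod (f (Suc k) x - f k x))\<^sup>2) \<le> B"
      using summable_imp_Bseq unfolding Bseq_def by blast
    then have B: "\<And>k. 2^k * (cmod (f (Suc k) x - f k x))\<^sup>2 \<le> B"
      using abs_le_D1 unfolding real_norm_def by blast
    have "summable (\<lambda>k. f (Suc k) x - f k x)"
    proof (rule summable_comparison_test')
      show "summable (\<lambda>k. sqrt B * (sqrt (1/2))^k)"
        by (intro summable_mult summable_geometric) (simp add: real_sqrt_divide)
      fix k assume "k \<ge> (0::nat)"
      have "(cmod (f (Suc k) x - f k x))\<^sup>2 \<le> B * (1/2)^k"
        using B[of k] by (simp add: field_simps)
      then have "cmod (f (Suc k) x - f k x) \<le> sqrt (B * (1/2)^k)"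
        by (intro real_le_rsqrt)
      then show "norm (f (Suc k) x - f k x) \<le> sqrt B * (sqrt (1/2))^k"
        by (simp add: real_sqrt_mult real_sqrt_power)
    qed
    then have "convergent (\<lambda>n. \<Sum>k<n. f (Suc k) x - f k x)"
      by (simp add: summable_iff_convergent)
    then have "convergent (\<lambda>n. f n x - f 0 x)"
      by (simp only: sum_lessThan_telescope[of "\<lambda>k. f k x"])
    then have "convergent (\<lambda>n. (f n x - f 0 x) + f 0 x)"
      by (intro convergent_add convergent_const)
    then show ?case by simp
  qed
  define F where "F x = lim (\<lambda>k. f k x)" for x
  have [measurable]: "F \<in> borel_measurable borel"
    unfolding F_def by measurable
  have lim: "AE x in lborel. (\<lambda>k. f k x) \<longlonglongrightarrow> F x"
    using conv by eventually_elim (simp add: F_def convergent_LIMSEQ_iff)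
  have FF: "(\<integral>\<^sup>+x. ennreal ((cmod (F x - f k x))\<^sup>2) \<partial>lborel) \<le> ennreal ((1/4)^k)" for k
  proof -
    have "(\<integral>\<^sup>+x. ennreal ((cmod (F x - f k x))\<^sup>2) \<partial>lborel)
        = (\<integral>\<^sup>+x. liminf (\<lambda>n. ennreal ((cmod (f n x - f k x))\<^sup>2)) \<partial>lborel)"
    proof (rule nn_integral_cong_AE)
      show "AE x in lborel. ennreal ((cmod (F x - f k x))\<^sup>2) = liminf (\<lambda>n. ennreal ((cmod (f n x - f k x))\<^sup>2))"
        using lim
      proof eventually_elim
        case (elim x)
        then have "(\<lambda>n. ennreal ((cmod (f n x - f k x))\<^sup>2)) \<longlonglongrightarrow> ennreal ((cmod (F x - f k x))\<^sup>2)"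
          by (intro tendsto_intros tendsto_ennrealI)
        then show ?case
          by (rule lim_imp_Liminf[symmetric, rotated]) simp
      qed
    qed
    also have "\<dots> \<le> liminf (\<lambda>n. \<integral>\<^sup>+x. ennreal ((cmod (f n x - f k x))\<^sup>2) \<partial>lborel)"
      by (intro nn_integral_liminf) measurable
    also have "\<dots> \<le> liminf (\<lambda>n. ennreal ((1/4)^k))"
      by (intro Liminf_mono eventually_sequentiallyI[of k] fd) auto
    finally show ?thesis
      by (simp add: Liminf_const)
  qed
  have Fk: "sq_integrable (\<lambda>x. F x - f k x)" for k
    unfolding sq_integrable_def
    using FF[of k] by (auto intro!: integrableI_bounded simp: le_less_trans)
  have "sq_integrable (\<lambda>x. (F x - f 0 x) + f 0 x)"
    by (intro sq_integrable_add Fk) (simp add: f_def sq_integrable_rep_l2)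
  then have F: "sq_integrable F" by simp
  have "dist (X (r k)) (abs_l2 F) \<le> (1/2)^k" for k
  proof -
    have "ennreal ((dist (abs_l2 F) (X (r k)))\<^sup>2) = (\<integral>\<^sup>+x. ennreal ((cmod (F x - f k x))\<^sup>2) \<partial>lborel)"
      unfolding nn_integral_rep_l2_diff[symmetric] f_def
      by (rule nn_integral_cong_AE) (use AE_rep_abs_l2[OF F] in auto)
    with FF[of k] have "ennreal ((dist (abs_l2 F) (X (r k)))\<^sup>2) \<le> ennreal ((1/4)^k)"
      by (simp only:)
    then have "(dist (abs_l2 F) (X (r k)))\<^sup>2 \<le> (1/4)^k"
      by (subst (asm) ennreal_le_iff) auto
    also have "(1/4::real)^k = ((1/2)^k)\<^sup>2"
      by (simp add: power_mult[symmetric] mult.commute[of k] power_mult power_divide)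
    finally show ?thesis
      by (subst dist_commute) (rule power2_le_imp_le, simp_all)
  qed
  then have "(\<lambda>k. dist (X (r k)) (abs_l2 F)) \<longlonglongrightarrow> 0"
    by (intro tendsto_sandwich[OF _ _ tendsto_const LIMSEQ_realpow_zero[of "1/2"]]) auto
  then have "(X \<circ> r) \<longlonglongrightarrow> abs_l2 F"
    by (subst tendsto_dist_iff) (simp only: o_def)
  then show ?thesis
    using Cauchy_converges_subseq[OF assms r] convergentI by blast
qed

instance l2 :: banach
  by standard (rule Cauchy_l2_convergent)

section \<open>Orthogonal series\<close>

lemma norm_sum_orthogonal:
  fixes v :: "'i \<Rightarrow> l2"
  assumes "finite F" "\<And>i j. i \<in> F \<Longrightarrow> j \<in> F \<Longrightarrow> i \<noteq> j \<Longrightarrow> cinner (v i) (v j) = 0"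
  shows "(norm (\<Sum>i\<in>F. v i))\<^sup>2 = (\<Sum>i\<in>F. (norm (v i))\<^sup>2)"
proof -
  have "cinner (\<Sum>i\<in>F. v i) (\<Sum>i\<in>F. v i) = (\<Sum>i\<in>F. \<Sum>j\<in>F. cinner (v j) (v i))"
    by (simp only: cinner_sum_left cinner_sum_right)
  also have "\<dots> = (\<Sum>i\<in>F. \<Sum>j\<in>F. if j = i then cinner (v i) (v i) else 0)"
    by (intro sum.cong refl) (use assms in auto)
  also have "\<dots> = complex_of_real (\<Sum>i\<in>F. (norm (v i))\<^sup>2)"
    using assms(1) by (simp add: cinner_self)
  finally show ?thesis
    by (simp only: cinner_self of_real_eq_iff)
qed

text \<open>For \<open>F0 \<subseteq> F\<close>, Pythagoras turns the squared distance of the two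
  partial sums into the difference of the partial sums of the squared norms. Hence the net of
  partial sums is Cauchy, and completeness gives the limit.\<close>

lemma summable_on_orthogonal:
  fixes v :: "'i \<Rightarrow> l2"
  assumes orth: "\<And>i j. i \<in> A \<Longrightarrow> j \<in> A \<Longrightarrow> i \<noteq> j \<Longrightarrow> cinner (v i) (v j) = 0"
    and sq: "(\<lambda>i. (norm (v i))\<^sup>2) summable_on A"
  shows "v summable_on A"
proof -
  let ?f = "\<lambda>i. (norm (v i))\<^sup>2"
  have "\<exists>P. eventually P (finite_subsets_at_top A) \<and>
           (\<forall>F F'. P F \<and> P F' \<longrightarrow> dist (sum v F) (sum v F') < e)" if "e > 0" for e
  proof -
    obtain S where "(?f has_sum S) A"
      using sq by (auto simp: summable_on_def)
    then have "eventually (\<lambda>F. dist (sum ?f F) S < (e/2)\<^sup>2 / 2) (finite_subsets_at_top A)"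
      unfolding has_sum_def using \<open>e > 0\<close> by (intro tendstoD) auto
    then obtain F0 where "finite F0 \<and> F0 \<subseteq> A \<and>
      (\<forall>F. finite F \<and> F0 \<subseteq> F \<and> F \<subseteq> A \<longrightarrow> dist (sum ?f F) S < (e/2)\<^sup>2 / 2)"
      unfolding eventually_finite_subsets_at_top by (rule exE)
    then have F0: "finite F0" "F0 \<subseteq> A"
      "\<And>F. finite F \<Longrightarrow> F0 \<subseteq> F \<Longrightarrow> F \<subseteq> A \<Longrightarrow> dist (sum ?f F) S < (e/2)\<^sup>2 / 2"
      by simp_all
    have *: "dist (sum v F) (sum v F0) < e/2" if F: "finite F" "F0 \<subseteq> F" "F \<subseteq> A" for F
    proof -
      have "sum v F - sum v F0 = sum v (F - F0)"
        by (simp add: F F0 sum_diff)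
      then have "(dist (sum v F) (sum v F0))\<^sup>2 = sum ?f (F - F0)"
        unfolding dist_norm
        by (simp only:) (rule norm_sum_orthogonal, use F in \<open>auto intro!: orth\<close>)
      also have "\<dots> = sum ?f F - sum ?f F0"
        by (simp add: F F0 sum_diff)
      also have "\<dots> \<le> dist (sum ?f F) S + dist (sum ?f F0) S"
        by (simp add: dist_real_def)
      also have "\<dots> < (e/2)\<^sup>2"
        using F0(3)[OF F] F0(3)[OF F0(1) order_refl F0(2)] by simp
      finally show ?thesis
        using \<open>e > 0\<close> by (intro power2_less_imp_less[of _ "e/2"]) auto
    qed
    show ?thesis
    proof (intro exI[of _ "\<lambda>F. finite F \<and> F0 \<subseteq> F \<and> F \<subseteq> A"] conjI allI impI)
      show "\<forall>\<^sub>F F in finite_subsets_at_top A. finite F \<and> F0 \<subseteq> F \<and> F \<subseteq> A"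
        unfolding eventually_finite_subsets_at_top using F0 by blast
      fix F F' assume "(finite F \<and> F0 \<subseteq> F \<and> F \<subseteq> A) \<and> finite F' \<and> F0 \<subseteq> F' \<and> F' \<subseteq> A"
      then show "dist (sum v F) (sum v F') < e"
        using *[of F] *[of F'] dist_triangle2[of "sum v F" "sum v F'" "sum v F0"] by simp
    qed
  qed
  then have "cauchy_filter (filtermap (sum v) (finite_subsets_at_top A))"
    by (simp add: cauchy_filter_metric_filtermap)
  moreover have "complete (UNIV :: l2 set)"
    by (meson Cauchy_convergent UNIV_I complete_def convergent_def)
  ultimately obtain L where "(sum v \<longlongrightarrow> L) (finite_subsets_at_top A)"
    using complete_uniform[where S = "UNIV :: l2 set"] by (force simp add: filterlim_def)
  then show ?thesis
    using summable_on_def has_sum_def by blast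
qed

section \<open>Uniqueness of moments under exponential decay\<close>

lemma power_le_fact_mult_exp: "0 \<le> x \<Longrightarrow> x ^ n \<le> fact n * exp x" for x :: real
proof -
  assume "0 \<le> x"
  then have "x ^ n /\<^sub>R fact n \<le> (\<Sum>k<Suc n. x ^ k /\<^sub>R fact k)"
    by (intro member_le_sum[of n _ "\<lambda>k. x ^ k /\<^sub>R fact k"]) auto
  also have "\<dots> \<le> exp x"
    unfolding exp_def using summable_exp_generic[of x] \<open>0 \<le> x\<close>
    by (intro sum_le_suminf) auto
  finally show ?thesis
    by (simp add: field_simps)
qed

lemma norm_exp_partial_sum_le:
  fixes z :: complex
  shows "cmod (\<Sum>k<n. z ^ k /\<^sub>R fact k) \<le> exp (cmod z)"
proof -
  have "cmod (\<Sum>k<n. z ^ k /\<^sub>R fact k) \<le> (\<Sum>k<n. cmod z ^ k /\<^sub>R fact k)"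
    by (rule order_trans[OF norm_sum]) (simp add: norm_power)
  also have "\<dots> \<le> exp (cmod z)"
    unfolding exp_def using summable_exp_generic[of "cmod z"]
    by (intro sum_le_suminf) auto
  finally show ?thesis .
qed

text \<open>
  The exponential decay makes the Fourier transform of \<open>F\<close> equal to its moment series, hence zero;
  so the positive and negative parts of \<open>F\<close> define measures with the same characteristic function.
\<close>

lemma moments_zero_AE_zero:
  fixes F :: "real \<Rightarrow> real"
  assumes [measurable]: "F \<in> borel_measurable borel"
    and int: "\<And>k::nat. integrable lborel (\<lambda>x. exp (k * \<bar>x\<bar>) * F x)"
    and mom: "\<And>n::nat. (LINT x|lborel. x ^ n * F x) = 0"
  shows "AE x in lborel. F x = 0"
proof -
  have intF: "integrable lborel F"
    using int[of 0] by simp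
  have pow: "integrable lborel (\<lambda>x. x ^ n * F x)" for n
  proof (rule Bochner_Integration.integrable_bound)
    show "integrable lborel (\<lambda>x. fact n * (exp (real 1 * \<bar>x\<bar>) * F x))"
      by (intro integrable_mult_right int)
    show "AE x in lborel. norm (x ^ n * F x) \<le> norm (fact n * (exp (real 1 * \<bar>x\<bar>) * F x))"
    proof (rule AE_I2)
      fix x
      have "\<bar>x\<bar> ^ n * \<bar>F x\<bar> \<le> (fact n * exp \<bar>x\<bar>) * \<bar>F x\<bar>"
        by (intro mult_right_mono power_le_fact_mult_exp) auto
      then show "norm (x ^ n * F x) \<le> norm (fact n * (exp (real 1 * \<bar>x\<bar>) * F x))"
        by (simp add: abs_mult power_abs)
    qed
  qed measurable
  have four: "(LINT x|lborel. iexp (t * x) * complex_of_real (F x)) = 0" for t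
  proof -
    \<comment> \<open>The integer \<open>m\<close> exceeds the frequency \<open>t\<close>, so
      \<open>exp (m * |x|) * |F x|\<close>, integrable by assumption, dominates all partial sums of
      the exponential series.\<close>
    obtain m :: nat where m: "\<bar>t\<bar> \<le> real m"
      using real_arch_simple by blast
    let ?s = "\<lambda>n x. (\<Sum>k<n. (\<i> * complex_of_real (t * x)) ^ k /\<^sub>R fact k) * complex_of_real (F x)"
    have "(\<lambda>n. LINT x|lborel. ?s n x) \<longlonglongrightarrow> (LINT x|lborel. iexp (t * x) * complex_of_real (F x))"
    proof (rule integral_dominated_convergence)
      show "integrable lborel (\<lambda>x. exp (m * \<bar>x\<bar>) * \<bar>F x\<bar>)"
        using integrable_abs[OF int[of m]] by (simp add: abs_mult)
      show "AE x in lborel. (\<lambda>n. ?s n x) \<longlonglongrightarrow> iexp (t * x) * complex_of_real (F x)"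
      proof (rule AE_I2)
        fix x
        have "(\<lambda>k. (\<i> * complex_of_real (t * x)) ^ k /\<^sub>R fact k) sums iexp (t * x)"
          by (rule exp_converges)
        then show "(\<lambda>n. ?s n x) \<longlonglongrightarrow> iexp (t * x) * complex_of_real (F x)"
          unfolding sums_def by (intro tendsto_intros)
      qed
      show "AE x in lborel. norm (?s n x) \<le> exp (m * \<bar>x\<bar>) * \<bar>F x\<bar>" for n
      proof (rule AE_I2)
        fix x
        have "cmod (\<Sum>k<n. (\<i> * complex_of_real (t * x)) ^ k /\<^sub>R fact k) \<le> exp (cmod (\<i> * complex_of_real (t * x)))"
          by (rule norm_exp_partial_sum_le)
        also have "\<dots> \<le> exp (m * \<bar>x\<bar>)"
          using m by (simp add: norm_mult abs_mult mult_right_mono)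
        finally show "norm (?s n x) \<le> exp (m * \<bar>x\<bar>) * \<bar>F x\<bar>"
          unfolding norm_mult by (intro mult_mono) auto
      qed
    qed measurable
    moreover have zero: "(LINT x|lborel. ?s n x) = 0" for n
    proof -
      have "?s n x = (\<Sum>k<n. (\<i> * complex_of_real t) ^ k / fact k * complex_of_real (x ^ k * F x))" for x
        unfolding sum_distrib_right
        by (intro sum.cong refl) (simp add: scaleR_conv_of_real field_simps power_mult_distrib)
      moreover have "integrable lborel (\<lambda>x. (\<i> * complex_of_real t) ^ k / fact k * complex_of_real (x ^ k * F x))" for k
        by (intro integrable_mult_right integrable_of_real pow)
      moreover have "(LINT x|lborel. (\<i> * complex_of_real t) ^ k / fact k * complex_of_real (x ^ k * F x)) = 0" for k
        by (simp only: integral_mult_right_zero integral_complex_of_real mom of_real_0 mult_zero_right)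
      ultimately show ?thesis
        by (simp only: Bochner_Integration.integral_sum sum.neutral_const)
    qed
    ultimately show ?thesis
      unfolding zero by (simp add: LIMSEQ_const_iff)
  qed
  define P N where "P x = max 0 (F x)" and "N x = max 0 (- F x)" for x
  have [measurable]: "P \<in> borel_measurable borel" "N \<in> borel_measurable borel"
    unfolding P_def N_def by measurable
  have intP: "integrable lborel P" and intN: "integrable lborel N"
    unfolding P_def N_def using intF by auto
  have FPN: "F x = P x - N x" for x
    by (simp add: P_def N_def)
  define c where "c = (LINT x|lborel. P x)"
  have cN: "c = (LINT x|lborel. N x)"
    using mom[of 0] intP intN by (simp add: FPN c_def)
  have nonneg: "P x \<ge> 0" "N x \<ge> 0" for x
    by (auto simp: P_def N_def)
  show ?thesis
  \<comment> \<open>The zeroth moment vanishes, so both parts have the same mass \<open>c\<close>.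
    Only a positive \<open>c\<close> allows normalising them to probability measures; if it is zero,
    both parts vanish almost everywhere.\<close>
  proof (cases "c = 0")
    case True
    have "AE x in lborel. P x = 0" "AE x in lborel. N x = 0"
      using integral_nonneg_eq_0_iff_AE[OF intP] integral_nonneg_eq_0_iff_AE[OF intN] nonneg True cN c_def
      by auto
    then show ?thesis
      by eventually_elim (simp add: FPN)
  next
    case False
    then have c: "c > 0"
      unfolding c_def using Bochner_Integration.integral_nonneg[of lborel P] nonneg by (simp add: order_less_le)
    have dist: "real_distribution (density lborel (\<lambda>x. ennreal (f x / c)))"
      if [measurable]: "f \<in> borel_measurable borel" and f: "integrable lborel f" "\<And>x. f x \<ge> 0" "c = (LINT x|lborel. f x)" for f
      unfolding real_distribution_def real_distribution_axioms_def
    proof (intro conjI prob_spaceI)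
      have "(\<integral>\<^sup>+x. ennreal (f x / c) \<partial>lborel) = ennreal (LINT x|lborel. f x / c)"
        using f c by (intro nn_integral_eq_integral) auto
      also have "\<dots> = 1"
        using f c by simp
      finally show "emeasure (density lborel (\<lambda>x. ennreal (f x / c)))
          (space (density lborel (\<lambda>x. ennreal (f x / c)))) = 1"
        by (simp add: emeasure_density)
    qed simp
    have char: "char (density lborel (\<lambda>x. ennreal (f x / c))) t
        = (LINT x|lborel. iexp (t * x) * complex_of_real (f x)) / c"
      if [measurable]: "f \<in> borel_measurable borel" and f: "\<And>x. f x \<ge> 0" for f t
    proof -
      have "char (density lborel (\<lambda>x. ennreal (f x / c))) t = (LINT x|lborel. (f x / c) *\<^sub>R iexp (t * x))"
        unfolding char_def using f c by (intro integral_density) auto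
      also have "\<dots> = (LINT x|lborel. iexp (t * x) * complex_of_real (f x) / c)"
        by (simp add: scaleR_conv_of_real mult.commute)
      finally show ?thesis by simp
    qed
    have int_iexp: "integrable lborel (\<lambda>x. iexp (t * x) * complex_of_real (f x))"
      if [measurable]: "f \<in> borel_measurable borel" and "integrable lborel f" for f t
      by (rule Bochner_Integration.integrable_bound[OF that(2)]) (auto simp: norm_mult)
    have "char (density lborel (\<lambda>x. ennreal (P x / c))) = char (density lborel (\<lambda>x. ennreal (N x / c)))"
    proof
      fix t
      have "(LINT x|lborel. iexp (t * x) * complex_of_real (P x)) - (LINT x|lborel. iexp (t * x) * complex_of_real (N x)) = 0"
        using four[of t] int_iexp[of P t] int_iexp[of N t] intP intN by (simp add: FPN right_diff_distrib)
      then show "char (density lborel (\<lambda>x. ennreal (P x / c))) t = char (density lborel (\<lambda>x. ennreal (N x / c))) t"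
        using nonneg by (simp add: char)
    qed
    then have "density lborel (\<lambda>x. ennreal (P x / c)) = density lborel (\<lambda>x. ennreal (N x / c))"
      using nonneg intP intN cN c_def by (intro Levy_uniqueness dist) auto
    then have "AE x in lborel. ennreal (P x / c) = ennreal (N x / c)"
      by (intro sigma_finite_measure.density_unique[OF lborel.sigma_finite_measure_axioms]) auto
    then show ?thesis
    proof eventually_elim
      case (elim x)
      then have "P x / c = N x / c"
        using nonneg c by (subst (asm) ennreal_inj) auto
      then show ?case
        using c by (simp add: FPN)
    qed
  qed
qed

text \<open>The one-dimensional result is applied twice. For fixed \<open>b\<close>, the partial
  moment \<open>G b\<close> in the second variable has vanishing moments in the first, hence
  vanishes almost everywhere. As there are countably many \<open>b\<close>, one null set serves them
  all, and outside it the sections of \<open>F\<close> themselves have vanishing moments.\<close>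

lemma moments_zero_AE_zero_plane:
  fixes F :: "real \<times> real \<Rightarrow> real"
  assumes F: "F \<in> borel_measurable borel"
    and int: "\<And>k::nat. integrable lborel (\<lambda>x. exp (k * (\<bar>fst x\<bar> + \<bar>snd x\<bar>)) * F x)"
    and mom: "\<And>a b::nat. (LINT x|lborel. fst x ^ a * snd x ^ b * F x) = 0"
  shows "AE x in lborel. F x = 0"
proof -
  have prod: "(lborel :: (real \<times> real) measure) = lborel \<Otimes>\<^sub>M lborel"
    by (simp add: lborel_prod)
  have [measurable]: "F \<in> borel_measurable (lborel \<Otimes>\<^sub>M lborel)"
    using F by (simp add: lborel_prod)
  note int = int[unfolded prod]
  \<comment> \<open>A power of a coordinate costs one unit of exponential rate in that coordinate,
    and \<open>k + l + 1\<close> dominates both \<open>k + 1\<close> and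
    \<open>l + 1\<close>.\<close>
  have bound: "integrable (lborel \<Otimes>\<^sub>M lborel) (\<lambda>x. exp (k * \<bar>fst x\<bar>) * (exp (l * \<bar>snd x\<bar>) * (fst x ^ a * snd x ^ b * F x)))"
    for k l a b :: nat
  proof (rule Bochner_Integration.integrable_bound)
    let ?m = "k + l + 1"
    show "integrable (lborel \<Otimes>\<^sub>M lborel) (\<lambda>x. fact a * fact b * (exp (?m * (\<bar>fst x\<bar> + \<bar>snd x\<bar>)) * F x))"
      by (intro integrable_mult_right int)
    show "AE x in lborel \<Otimes>\<^sub>M lborel. norm (exp (k * \<bar>fst x\<bar>) * (exp (l * \<bar>snd x\<bar>) * (fst x ^ a * snd x ^ b * F x)))
        \<le> norm (fact a * fact b * (exp (?m * (\<bar>fst x\<bar> + \<bar>snd x\<bar>)) * F x))"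
    proof (rule AE_I2)
      fix x :: "real \<times> real"
      let ?x = "\<bar>fst x\<bar>" and ?y = "\<bar>snd x\<bar>"
      have "exp (k * ?x) * exp (l * ?y) * (?x ^ a * ?y ^ b) * \<bar>F x\<bar>
          \<le> exp (k * ?x) * exp (l * ?y) * ((fact a * exp ?x) * (fact b * exp ?y)) * \<bar>F x\<bar>"
        by (intro mult_right_mono mult_left_mono mult_mono power_le_fact_mult_exp) auto
      also have "\<dots> = fact a * fact b * exp (k * ?x + l * ?y + ?x + ?y) * \<bar>F x\<bar>"
        by (simp add: exp_add mult_ac)
      also have "\<dots> \<le> fact a * fact b * exp (?m * (?x + ?y)) * \<bar>F x\<bar>"
      proof -
        have "real k * ?x + real l * ?y + ?x + ?y \<le> real ?m * (?x + ?y)"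
          by (simp add: algebra_simps)
        then show ?thesis
          by (intro mult_right_mono mult_left_mono) auto
      qed
      finally show "norm (exp (k * ?x) * (exp (l * ?y) * (fst x ^ a * snd x ^ b * F x)))
        \<le> norm (fact a * fact b * (exp (?m * (?x + ?y)) * F x))"
        by (simp add: abs_mult power_abs mult_ac)
    qed
  qed measurable
  define G where "G b x = (LINT y|lborel. y ^ b * F (x, y))" for b x
  have [measurable]: "G b \<in> borel_measurable borel" for b
    unfolding G_def by measurable
  have G: "AE x in lborel. G b x = 0" for b
  proof (rule moments_zero_AE_zero)
    show "integrable lborel (\<lambda>x. exp (k * \<bar>x\<bar>) * G b x)" for k :: nat
      using lborel_pair.integrable_fst'[OF bound[of k 0 0 b]] by (simp add: G_def mult.assoc)
    show "(LINT x|lborel. x ^ n * G b x) = 0" for n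
      using lborel_pair.integral_fst'[OF bound[of 0 0 n b]] mom[of n b]
      by (simp add: G_def mult.assoc lborel_prod)
  qed measurable
  have "AE x in lborel. \<forall>k::nat. integrable lborel (\<lambda>y. exp (k * \<bar>y\<bar>) * F (x, y))"
    using lborel_pair.AE_integrable_fst'[OF bound[of 0 _ 0 0]]
    by (subst AE_all_countable) simp
  moreover have "AE x in lborel. \<forall>b. G b x = 0"
    using G by (subst AE_all_countable) simp
  ultimately have "AE x in lborel. AE y in lborel. F (x, y) = 0"
  proof eventually_elim
    case (elim x)
    then show ?case
      by (intro moments_zero_AE_zero) (auto simp: G_def)
  qed
  then have "AE x in lborel \<Otimes>\<^sub>M lborel. F x = 0"
    by (intro lborel_pair.AE_pair_measure) measurable
  then show ?thesis
    by (simp only: lborel_prod)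
qed

section \<open>Smooth functions and cutoffs\<close>

definition smooth :: "(real \<times> real \<Rightarrow> complex) \<Rightarrow> bool" where
  "smooth f \<longleftrightarrow> (\<forall>k. C_k k f)"

lemma pd_eqI: "(f has_derivative f') (at x) \<Longrightarrow> pd v f x = f' v"
  unfolding pd_def using frechet_derivative_at by metis

lemma has_derivative_pd: "f differentiable (at x) \<Longrightarrow> (f has_derivative (\<lambda>v. pd v f x)) (at x)"
  unfolding pd_def by (simp add: frechet_derivative_works)

lemma C_k_SucD: "C_k (Suc k) f \<Longrightarrow> C_k k f"
proof (induction k arbitrary: f)
  case 0
  then show ?case
    by (auto intro!: continuous_at_imp_continuous_on differentiable_imp_continuous_within)
qed auto

lemma C_k_const: "C_k k (\<lambda>x. c)"
proof (induction k arbitrary: c)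
  case (Suc k)
  have "pd v (\<lambda>x. c) = (\<lambda>x. 0)" for v
    by (rule ext, rule pd_eqI, rule has_derivative_const)
  then show ?case using Suc by simp
qed simp

lemma pd_add:
  "f differentiable (at x) \<Longrightarrow> g differentiable (at x) \<Longrightarrow> pd v (\<lambda>x. f x + g x) x = pd v f x + pd v g x"
  by (rule pd_eqI) (intro has_derivative_add has_derivative_pd)

lemma pd_mult:
  "f differentiable (at x) \<Longrightarrow> g differentiable (at x) \<Longrightarrow>
    pd v (\<lambda>x. f x * g x) x = f x * pd v g x + pd v f x * g x"
  by (rule pd_eqI) (intro has_derivative_mult has_derivative_pd)

lemma C_k_add: "C_k k f \<Longrightarrow> C_k k g \<Longrightarrow> C_k k (\<lambda>x. f x + g x)"
proof (induction k arbitrary: f g)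
  case 0
  then show ?case by (auto intro: continuous_intros)
next
  case (Suc k)
  have "pd v (\<lambda>x. f x + g x) = (\<lambda>x. pd v f x + pd v g x)" for v
    using Suc.prems by (intro ext pd_add) auto
  with Suc show ?case by (auto intro!: differentiable_add)
qed

lemma C_k_mult: "C_k k f \<Longrightarrow> C_k k g \<Longrightarrow> C_k k (\<lambda>x. f x * g x)"
proof (induction k arbitrary: f g)
  case 0
  then show ?case by (auto intro: continuous_intros)
next
  case (Suc k)
  have "pd v (\<lambda>x. f x * g x) = (\<lambda>x. f x * pd v g x + pd v f x * g x)" for v
    using Suc.prems by (intro ext pd_mult) auto
  moreover have "C_k k (\<lambda>x. f x * pd v g x + pd v f x * g x)" for v
    using Suc.prems C_k_SucD[OF Suc.prems(1)] C_k_SucD[OF Suc.prems(2)]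
    by (intro C_k_add Suc.IH) (simp_all del: split_paired_All)
  ultimately show ?case using Suc.prems by (auto intro!: differentiable_mult)
qed

lemma smooth_const: "smooth (\<lambda>x. c)"
  by (simp add: smooth_def C_k_const)

lemma smooth_add: "smooth f \<Longrightarrow> smooth g \<Longrightarrow> smooth (\<lambda>x. f x + g x)"
  by (simp add: smooth_def C_k_add)

lemma smooth_mult: "smooth f \<Longrightarrow> smooth g \<Longrightarrow> smooth (\<lambda>x. f x * g x)"
  by (simp add: smooth_def C_k_mult)

lemma smooth_power: "smooth f \<Longrightarrow> smooth (\<lambda>x. f x ^ n)"
  by (induction n) (simp_all add: smooth_const smooth_mult)

lemma smooth_pd: "smooth f \<Longrightarrow> smooth (pd v f)"
  unfolding smooth_def by (metis C_k.simps(2))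

lemma smooth_imp_differentiable: "smooth f \<Longrightarrow> f differentiable (at x)"
  unfolding smooth_def by (metis C_k.simps(2))

lemma smooth_imp_continuous: "smooth f \<Longrightarrow> continuous_on UNIV f"
  unfolding smooth_def by (metis C_k.simps(1))

lemma smooth_imp_measurable: "smooth f \<Longrightarrow> f \<in> borel_measurable borel"
  by (rule borel_measurable_continuous_onI[OF smooth_imp_continuous])

lemma smooth_bounded_linear:
  fixes l :: "real \<times> real \<Rightarrow> real"
  assumes "bounded_linear l"
  shows "smooth (\<lambda>x. complex_of_real (l x))"
proof -
  have d: "((\<lambda>x. complex_of_real (l x)) has_derivative (\<lambda>v. complex_of_real (l v))) (at x)" for x
    by (intro has_derivative_of_real bounded_linear.has_derivative[OF assms] has_derivative_ident)
  have "C_k k (\<lambda>x. complex_of_real (l x))" for k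
  proof (cases k)
    case 0
    then show ?thesis
      by (auto intro!: continuous_intros linear_continuous_on assms)
  next
    case (Suc k')
    have "pd v (\<lambda>x. complex_of_real (l x)) = (\<lambda>x. complex_of_real (l v))" for v
      by (rule ext, rule pd_eqI, rule d)
    moreover have "(\<lambda>x. complex_of_real (l x)) differentiable (at x)" for x
      unfolding differentiable_def using d by blast
    ultimately show ?thesis
      using Suc by (simp add: C_k_const del: split_paired_All)
  qed
  then show ?thesis by (simp add: smooth_def)
qed

lemma smooth_fst: "smooth (\<lambda>x. complex_of_real (fst x))"
  by (intro smooth_bounded_linear bounded_linear_fst)

lemma smooth_snd: "smooth (\<lambda>x. complex_of_real (snd x))"
  by (intro smooth_bounded_linear bounded_linear_snd)

text \<open>The family \<open>\<psi>\<close> is closed under differentiation up to combinations of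
  two members. Induction on the order of differentiability, for all members at once, then replaces a
  chain rule for higher derivatives. It serves the flat functions, indexed by their power, and the
  exponential as a one-member family.\<close>

lemma smooth_compose:
  fixes \<psi> :: "'i \<Rightarrow> real \<Rightarrow> real" and q :: "real \<times> real \<Rightarrow> real"
  assumes deriv: "\<And>i s. (\<psi> i has_real_derivative a i * \<psi> (\<alpha> i) s + b i * \<psi> (\<beta> i) s) (at s)"
    and q: "smooth (\<lambda>x. complex_of_real (q x))" and q': "\<And>x. (q has_derivative q' x) (at x)"
  shows "smooth (\<lambda>x. complex_of_real (\<psi> i (q x)))"
proof -
  have d: "((\<lambda>x. complex_of_real (\<psi> i (q x))) has_derivative
      (\<lambda>v. complex_of_real (a i * \<psi> (\<alpha> i) (q x) + b i * \<psi> (\<beta> i) (q x)) * complex_of_real (q' x v))) (at x)" for i x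
  proof -
    have "((\<lambda>x. \<psi> i (q x)) has_derivative (\<lambda>v. (a i * \<psi> (\<alpha> i) (q x) + b i * \<psi> (\<beta> i) (q x)) * q' x v)) (at x)"
      using has_derivative_compose[OF q' deriv[of i "q x", unfolded has_field_derivative_def]] by simp
    from has_derivative_of_real[OF this] show ?thesis by simp
  qed
  have qv: "pd v (\<lambda>x. complex_of_real (q x)) x = complex_of_real (q' x v)" for v x
    by (intro pd_eqI has_derivative_of_real q')
  have "C_k k (\<lambda>x. complex_of_real (\<psi> i (q x)))" for k i
  proof (induction k arbitrary: i)
    case 0
    show ?case
      unfolding C_k.simps by (intro continuous_at_imp_continuous_on ballI has_derivative_continuous[OF d])
  next
    case (Suc k)
    have "pd v (\<lambda>x. complex_of_real (\<psi> i (q x))) = (\<lambda>x.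
        (complex_of_real (a i) * complex_of_real (\<psi> (\<alpha> i) (q x)) + complex_of_real (b i) * complex_of_real (\<psi> (\<beta> i) (q x)))
          * pd v (\<lambda>x. complex_of_real (q x)) x)" for v
      unfolding qv by (rule ext, subst pd_eqI[OF d]) simp
    moreover have "C_k k (pd v (\<lambda>x. complex_of_real (q x)))" for v
      using smooth_pd[OF q] by (simp add: smooth_def)
    moreover have "(\<lambda>x. complex_of_real (\<psi> i (q x))) differentiable (at x)" for x
      unfolding differentiable_def using d by blast
    ultimately show ?case
      using Suc by (simp del: split_paired_All) (intro allI C_k_add C_k_mult C_k_const; simp)
  qed
  then show ?thesis by (simp add: smooth_def)
qed

lemma smooth_quadratic:
  "smooth (\<lambda>x. complex_of_real (a + b * ((fst x)\<^sup>2 + (snd x)\<^sup>2)))"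
proof -
  have "smooth (\<lambda>x. complex_of_real a + complex_of_real b * (complex_of_real (fst x) ^ 2 + complex_of_real (snd x) ^ 2))"
    by (intro smooth_add smooth_const smooth_mult smooth_power smooth_fst smooth_snd)
  then show ?thesis by simp
qed

lemma has_derivative_quadratic:
  "((\<lambda>x::real \<times> real. a + b * ((fst x)\<^sup>2 + (snd x)\<^sup>2)) has_derivative (\<lambda>v. 2 * b * (x \<bullet> v))) (at x)"
  by (auto intro!: derivative_eq_intros ext simp: inner_prod_def algebra_simps)

section \<open>Smooth cutoffs with compact support\<close>

text \<open>The derivatives of \<open>exp (- 1 / s)\<close> are combinations of these functions;
  carrying the power \<open>n\<close> as a parameter closes the family under
  differentiation.\<close>

definition flat :: "nat \<Rightarrow> real \<Rightarrow> real" where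
  "flat n s = (if s \<le> 0 then 0 else exp (- 1 / s) / s ^ n)"

lemma flat_nonneg: "0 \<le> flat n s"
  by (simp add: flat_def)

lemma flat_le_fact: "flat n s \<le> fact n"
proof (cases "s \<le> 0")
  case False
  then have "(1 / s) ^ n \<le> fact n * exp (1 / s)"
    by (intro power_le_fact_mult_exp) auto
  with False show ?thesis
    by (simp add: flat_def exp_minus field_simps)
qed (simp add: flat_def)

text \<open>Two powers of \<open>s\<close> are traded for a larger index. The quadratic bound makes
  the difference quotient at 0 tend to 0, which is the delicate point of the derivative
  formula.\<close>

lemma flat_le_square: "flat n s \<le> fact (n + 2) * s\<^sup>2"
proof (cases "s \<le> 0")
  case False
  then have "flat n s = flat (n + 2) s * s\<^sup>2"
    by (simp add: flat_def power_add power2_eq_square)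
  also have "\<dots> \<le> fact (n + 2) * s\<^sup>2"
    by (intro mult_right_mono flat_le_fact) auto
  finally show ?thesis .
qed (simp add: flat_def)

lemma flat_deriv:
  "(flat n has_real_derivative (- real n) * flat (n + 1) s + 1 * flat (n + 2) s) (at s)"
proof -
  consider "s < 0" | "s = 0" | "s > 0" by linarith
  then show ?thesis
  proof cases
    case 1
    have "((\<lambda>s. 0) has_real_derivative 0) (at s)" by simp
    then have "(flat n has_real_derivative 0) (at s)"
      by (rule has_field_derivative_transform_within_open[where S = "{..<0}"])
         (use 1 in \<open>auto simp: flat_def\<close>)
    with 1 show ?thesis by (simp add: flat_def)
  next
    case 2
    have "((\<lambda>h. (flat n (0 + h) - flat n 0) / h) \<longlongrightarrow> 0) (at 0)"
    proof (rule Lim_null_comparison)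
      show "((\<lambda>h. fact (n + 2) * \<bar>h\<bar>) \<longlongrightarrow> 0) (at (0::real))"
        by (auto intro!: tendsto_eq_intros)
      show "\<forall>\<^sub>F h in at 0. norm ((flat n (0 + h) - flat n 0) / h) \<le> fact (n + 2) * \<bar>h\<bar>"
      proof (rule eventually_at_filter[THEN iffD2], rule always_eventually, intro allI impI)
        fix h :: real assume "h \<noteq> 0"
        have "flat n h \<le> fact (n + 2) * \<bar>h\<bar> * \<bar>h\<bar>"
          using flat_le_square[of n h] by (simp add: power2_eq_square mult.assoc)
        then show "norm ((flat n (0 + h) - flat n 0) / h) \<le> fact (n + 2) * \<bar>h\<bar>"
          using \<open>h \<noteq> 0\<close> flat_nonneg[of n h] by (simp add: flat_def[of n 0] pos_divide_le_eq)
      qed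
    qed
    with 2 show ?thesis
      by (simp add: has_field_derivative_iff flat_def)
  next
    case 3
    have "((\<lambda>s. exp (- 1 / s) / s ^ n) has_real_derivative (- real n) * flat (n + 1) s + 1 * flat (n + 2) s) (at s)"
    proof -
      have 1: "((\<lambda>s. s ^ n) has_real_derivative real n * s ^ (n - 1)) (at s)"
        using DERIV_pow[of n s UNIV] by simp
      have 2: "((\<lambda>s. exp (- 1 / s)) has_real_derivative exp (- 1 / s) / s\<^sup>2) (at s)"
        using 3 by (auto intro!: derivative_eq_intros simp: power2_eq_square)
      have "(exp (- 1 / s) / s\<^sup>2 * s ^ n - exp (- 1 / s) * (real n * s ^ (n - 1))) / (s ^ n * s ^ n)
          = - real n * flat (n + 1) s + 1 * flat (n + 2) s"
      proof (cases n)
        case 0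
        with 3 show ?thesis by (simp add: flat_def power2_eq_square)
      next
        case (Suc m)
        with 3 show ?thesis by (simp add: flat_def field_simps power2_eq_square)
      qed
      moreover have "s ^ n \<noteq> 0" using 3 by simp
      ultimately show ?thesis
        using DERIV_divide[OF 2 1] by simp
    qed
    then show ?thesis
      by (rule has_field_derivative_transform_within_open[where S = "{0<..}"])
         (use 3 in \<open>auto simp: flat_def\<close>)
  qed
qed

text \<open>The cutoff proper is \<open>bump N 0\<close>, supported in the disc of radius
  \<open>N + 1\<close>; positive \<open>n\<close> occur in its derivatives. It tends pointwise to
  \<open>exp (- 1)\<close> instead of 1, and this common factor is cancelled whenever a limit is
  taken.\<close>

definition bump :: "nat \<Rightarrow> nat \<Rightarrow> real \<times> real \<Rightarrow> complex" where
  "bump N n x = complex_of_real (flat n (1 + (- 1 / (real (Suc N))\<^sup>2) * ((fst x)\<^sup>2 + (snd x)\<^sup>2)))"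

lemma smooth_bump: "smooth (bump N n)"
  unfolding bump_def
  by (rule smooth_compose[where \<psi> = flat, OF flat_deriv smooth_quadratic has_derivative_quadratic])

lemma pd_bump:
  "pd v (bump N n) x = (- of_nat n * bump N (n + 1) x + bump N (n + 2) x)
     * complex_of_real (2 * (- 1 / (real (Suc N))\<^sup>2) * (x \<bullet> v))"
proof (rule pd_eqI)
  let ?q = "\<lambda>x::real \<times> real. 1 + (- 1 / (real (Suc N))\<^sup>2) * ((fst x)\<^sup>2 + (snd x)\<^sup>2)"
  have "((\<lambda>x. flat n (?q x)) has_derivative (\<lambda>v. ((- real n) * flat (n + 1) (?q x) + 1 * flat (n + 2) (?q x))
      * (2 * (- 1 / (real (Suc N))\<^sup>2) * (x \<bullet> v)))) (at x)"
    by (rule has_derivative_compose[OF has_derivative_quadratic flat_deriv[unfolded has_field_derivative_def]])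
  then have "((\<lambda>x. complex_of_real (flat n (?q x))) has_derivative (\<lambda>v. complex_of_real (((- real n) * flat (n + 1) (?q x) + 1 * flat (n + 2) (?q x))
      * (2 * (- 1 / (real (Suc N))\<^sup>2) * (x \<bullet> v))))) (at x)"
    by (rule has_derivative_of_real)
  then show "(bump N n has_derivative (\<lambda>v. (- of_nat n * bump N (n + 1) x + bump N (n + 2) x)
     * complex_of_real (2 * (- 1 / (real (Suc N))\<^sup>2) * (x \<bullet> v)))) (at x)"
    unfolding bump_def by simp
qed

lemma bump_eq_0: "norm x \<ge> real (Suc N) \<Longrightarrow> bump N n x = 0"
proof -
  assume *: "norm x \<ge> real (Suc N)"
  have "(real (Suc N))\<^sup>2 \<le> (norm x)\<^sup>2"
    using * by (intro power_mono) auto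
  also have "(norm x)\<^sup>2 = (fst x)\<^sup>2 + (snd x)\<^sup>2"
    by (simp add: norm_prod_def)
  finally show ?thesis
    by (simp add: bump_def flat_def field_simps del: of_nat_Suc)
qed

lemma norm_bump_le: "cmod (bump N n x) \<le> fact n"
  using flat_le_fact flat_nonneg by (simp add: bump_def)

text \<open>The linear factor produced by each differentiation is bounded by the radius on the
  support, and off the support the product is zero. Against the factor \<open>1 / (N + 1)^2\<close>
  this leaves the decay \<open>1 / (N + 1)\<close>.\<close>

lemma norm_bump_inner_le:
  assumes "norm v = 1"
  shows "cmod (bump N n x * complex_of_real (x \<bullet> v)) \<le> fact n * real (Suc N)"
proof (cases "norm x \<ge> real (Suc N)")
  case False
  have "\<bar>x \<bullet> v\<bar> \<le> real (Suc N)"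
    using Cauchy_Schwarz_ineq2[of x v] False assms by simp
  then show ?thesis
    unfolding norm_mult by (intro mult_mono norm_bump_le) auto
qed (simp add: bump_eq_0)

lemma bump_tendsto: "(\<lambda>N. bump N 0 x) \<longlonglongrightarrow> complex_of_real (exp (- 1))"
proof -
  have "(\<lambda>N. 1 + (- 1 / (real (Suc N))\<^sup>2) * ((fst x)\<^sup>2 + (snd x)\<^sup>2)) \<longlonglongrightarrow> 1 + 0 * ((fst x)\<^sup>2 + (snd x)\<^sup>2)"
    by (intro tendsto_intros) real_asymp
  moreover have "isCont (flat 0) 1"
    using flat_deriv by (rule DERIV_isCont)
  ultimately have "(\<lambda>N. flat 0 (1 + (- 1 / (real (Suc N))\<^sup>2) * ((fst x)\<^sup>2 + (snd x)\<^sup>2))) \<longlonglongrightarrow> flat 0 1"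
    by (intro isCont_tendsto_compose[of _ "flat 0"]) auto
  then show ?thesis
    unfolding bump_def by (intro tendsto_of_real) (simp add: flat_def)
qed

lemma norm_pd_bump_le:
  assumes "norm v = 1"
  shows "cmod (pd v (bump N 0) x) \<le> 4 / real (Suc N)"
proof -
  have "pd v (bump N 0) x = complex_of_real (- 2 / (real (Suc N))\<^sup>2) * (bump N 2 x * complex_of_real (x \<bullet> v))"
    by (simp add: pd_bump numeral_2_eq_2)
  then have "cmod (pd v (bump N 0) x) = 2 / (real (Suc N))\<^sup>2 * cmod (bump N 2 x * complex_of_real (x \<bullet> v))"
    by (simp add: norm_mult norm_divide norm_power del: of_nat_Suc)
  also have "\<dots> \<le> 2 / (real (Suc N))\<^sup>2 * (fact 2 * real (Suc N))"
    by (intro mult_left_mono norm_bump_inner_le assms) auto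
  also have "\<dots> = 4 / real (Suc N)"
    by (simp add: power2_eq_square fact_numeral field_simps del: of_nat_Suc)
  finally show ?thesis .
qed

text \<open>The constant is \<open>2 * fact 2 + 4 * (fact 4 + 2 * fact 3)\<close>. The decay
  obtained is quadratic in the radius; it is weakened to the rate of the first derivative so that
  one limit lemma treats both.\<close>

lemma norm_pd_pd_bump_le:
  assumes "norm v = 1"
  shows "cmod (pd v (pd v (bump N 0)) x) \<le> 148 / real (Suc N)"
proof -
  define R where "R = real (Suc N)"
  have R: "R \<ge> 1" by (simp add: R_def)
  define r where "r = complex_of_real (2 * (- 1 / R\<^sup>2))"
  have "pd v (bump N 0) = (\<lambda>x. bump N 2 x * complex_of_real ((2 * (- 1 / R\<^sup>2)) * (x \<bullet> v)))"
    by (simp add: pd_bump fun_eq_iff R_def numeral_2_eq_2 del: of_nat_Suc split_paired_All)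
  moreover have "((\<lambda>x. complex_of_real ((2 * (- 1 / R\<^sup>2)) * (x \<bullet> v)))
      has_derivative (\<lambda>w. complex_of_real ((2 * (- 1 / R\<^sup>2)) * (w \<bullet> v)))) (at x)"
    by (intro has_derivative_of_real has_derivative_mult_right has_derivative_inner_left has_derivative_ident)
  then have "pd v (\<lambda>x. complex_of_real ((2 * (- 1 / R\<^sup>2)) * (x \<bullet> v))) x = r * (v \<bullet> v)"
      "(\<lambda>x. complex_of_real ((2 * (- 1 / R\<^sup>2)) * (x \<bullet> v))) differentiable (at x)"
    by (auto simp: pd_eqI r_def differentiable_def)
  ultimately have "pd v (pd v (bump N 0)) x = bump N 2 x * (r * (v \<bullet> v))
      + pd v (bump N 2) x * (r * (x \<bullet> v))"
    by (simp add: pd_mult smooth_bump smooth_imp_differentiable r_def del: of_real_mult of_real_divide of_real_minus)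
       (simp add: mult_ac)
  also have "pd v (bump N 2) x = (- of_nat 2 * bump N (2 + 1) x + bump N (2 + 2) x)
     * complex_of_real (2 * (- 1 / (real (Suc N))\<^sup>2) * (x \<bullet> v))"
    by (rule pd_bump)
  also have "(2::nat) + 1 = 3" by simp
  also have "(2::nat) + 2 = 4" by simp
  also have "bump N 2 x * (r * (v \<bullet> v)) + (- of_nat 2 * bump N 3 x + bump N 4 x)
     * complex_of_real (2 * (- 1 / (real (Suc N))\<^sup>2) * (x \<bullet> v)) * (r * (x \<bullet> v)) = r * bump N 2 x + r * r * (bump N 4 x * (x \<bullet> v) - 2 * (bump N 3 x * (x \<bullet> v))) * (x \<bullet> v)"
    using assms by (simp add: r_def R_def power2_norm_eq_inner[symmetric] algebra_simps
        del: of_nat_Suc)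
  finally have eq: "pd v (pd v (bump N 0)) x
      = r * bump N 2 x + r * r * (bump N 4 x * (x \<bullet> v) - 2 * (bump N 3 x * (x \<bullet> v))) * (x \<bullet> v)" .
  have cr: "cmod r = 2 / R\<^sup>2"
    using R by (simp add: r_def norm_mult norm_divide norm_power)
  show ?thesis
  proof (cases "norm x \<ge> R")
    case True
    then show ?thesis
      unfolding eq using R by (simp add: bump_eq_0 R_def)
  next
    case False
    then have xv: "\<bar>x \<bullet> v\<bar> \<le> R"
      using Cauchy_Schwarz_ineq2[of x v] assms by simp
    have "cmod (pd v (pd v (bump N 0)) x) \<le> cmod r * cmod (bump N 2 x)
        + cmod r * cmod r * (cmod (bump N 4 x * (x \<bullet> v)) + 2 * cmod (bump N 3 x * (x \<bullet> v))) * \<bar>x \<bullet> v\<bar>"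
      unfolding eq
      by (rule order_trans[OF norm_triangle_ineq], unfold norm_mult norm_of_real)
         (intro add_mono mult_right_mono mult_left_mono order_trans[OF norm_triangle_ineq4], auto simp: norm_mult)
    also have "\<dots> \<le> 2 / R\<^sup>2 * fact 2 + 2 / R\<^sup>2 * (2 / R\<^sup>2) * (fact 4 * R + 2 * (fact 3 * R)) * R"
      unfolding cr using xv R
      by (intro add_mono mult_mono mult_left_mono norm_bump_le norm_bump_inner_le[OF assms, of N, folded R_def]) auto
    also have "\<dots> = 148 / R\<^sup>2"
      using R by (simp add: fact_numeral field_simps power2_eq_square)
    also have "\<dots> \<le> 148 / R"
      using R by (intro divide_left_mono) (auto simp: power2_eq_square)
    finally show ?thesis by (simp add: R_def)
  qed
qed

lemma bump_mult_test_function: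
  assumes "smooth f"
  shows "(\<lambda>x. bump N 0 x * f x) \<in> test_functions"
proof -
  have "bounded {x. bump N 0 x * f x \<noteq> 0}"
    by (rule bounded_subset[OF bounded_cball[of 0 "real (Suc N)"]])
       (use bump_eq_0 in \<open>force simp del: of_nat_Suc\<close>)
  moreover have "smooth (\<lambda>x. bump N 0 x * f x)"
    by (intro smooth_mult smooth_bump assms)
  ultimately show ?thesis
    by (simp add: test_functions_def compact_closure smooth_def)
qed

section \<open>Removing the cutoff from weak identities\<close>

lemma integral_mult_bounded_tendsto:
  fixes h :: "real \<times> real \<Rightarrow> complex"
  assumes h: "integrable lborel h" and [measurable]: "\<And>N. b N \<in> borel_measurable borel"
    and B: "\<And>N x. cmod (b N x) \<le> B" and lim: "\<And>x. (\<lambda>N. b N x) \<longlonglongrightarrow> c"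
  shows "(\<lambda>N. LINT x|lborel. h x * b N x) \<longlonglongrightarrow> c * (LINT x|lborel. h x)"
    and "integrable lborel (\<lambda>x. h x * b N x)"
proof -
  have [measurable]: "h \<in> borel_measurable lborel" using h by auto
  have int: "integrable lborel (\<lambda>x. B * cmod (h x))"
    using h by auto
  have bd: "AE x in lborel. norm (h x * b N x) \<le> B * cmod (h x)" for N
    using B by (auto simp: norm_mult mult.commute[of B] intro!: mult_left_mono)
  have "(\<lambda>N. LINT x|lborel. h x * b N x) \<longlonglongrightarrow> (LINT x|lborel. h x * c)"
    by (rule integral_dominated_convergence[OF _ _ int _ bd]) (auto intro!: tendsto_intros lim)
  then show "(\<lambda>N. LINT x|lborel. h x * b N x) \<longlonglongrightarrow> c * (LINT x|lborel. h x)"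
    by (simp add: mult.commute)
  show "integrable lborel (\<lambda>x. h x * b N x)"
    by (rule Bochner_Integration.integrable_bound[OF int]) (use bd[of N] in auto)
qed

lemma integral_mult_bump_tendsto:
  assumes u: "sq_integrable u" and f: "sq_integrable f"
  shows "(\<lambda>N. LINT x|lborel. u x * (bump N 0 x * f x)) \<longlonglongrightarrow> exp (- 1) * (LINT x|lborel. u x * f x)"
    and "integrable lborel (\<lambda>x. u x * (bump N 0 x * f x))"
  using integral_mult_bounded_tendsto[OF integrable_mult_sq_integrable[OF u f], of "\<lambda>N. bump N 0" 1 "exp (- 1)"]
    norm_bump_le[of _ 0] bump_tendsto smooth_imp_measurable[OF smooth_bump]
  by (simp_all add: exp_of_real[symmetric] mult_ac)

lemma integral_mult_vanishing_tendsto: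
  fixes b :: "nat \<Rightarrow> real \<times> real \<Rightarrow> complex"
  assumes u: "sq_integrable u" and f: "sq_integrable f" and b: "\<And>N. b N \<in> borel_measurable borel"
    and B: "\<And>N x. cmod (b N x) \<le> B / real (Suc N)"
  shows "(\<lambda>N. LINT x|lborel. u x * (b N x * f x)) \<longlonglongrightarrow> 0"
    and "integrable lborel (\<lambda>x. u x * (b N x * f x))"
proof -
  have "B \<ge> 0"
    using order_trans[OF norm_ge_zero B[of 0 0]] by simp
  then have B': "cmod (b N x) \<le> B" for N x
    using order_trans[OF B[of N x], of B] by (simp add: field_simps)
  have lim: "(\<lambda>N. b N x) \<longlonglongrightarrow> 0" for x
  proof (rule Lim_null_comparison)
    show "(\<lambda>N. B / real (Suc N)) \<longlonglongrightarrow> 0" by real_asymp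
    show "\<forall>\<^sub>F N in sequentially. norm (b N x) \<le> B / real (Suc N)"
      by (intro always_eventually allI B)
  qed
  show "(\<lambda>N. LINT x|lborel. u x * (b N x * f x)) \<longlonglongrightarrow> 0" "integrable lborel (\<lambda>x. u x * (b N x * f x))"
    using integral_mult_bounded_tendsto[OF integrable_mult_sq_integrable[OF u f] b B' lim]
    by (simp_all add: mult_ac)
qed

text \<open>The integrals with the cutoff inserted are all zero, and they converge to a nonzero
  multiple of the integral in question.\<close>

lemma test_orthogonal_imp_smooth_orthogonal:
  assumes zero: "\<And>\<phi>. \<phi> \<in> test_functions \<Longrightarrow> (LINT x|lborel. u x * \<phi> x) = 0"
    and u: "sq_integrable u" and f: "smooth f" "sq_integrable f"
  shows "(LINT x|lborel. u x * f x) = 0"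
proof -
  have "(\<lambda>N. 0) \<longlonglongrightarrow> exp (- 1) * (LINT x|lborel. u x * f x)"
    using integral_mult_bump_tendsto(1)[OF u f(2)] by (simp add: zero bump_mult_test_function[OF f(1)])
  then show ?thesis
    by (simp add: LIMSEQ_const_iff)
qed

text \<open>The identity is tested with cutoff times \<open>f\<close>. The product rule leaves an
  error term in which the derivative, of order \<open>1 / N\<close>, falls on the cutoff. The other
  terms converge to their values without cutoff times \<open>exp (- 1)\<close>.\<close>

lemma has_weak_deriv_smooth:
  assumes w: "has_weak_deriv v u w" and v: "norm v = 1"
    and f: "smooth f" "sq_integrable f" "sq_integrable (pd v f)"
  shows "(LINT x|lborel. rep_l2 u x * pd v f x) = - (LINT x|lborel. rep_l2 w x * f x)"
proof -
  let ?u = "rep_l2 u" and ?w = "rep_l2 w"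
  note [simp] = sq_integrable_rep_l2
  note bm = smooth_imp_measurable[OF smooth_pd[OF smooth_bump]]
  have "(LINT x|lborel. ?u x * (bump N 0 x * pd v f x)) + (LINT x|lborel. ?u x * (pd v (bump N 0) x * f x))
      = - (LINT x|lborel. ?w x * (bump N 0 x * f x))" for N
  proof -
    have "(LINT x|lborel. ?u x * (bump N 0 x * pd v f x)) + (LINT x|lborel. ?u x * (pd v (bump N 0) x * f x))
        = (LINT x|lborel. ?u x * (bump N 0 x * pd v f x) + ?u x * (pd v (bump N 0) x * f x))"
      using f by (intro Bochner_Integration.integral_add[symmetric] integral_mult_bump_tendsto(2)
          integral_mult_vanishing_tendsto(2)[where B = 4 and b = "\<lambda>N. pd v (bump N 0)"] norm_pd_bump_le v bm) auto
    also have "\<dots> = (LINT x|lborel. ?u x * pd v (\<lambda>x. bump N 0 x * f x) x)"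
      by (simp add: pd_mult smooth_bump f smooth_imp_differentiable distrib_left)
    also have "\<dots> = - (LINT x|lborel. ?w x * (bump N 0 x * f x))"
      using w bump_mult_test_function[OF f(1), of N] unfolding has_weak_deriv_def by blast
    finally show ?thesis .
  qed
  moreover have "(\<lambda>N. (LINT x|lborel. ?u x * (bump N 0 x * pd v f x)) + (LINT x|lborel. ?u x * (pd v (bump N 0) x * f x)))
      \<longlonglongrightarrow> exp (- 1) * (LINT x|lborel. ?u x * pd v f x) + 0"
    using f by (intro tendsto_add integral_mult_bump_tendsto(1)
        integral_mult_vanishing_tendsto(1)[where B = 4] norm_pd_bump_le v bm) auto
  moreover have "(\<lambda>N. - (LINT x|lborel. ?w x * (bump N 0 x * f x))) \<longlonglongrightarrow> - (exp (- 1) * (LINT x|lborel. ?w x * f x))"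
    using f by (intro tendsto_minus integral_mult_bump_tendsto(1)) auto
  ultimately have "exp (- 1) * (LINT x|lborel. ?u x * pd v f x) + 0 = - (exp (- 1) * (LINT x|lborel. ?w x * f x))"
    using LIMSEQ_unique by simp
  then have "exp (- 1) * (LINT x|lborel. ?u x * pd v f x) = exp (- 1) * - (LINT x|lborel. ?w x * f x)"
    by simp
  then show ?thesis
    by (simp only: mult_left_cancel[OF exp_not_eq_zero])
qed

text \<open>Differentiating cutoff times \<open>f\<close> twice gives two error terms per
  coordinate, with one or two derivatives on the cutoff. They are paired with \<open>pd v f\<close>
  and with \<open>f\<close>, so square integrability of these makes them vanish in the
  limit.\<close>

lemma has_weak_laplacian_smooth:
  assumes w: "has_weak_laplacian u w" and f: "smooth f" "sq_integrable f"
    and f': "\<And>v. v \<in> {(1, 0), (0, 1)} \<Longrightarrow> sq_integrable (pd v f)"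
      "\<And>v. v \<in> {(1, 0), (0, 1)} \<Longrightarrow> sq_integrable (pd v (pd v f))"
  shows "(LINT x|lborel. rep_l2 u x * (pd (1, 0) (pd (1, 0) f) x + pd (0, 1) (pd (0, 1) f) x))
    = (LINT x|lborel. rep_l2 w x * f x)"
proof -
  let ?u = "rep_l2 u" and ?w = "rep_l2 w"
  note [simp] = sq_integrable_rep_l2
  note bm = smooth_imp_measurable[OF smooth_pd[OF smooth_bump]]
    smooth_imp_measurable[OF smooth_pd[OF smooth_pd[OF smooth_bump]]]
  define L where "L v N x = ?u x * (bump N 0 x * pd v (pd v f) x) + (2 * (?u x * (pd v (bump N 0) x * pd v f x))
       + ?u x * (pd v (pd v (bump N 0)) x * f x))" for v N x
  have L_eq: "L v N x = ?u x * pd v (pd v (\<lambda>x. bump N 0 x * f x)) x" for v N x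
  proof -
    have "pd v (\<lambda>x. bump N 0 x * f x) = (\<lambda>x. bump N 0 x * pd v f x + pd v (bump N 0) x * f x)"
      by (simp add: fun_eq_iff pd_mult smooth_bump f smooth_imp_differentiable)
    then show ?thesis
      by (simp add: L_def pd_mult pd_add smooth_pd smooth_bump f smooth_imp_differentiable
          differentiable_mult algebra_simps)
  qed
  have L_int: "integrable lborel (L v N)" and L_lim: "(\<lambda>N. LINT x|lborel. L v N x) \<longlonglongrightarrow> exp (- 1) * (LINT x|lborel. ?u x * pd v (pd v f) x) + (2 * 0 + 0)"
    if ax: "v \<in> {(1, 0), (0, 1)}" for v N
  proof -
    have v: "norm v = 1" using ax by (auto simp: norm_prod_def)
    note f' = f'[OF ax]
    have i1: "integrable lborel (\<lambda>x. ?u x * (bump N 0 x * pd v (pd v f) x))" for N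
      using f' by (intro integral_mult_bump_tendsto(2)) auto
    have i2: "integrable lborel (\<lambda>x. ?u x * (pd v (bump N 0) x * pd v f x))" for N
      using f' by (intro integral_mult_vanishing_tendsto(2)[where B = 4 and b = "\<lambda>N. pd v (bump N 0)"] norm_pd_bump_le v bm) auto
    have i3: "integrable lborel (\<lambda>x. ?u x * (pd v (pd v (bump N 0)) x * f x))" for N
      using f by (intro integral_mult_vanishing_tendsto(2)[where B = 148 and b = "\<lambda>N. pd v (pd v (bump N 0))"] norm_pd_pd_bump_le v bm) auto
    show "integrable lborel (L v N)"
      unfolding L_def by (intro Bochner_Integration.integrable_add integrable_mult_right i1 i2 i3)
    have "(LINT x|lborel. L v N x) = (LINT x|lborel. ?u x * (bump N 0 x * pd v (pd v f) x))
      + (2 * (LINT x|lborel. ?u x * (pd v (bump N 0) x * pd v f x))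
       + (LINT x|lborel. ?u x * (pd v (pd v (bump N 0)) x * f x)))" for N
      unfolding L_def by (simp add: i1 i2 i3 Bochner_Integration.integrable_add integrable_mult_right)
    then show "(\<lambda>N. LINT x|lborel. L v N x) \<longlonglongrightarrow> exp (- 1) * (LINT x|lborel. ?u x * pd v (pd v f) x) + (2 * 0 + 0)"
      using f f' by (simp only:) (intro tendsto_add tendsto_mult_left integral_mult_bump_tendsto(1)
        integral_mult_vanishing_tendsto(1)[where B = 4 and b = "\<lambda>N. pd v (bump N 0)"]
        integral_mult_vanishing_tendsto(1)[where B = 148 and b = "\<lambda>N. pd v (pd v (bump N 0))"]
        norm_pd_bump_le norm_pd_pd_bump_le v bm; simp)
  qed
  have n: "(1, 0) \<in> {(1, 0), (0, 1 :: real)}" "(0, 1) \<in> {(1 :: real, 0), (0, 1)}"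
    by auto
  have i: "integrable lborel (\<lambda>x. ?u x * pd v (pd v f) x)" if "v \<in> {(1, 0), (0, 1)}" for v
    using f'(2)[OF that] by (intro integrable_mult_sq_integrable) auto
  have "(LINT x|lborel. L (1, 0) N x) + (LINT x|lborel. L (0, 1) N x) = (LINT x|lborel. ?w x * (bump N 0 x * f x))" for N
  proof -
    have "(LINT x|lborel. L (1, 0) N x) + (LINT x|lborel. L (0, 1) N x) = (LINT x|lborel. L (1, 0) N x + L (0, 1) N x)"
      by (intro Bochner_Integration.integral_add[symmetric] L_int n)
    also have "\<dots> = (LINT x|lborel. ?w x * (bump N 0 x * f x))"
      using w bump_mult_test_function[OF f(1), of N] unfolding has_weak_laplacian_def L_eq distrib_left[symmetric] by blast
    finally show ?thesis .
  qed
  moreover have "(\<lambda>N. (LINT x|lborel. L (1, 0) N x) + (LINT x|lborel. L (0, 1) N x)) \<longlonglongrightarrow>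
     (exp (- 1) * (LINT x|lborel. ?u x * pd (1, 0) (pd (1, 0) f) x) + (2 * 0 + 0))
     + (exp (- 1) * (LINT x|lborel. ?u x * pd (0, 1) (pd (0, 1) f) x) + (2 * 0 + 0))"
    by (intro tendsto_add[OF L_lim L_lim] n)
  moreover have "(\<lambda>N. LINT x|lborel. ?w x * (bump N 0 x * f x)) \<longlonglongrightarrow> exp (- 1) * (LINT x|lborel. ?w x * f x)"
    using f by (intro integral_mult_bump_tendsto(1)) auto
  ultimately have "exp (- 1) * ((LINT x|lborel. ?u x * pd (1, 0) (pd (1, 0) f) x)
      + (LINT x|lborel. ?u x * pd (0, 1) (pd (0, 1) f) x)) = exp (- 1) * (LINT x|lborel. ?w x * f x)"
    using LIMSEQ_unique by (simp add: distrib_left)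
  then have "(LINT x|lborel. ?u x * pd (1, 0) (pd (1, 0) f) x)
      + (LINT x|lborel. ?u x * pd (0, 1) (pd (0, 1) f) x) = (LINT x|lborel. ?w x * f x)"
    by (simp only: mult_left_cancel[OF exp_not_eq_zero])
  then show ?thesis
    by (simp add: distrib_left i[OF n(1)] i[OF n(2)])
qed

section \<open>Hermite functions\<close>

text \<open>The normalised Hermite functions, generated by the three-term recurrence that expresses
  multiplication by \<open>x\<close> through the neighbouring indices. The fourth root of
  \<open>pi\<close> normalises the Gaussian in the Lebesgue measure.\<close>

fun hermite :: "nat \<Rightarrow> real \<Rightarrow> real" where
  "hermite 0 x = exp (- x\<^sup>2 / 2) / sqrt (sqrt pi)"
| "hermite (Suc 0) x = sqrt 2 * x * hermite 0 x"
| "hermite (Suc (Suc n)) x =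
     (sqrt 2 * x * hermite (Suc n) x - sqrt (real (Suc n)) * hermite n x) / sqrt (real (Suc (Suc n)))"

text \<open>At \<open>n = 0\<close> the truncated index \<open>n - 1\<close> is again 0, but its
  coefficient \<open>sqrt 0\<close> removes the term. All later formulas with lowered indices rely
  on the same convention.\<close>

lemma mult_hermite:
  "x * hermite n x = (sqrt (real (n + 1)) * hermite (n + 1) x + sqrt (real n) * hermite (n - 1) x) / sqrt 2"
  by (cases n) (simp_all add: field_simps del: hermite.simps(1))

lemma hermite_0_deriv: "(hermite 0 has_real_derivative - x * hermite 0 x) (at x)"
proof -
  have "((\<lambda>x. exp (- x\<^sup>2 / 2)) has_real_derivative exp (- x\<^sup>2 / 2) * - x) (at x)"
    by (auto intro!: derivative_eq_intros)
  from DERIV_cdivide[OF this, of "sqrt (sqrt pi)"]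
  have "((\<lambda>x. exp (- x\<^sup>2 / 2) / sqrt (sqrt pi)) has_real_derivative - x * hermite 0 x) (at x)"
    by (simp add: mult.commute)
  moreover have "hermite 0 = (\<lambda>x. exp (- x\<^sup>2 / 2) / sqrt (sqrt pi))"
    by (rule ext) simp
  ultimately show ?thesis
    by (simp only:)
qed

text \<open>This is the lowering relation of the operator \<open>x + d/dx\<close>. Unlike the
  symmetric form derived from it below, it involves no index above \<open>n\<close>, so induction
  along the recurrence closes.\<close>

lemma hermite_deriv_aux:
  "(hermite n has_real_derivative sqrt 2 * sqrt (real n) * hermite (n - 1) x - x * hermite n x) (at x)"
proof (induction n rule: induct_nat_012)
  case 0
  then show ?case using hermite_0_deriv[of x] by (simp del: hermite.simps)
next
  case 1
  have "((\<lambda>x. sqrt 2 * x * hermite 0 x) has_real_derivative sqrt 2 * hermite 0 x - sqrt 2 * x * (x * hermite 0 x)) (at x)"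
    by (auto intro!: derivative_eq_intros hermite_0_deriv simp del: hermite.simps(1))
  then show ?case
    by (simp add: algebra_simps del: hermite.simps(1))
next
  case (ge2 n)
  have rec: "sqrt (real (Suc (Suc n))) * hermite (Suc (Suc n)) x = sqrt 2 * x * hermite (Suc n) x - sqrt (real (Suc n)) * hermite n x"
    by simp
  have sq: "sqrt (real (Suc (Suc n))) * sqrt (real (Suc (Suc n))) = Suc (Suc n)" "sqrt (real (Suc n)) * sqrt (real (Suc n)) = Suc n"
    "sqrt 2 * sqrt 2 = 2"
    by simp_all
  have xn: "sqrt 2 * (x * hermite n x) = sqrt (real (Suc n)) * hermite (Suc n) x + sqrt (real n) * hermite (n - 1) x"
    using mult_hermite[of x n] by simp
  have "((\<lambda>x. (sqrt 2 * x * hermite (Suc n) x - sqrt (real (Suc n)) * hermite n x) / sqrt (real (Suc (Suc n))))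
      has_real_derivative (sqrt 2 * hermite (Suc n) x
        + sqrt 2 * x * (sqrt 2 * sqrt (real (Suc n)) * hermite n x - x * hermite (Suc n) x)
        - sqrt (real (Suc n)) * (sqrt 2 * sqrt (real n) * hermite (n - 1) x - x * hermite n x)) / sqrt (real (Suc (Suc n)))) (at x)"
  proof -
    have A: "(hermite (Suc n) has_real_derivative sqrt 2 * sqrt (real (Suc n)) * hermite n x - x * hermite (Suc n) x) (at x)"
      using ge2(2) by simp
    have B: "((\<lambda>x. sqrt 2 * x) has_real_derivative sqrt 2) (at x)"
      by (auto intro!: derivative_eq_intros)
    show ?thesis
      by (rule DERIV_cong[OF DERIV_cdivide[OF DERIV_diff[OF DERIV_mult[OF B A] DERIV_cmult[OF ge2(1)]]]])
         (simp add: mult.commute del: hermite.simps of_nat_Suc)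
  qed
  moreover have eq: "sqrt 2 * hermite (Suc n) x
        + sqrt 2 * x * (sqrt 2 * sqrt (real (Suc n)) * hermite n x - x * hermite (Suc n) x)
        - sqrt (real (Suc n)) * (sqrt 2 * sqrt (real n) * hermite (n - 1) x - x * hermite n x)
      = sqrt (real (Suc (Suc n))) * (sqrt 2 * sqrt (real (Suc (Suc n))) * hermite (Suc n) x - x * hermite (Suc (Suc n)) x)"
  proof -
    have "sqrt 2 * hermite (Suc n) x
        + sqrt 2 * x * (sqrt 2 * sqrt (real (Suc n)) * hermite n x - x * hermite (Suc n) x)
        - sqrt (real (Suc n)) * (sqrt 2 * sqrt (real n) * hermite (n - 1) x - x * hermite n x)
      = sqrt 2 * hermite (Suc n) x + sqrt 2 * sqrt (real (Suc n)) * (sqrt 2 * (x * hermite n x) - sqrt (real n) * hermite (n - 1) x)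
        - x * (sqrt 2 * x * hermite (Suc n) x - sqrt (real (Suc n)) * hermite n x)"
      by (simp only: algebra_simps)
    also have "\<dots> = sqrt 2 * hermite (Suc n) x + sqrt 2 * (sqrt (real (Suc n)) * sqrt (real (Suc n))) * hermite (Suc n) x
        - x * (sqrt (real (Suc (Suc n))) * hermite (Suc (Suc n)) x)"
      unfolding xn rec by (simp only: algebra_simps)
    also have "\<dots> = sqrt 2 * (sqrt (real (Suc (Suc n))) * sqrt (real (Suc (Suc n)))) * hermite (Suc n) x
        - x * (sqrt (real (Suc (Suc n))) * hermite (Suc (Suc n)) x)"
      unfolding sq by (simp add: algebra_simps del: hermite.simps)
    finally show ?thesis
      by (simp only: algebra_simps)
  qed
  moreover have "hermite (Suc (Suc n)) = (\<lambda>x. (sqrt 2 * x * hermite (Suc n) x - sqrt (real (Suc n)) * hermite n x) / sqrt (real (Suc (Suc n))))"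
    by (rule ext) simp
  moreover have "sqrt (real (Suc (Suc n))) * (sqrt 2 * sqrt (real (Suc (Suc n))) * hermite (Suc n) x - x * hermite (Suc (Suc n)) x)
      / sqrt (real (Suc (Suc n))) = sqrt 2 * sqrt (real (Suc (Suc n))) * hermite (Suc n) x - x * hermite (Suc (Suc n)) x"
    by (simp del: hermite.simps of_nat_Suc)
  ultimately show ?case
    by (simp only: diff_Suc_1)
qed

lemma hermite_deriv:
  "(hermite n has_real_derivative (sqrt (real n) * hermite (n - 1) x - sqrt (real (n + 1)) * hermite (n + 1) x) / sqrt 2) (at x)"
proof -
  have "sqrt 2 * sqrt 2 = (2::real)" by simp
  then have "sqrt 2 * sqrt (real n) * hermite (n - 1) x - x * hermite n x
      = (sqrt (real n) * hermite (n - 1) x - sqrt (real (n + 1)) * hermite (n + 1) x) / sqrt 2"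
    unfolding mult_hermite by (simp add: field_simps)
  with hermite_deriv_aux show ?thesis by metis
qed

lemma borel_measurable_hermite [measurable]: "hermite n \<in> borel_measurable borel"
  by (intro borel_measurable_continuous_onI DERIV_continuous_on[OF DERIV_subset[OF hermite_deriv]]) auto

lemma linear_minus_quadratic_le: "k * t - t\<^sup>2 / 2 \<le> k\<^sup>2 - t\<^sup>2 / 4" for k t :: real
  using zero_le_power2[of "t / 2 - k"] by (simp add: power2_eq_square algebra_simps)

text \<open>Each step of the recurrence multiplies by \<open>x\<close>, and
  \<open>|x| \<le> exp |x|\<close> charges this to the exponential rate. The linear exponent is
  later absorbed by half of the Gaussian.\<close>

lemma hermite_bound_aux:
  "\<exists>C\<ge>0. \<forall>x. \<bar>hermite n x\<bar> \<le> C * exp (real n * \<bar>x\<bar> - x\<^sup>2 / 2)"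
proof (induction n rule: induct_nat_012)
  case 0
  show ?case
    by (rule exI[of _ "1 / sqrt (sqrt pi)"]) (simp add: field_simps)
next
  case 1
  have "\<bar>x\<bar> \<le> exp \<bar>x\<bar>" for x :: real
    using exp_ge_add_one_self[of "\<bar>x\<bar>"] by linarith
  then have *: "\<bar>x\<bar> * exp (- x\<^sup>2 / 2) \<le> exp \<bar>x\<bar> * exp (- x\<^sup>2 / 2)" for x :: real
    by (intro mult_right_mono) auto
  have "\<bar>hermite (Suc 0) x\<bar> \<le> (sqrt 2 / sqrt (sqrt pi)) * exp (real (Suc 0) * \<bar>x\<bar> - x\<^sup>2 / 2)" for x
  proof -
    have "\<bar>hermite (Suc 0) x\<bar> = (sqrt 2 / sqrt (sqrt pi)) * (\<bar>x\<bar> * exp (- x\<^sup>2 / 2))"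
      by (simp add: abs_mult)
    also have "\<dots> \<le> (sqrt 2 / sqrt (sqrt pi)) * (exp \<bar>x\<bar> * exp (- x\<^sup>2 / 2))"
      by (intro mult_left_mono *) auto
    finally show ?thesis
      by (simp only: exp_add[symmetric]) simp
  qed
  then show ?case
    by (intro exI[of _ "sqrt 2 / sqrt (sqrt pi)"]) auto
next
  case (ge2 n)
  from ge2 obtain C D where C: "C \<ge> 0" "\<And>x. \<bar>hermite n x\<bar> \<le> C * exp (real n * \<bar>x\<bar> - x\<^sup>2 / 2)"
    and D: "D \<ge> 0" "\<And>x. \<bar>hermite (Suc n) x\<bar> \<le> D * exp (real (Suc n) * \<bar>x\<bar> - x\<^sup>2 / 2)"
    by blast
  have "\<bar>hermite (Suc (Suc n)) x\<bar> \<le> (sqrt 2 * D + sqrt (real (Suc n)) * C) * exp (real (Suc (Suc n)) * \<bar>x\<bar> - x\<^sup>2 / 2)" for x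
  proof -
    let ?E = "exp (real (Suc (Suc n)) * \<bar>x\<bar> - x\<^sup>2 / 2)"
    have "\<bar>x\<bar> \<le> exp \<bar>x\<bar>"
      using exp_ge_add_one_self[of "\<bar>x\<bar>"] by linarith
    then have "\<bar>x\<bar> * \<bar>hermite (Suc n) x\<bar> \<le> exp \<bar>x\<bar> * (D * exp (real (Suc n) * \<bar>x\<bar> - x\<^sup>2 / 2))"
      by (intro mult_mono D) auto
    also have "\<dots> = D * ?E"
      by (simp add: exp_add[symmetric] algebra_simps)
    finally have 1: "\<bar>x\<bar> * \<bar>hermite (Suc n) x\<bar> \<le> D * ?E" .
    have "\<bar>hermite n x\<bar> \<le> C * exp (real n * \<bar>x\<bar> - x\<^sup>2 / 2)"
      by (rule C)
    also have "\<dots> \<le> C * ?E"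
      using C(1) by (intro mult_left_mono) (auto simp: algebra_simps)
    finally have 2: "\<bar>hermite n x\<bar> \<le> C * ?E" .
    have "\<bar>hermite (Suc (Suc n)) x\<bar> = \<bar>sqrt 2 * x * hermite (Suc n) x - sqrt (real (Suc n)) * hermite n x\<bar> / sqrt (real (Suc (Suc n)))"
      by (simp add: abs_divide)
    also have "\<dots> \<le> \<bar>sqrt 2 * x * hermite (Suc n) x - sqrt (real (Suc n)) * hermite n x\<bar> / 1"
      by (intro divide_left_mono) auto
    also have "\<dots> \<le> sqrt 2 * (\<bar>x\<bar> * \<bar>hermite (Suc n) x\<bar>) + sqrt (real (Suc n)) * \<bar>hermite n x\<bar>"
      using abs_triangle_ineq4[of "sqrt 2 * x * hermite (Suc n) x" "sqrt (real (Suc n)) * hermite n x"]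
      by (simp add: abs_mult mult.assoc del: hermite.simps)
    also have "\<dots> \<le> sqrt 2 * (D * ?E) + sqrt (real (Suc n)) * (C * ?E)"
      by (intro add_mono mult_left_mono 1 2) auto
    finally show ?thesis
      by (simp add: algebra_simps del: hermite.simps)
  qed
  moreover have "sqrt 2 * D + sqrt (real (Suc n)) * C \<ge> 0"
    using C(1) D(1) by simp
  ultimately show ?case by blast
qed

lemma hermite_bound: "\<exists>C\<ge>0. \<forall>x. \<bar>hermite n x\<bar> \<le> C * exp (- x\<^sup>2 / 4)"
proof -
  obtain C where C: "C \<ge> 0" "\<And>x. \<bar>hermite n x\<bar> \<le> C * exp (real n * \<bar>x\<bar> - x\<^sup>2 / 2)"
    using hermite_bound_aux by blast
  have "\<bar>hermite n x\<bar> \<le> (C * exp ((real n)\<^sup>2)) * exp (- x\<^sup>2 / 4)" for x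
  proof -
    have "C * exp (real n * \<bar>x\<bar> - x\<^sup>2 / 2) \<le> C * exp ((real n)\<^sup>2 - x\<^sup>2 / 4)"
      using C(1) linear_minus_quadratic_le[of "real n" "\<bar>x\<bar>"] by (intro mult_left_mono) auto
    also have "\<dots> = (C * exp ((real n)\<^sup>2)) * exp (- x\<^sup>2 / 4)"
      by (simp add: exp_add[symmetric])
    finally show ?thesis using C(2)[of x] by linarith
  qed
  moreover have "C * exp ((real n)\<^sup>2) \<ge> 0" using C by simp
  ultimately show ?thesis by blast
qed

lemma integrable_gaussian: "integrable lborel (\<lambda>x::real. exp (- x\<^sup>2 / 2))"
proof -
  have "integrable lborel (\<lambda>x::real. sqrt (2 * pi) * std_normal_density x)"
    by (intro integrable_mult_right) auto
  then show ?thesis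
    by (simp add: std_normal_density_def)
qed

lemma hermite_mult_bound: "\<exists>C\<ge>0. \<forall>x. \<bar>hermite m x * hermite n x\<bar> \<le> C * exp (- x\<^sup>2 / 2)"
proof -
  obtain C D where C: "C \<ge> 0" "\<And>x. \<bar>hermite m x\<bar> \<le> C * exp (- x\<^sup>2 / 4)"
    and D: "D \<ge> 0" "\<And>x. \<bar>hermite n x\<bar> \<le> D * exp (- x\<^sup>2 / 4)"
    using hermite_bound[of m] hermite_bound[of n] by blast
  have "\<bar>hermite m x * hermite n x\<bar> \<le> (C * D) * exp (- x\<^sup>2 / 2)" for x
  proof -
    have "\<bar>hermite m x * hermite n x\<bar> \<le> (C * exp (- x\<^sup>2 / 4)) * (D * exp (- x\<^sup>2 / 4))"
      unfolding abs_mult using C D by (intro mult_mono) auto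
    also have "\<dots> = C * D * (exp (- x\<^sup>2 / 4) * exp (- x\<^sup>2 / 4))"
      by (simp add: mult_ac)
    also have "\<dots> = (C * D) * exp (- x\<^sup>2 / 2)"
      by (simp add: exp_add[symmetric])
    finally show ?thesis .
  qed
  moreover have "C * D \<ge> 0" using C D by simp
  ultimately show ?thesis by blast
qed

lemma integrable_hermite_mult: "integrable lborel (\<lambda>x. hermite m x * hermite n x)"
proof -
  obtain C where C: "\<And>x. \<bar>hermite m x * hermite n x\<bar> \<le> C * exp (- x\<^sup>2 / 2)"
    using hermite_mult_bound by blast
  show ?thesis
    by (rule Bochner_Integration.integrable_bound[OF integrable_mult_right[OF integrable_gaussian, of C]])
       (use C in \<open>auto intro!: AE_I2 order_trans[OF _ abs_ge_self]\<close>)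
qed

section \<open>Orthonormality of the Hermite functions\<close>

text \<open>The integrand is the derivative of \<open>hermite m x * hermite n x\<close>, which
  decays at both ends of the line.\<close>

lemma integral_hermite_deriv_zero:
  fixes m n :: nat
  shows
  "(LINT x|lborel. hermite m x * ((sqrt (real n) * hermite (n - 1) x - sqrt (real (n + 1)) * hermite (n + 1) x) / sqrt 2)
     + (sqrt (real m) * hermite (m - 1) x - sqrt (real (m + 1)) * hermite (m + 1) x) / sqrt 2 * hermite n x) = 0"
  (is "(LINT x|lborel. ?f x) = 0")
proof -
  have int: "integrable lborel ?f"
    by (simp add: right_diff_distrib left_diff_distrib mult.left_commute[of "hermite m _"] mult.assoc
        integrable_hermite_mult)
  have cont: "isCont (hermite k) x" for k x
    using hermite_deriv by (rule DERIV_isCont)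
  have deriv: "((\<lambda>x. hermite m x * hermite n x) has_vector_derivative ?f x) (at x)" for x
    unfolding has_real_derivative_iff_has_vector_derivative[symmetric]
    by (rule DERIV_cong[OF DERIV_mult[OF hermite_deriv[of m x] hermite_deriv[of n x]]])
       (simp only: mult.commute add.commute)
  obtain C where C: "\<And>x. \<bar>hermite m x * hermite n x\<bar> \<le> C * exp (- x\<^sup>2 / 2)"
    using hermite_mult_bound by blast
  have lim: "((\<lambda>x. hermite m x * hermite n x) \<longlongrightarrow> 0) F" if "((\<lambda>x. C * exp (- x\<^sup>2 / 2)) \<longlongrightarrow> 0) F" for F
    by (rule Lim_null_comparison[OF _ that]) (use C in auto)
  have "(LBINT x=-\<infinity>..\<infinity>. ?f x) = 0 - 0"
  proof (rule interval_integral_FTC_integrable[OF _ deriv])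
    show "isCont ?f x" for x by (intro continuous_intros cont) simp_all
    show "set_integrable lborel (einterval (- \<infinity>) \<infinity>) ?f"
      using int by (simp add: set_integrable_def)
    show "(((\<lambda>x. hermite m x * hermite n x) \<circ> real_of_ereal) \<longlongrightarrow> 0) (at_right (- \<infinity>))"
      unfolding ereal_tendsto_simps by (rule lim) real_asymp
    show "(((\<lambda>x. hermite m x * hermite n x) \<circ> real_of_ereal) \<longlongrightarrow> 0) (at_left \<infinity>)"
      unfolding ereal_tendsto_simps by (rule lim) real_asymp
  qed simp
  then show ?thesis
    by (simp add: interval_lebesgue_integral_def set_lebesgue_integral_def)
qed

text \<open>This is the adjointness of creation and destruction: equation 1 is the antisymmetry of
  the derivative, equation 2 the symmetry of multiplication by \<open>x\<close>, and eliminating the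
  term with \<open>n + 1\<close> leaves the claim.\<close>

lemma integral_hermite_shift:
  fixes m n :: nat
  shows
  "sqrt (real (m + 1)) * (LINT x|lborel. hermite (m + 1) x * hermite n x)
    = sqrt (real n) * (LINT x|lborel. hermite m x * hermite (n - 1) x)"
proof -
  define I where "I m n = (LINT x|lborel. hermite m x * hermite n x)" for m n
  note int = integrable_hermite_mult
  have "0 = (LINT x|lborel. sqrt (real n) / sqrt 2 * (hermite m x * hermite (n - 1) x)
        - sqrt (real (n + 1)) / sqrt 2 * (hermite m x * hermite (n + 1) x)
        + (sqrt (real m) / sqrt 2 * (hermite (m - 1) x * hermite n x)
        - sqrt (real (m + 1)) / sqrt 2 * (hermite (m + 1) x * hermite n x)))"
    unfolding integral_hermite_deriv_zero[of m n, symmetric]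
    by (intro Bochner_Integration.integral_cong refl)
       (simp add: right_diff_distrib left_diff_distrib diff_divide_distrib mult_ac)
  also have "\<dots> = (sqrt (real n) * I m (n - 1) - sqrt (real (n + 1)) * I m (n + 1)
        + (sqrt (real m) * I (m - 1) n - sqrt (real (m + 1)) * I (m + 1) n)) / sqrt 2"
    by (simp add: I_def int diff_divide_distrib add_divide_distrib)
  finally have 1: "sqrt (real n) * I m (n - 1) - sqrt (real (n + 1)) * I m (n + 1)
      + (sqrt (real m) * I (m - 1) n - sqrt (real (m + 1)) * I (m + 1) n) = 0"
    by simp
  have "(LINT x|lborel. sqrt (real (m + 1)) * (hermite (m + 1) x * hermite n x) + sqrt (real m) * (hermite (m - 1) x * hermite n x))
      = (LINT x|lborel. sqrt (real (n + 1)) * (hermite m x * hermite (n + 1) x) + sqrt (real n) * (hermite m x * hermite (n - 1) x))"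
  proof (intro Bochner_Integration.integral_cong refl)
    fix x
    have k: "sqrt (real (k + 1)) * hermite (k + 1) x + sqrt (real k) * hermite (k - 1) x = sqrt 2 * (x * hermite k x)" for k
      unfolding mult_hermite by simp
    have "(sqrt (real (m + 1)) * hermite (m + 1) x + sqrt (real m) * hermite (m - 1) x) * hermite n x
        = hermite m x * (sqrt (real (n + 1)) * hermite (n + 1) x + sqrt (real n) * hermite (n - 1) x)"
      unfolding k by simp
    then show "sqrt (real (m + 1)) * (hermite (m + 1) x * hermite n x) + sqrt (real m) * (hermite (m - 1) x * hermite n x)
      = sqrt (real (n + 1)) * (hermite m x * hermite (n + 1) x) + sqrt (real n) * (hermite m x * hermite (n - 1) x)"
      by (simp only: distrib_left distrib_right mult_ac)
  qed
  then have 2: "sqrt (real (m + 1)) * I (m + 1) n + sqrt (real m) * I (m - 1) n = sqrt (real (n + 1)) * I m (n + 1) + sqrt (real n) * I m (n - 1)"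
    by (simp add: I_def int)
  show ?thesis
    using 1 2 unfolding I_def by linarith
qed

lemma integral_hermite_0: "(LINT x|lborel. hermite 0 x * hermite 0 x) = 1"
proof -
  have "hermite 0 x * hermite 0 x = normal_density 0 (1 / sqrt 2) x" for x
  proof -
    have "hermite 0 x * hermite 0 x = (exp (- x\<^sup>2 / 2) * exp (- x\<^sup>2 / 2)) / sqrt pi"
      by simp
    also have "exp (- x\<^sup>2 / 2) * exp (- x\<^sup>2 / 2) = exp (- x\<^sup>2)"
      by (simp add: exp_add[symmetric])
    finally show ?thesis
      by (simp add: normal_density_def power_divide field_simps)
  qed
  then have "(LINT x|lborel. hermite 0 x * hermite 0 x) = (LINT x|lborel. normal_density 0 (1 / sqrt 2) x)"
    by (simp only:)
  also have "\<dots> = 1"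
    by (rule integral_normal_density) simp
  finally show ?thesis .
qed

text \<open>The shift relation lowers both indices by one until one of them is 0. If the other is
  then still positive, the factor \<open>sqrt 0\<close> makes the integral vanish.\<close>

lemma hermite_orthonormal:
  "(LINT x|lborel. hermite m x * hermite n x) = (if m = n then 1 else 0)"
proof (induction m arbitrary: n)
  case 0
  show ?case
  proof (cases n)
    case (Suc k)
    have "sqrt (real (k + 1)) * (LINT x|lborel. hermite (k + 1) x * hermite 0 x) = 0"
      by (simp only: integral_hermite_shift) simp
    then have "(LINT x|lborel. hermite (Suc k) x * hermite 0 x) = 0"
      by (simp del: hermite.simps)
    then show ?thesis
      by (simp only: Suc mult.commute) simp
  qed (simp add: integral_hermite_0 del: hermite.simps)
next
  case (Suc m)
  have "sqrt (real (m + 1)) * (LINT x|lborel. hermite (m + 1) x * hermite n x)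
      = sqrt (real n) * (if m = n - 1 then 1 else 0)"
    by (simp only: integral_hermite_shift Suc.IH)
  then show ?case
    by (cases n) (auto simp del: hermite.simps split: if_splits)
qed

section \<open>Products of Hermite functions on the plane\<close>

lemma integrable_prod_mult:
  fixes f g :: "real \<Rightarrow> real"
  assumes f: "integrable lborel f" and g: "integrable lborel g"
  shows "integrable lborel (\<lambda>x. f (fst x) * g (snd x))"
    and "(LINT x|lborel. f (fst x) * g (snd x)) = (LINT x|lborel. f x) * (LINT x|lborel. g x)"
proof -
  have [measurable]: "f \<in> borel_measurable borel" "g \<in> borel_measurable borel"
    using f g by auto
  have int: "integrable (lborel \<Otimes>\<^sub>M lborel) (\<lambda>x. f (fst x) * g (snd x))"
  proof (rule lborel_pair.Fubini_integrable)
    show "integrable lborel (\<lambda>x. LINT y|lborel. norm (f (fst (x, y)) * g (snd (x, y))))"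
      using f by (simp add: abs_mult integrable_abs)
    show "AE x in lborel. integrable lborel (\<lambda>y. f (fst (x, y)) * g (snd (x, y)))"
      using g by simp
  qed measurable
  then show "integrable lborel (\<lambda>x. f (fst x) * g (snd x))"
    by (simp only: lborel_prod)
  show "(LINT x|lborel. f (fst x) * g (snd x)) = (LINT x|lborel. f x) * (LINT x|lborel. g x)"
    using lborel_pair.integral_fst'[OF int] by (simp add: lborel_prod)
qed

definition hfun2 :: "nat \<Rightarrow> nat \<Rightarrow> real \<times> real \<Rightarrow> complex" where
  "hfun2 p q x = complex_of_real (hermite p (fst x) * hermite q (snd x))"

lemma smooth_hermite:
  assumes l: "bounded_linear l"
  shows "smooth (\<lambda>x. complex_of_real (hermite n (l x)))"
proof (induction n rule: induct_nat_012)
  note smooth_l = smooth_bounded_linear[OF l]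
  have q: "smooth (\<lambda>x. complex_of_real (- (l x)\<^sup>2 / 2))"
    using smooth_mult[OF smooth_const[of "- 1 / 2"] smooth_power[OF smooth_l, of 2]] by simp
  have "smooth (\<lambda>x. complex_of_real (exp (- (l x)\<^sup>2 / 2)))"
    by (rule smooth_compose[where \<psi> = "\<lambda>_::unit. exp" and a = "\<lambda>_. 1" and b = "\<lambda>_. 0" and \<alpha> = "\<lambda>_. ()" and \<beta> = "\<lambda>_. ()", OF _ q])
       (auto intro!: derivative_eq_intros bounded_linear.has_derivative[OF l])
  from smooth_mult[OF smooth_const[of "1 / complex_of_real (sqrt (sqrt pi))"] this]
  show base: "smooth (\<lambda>x. complex_of_real (hermite 0 (l x)))" by simp
  from smooth_mult[OF smooth_mult[OF smooth_const[of "complex_of_real (sqrt 2)"] smooth_l] base]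
  show "smooth (\<lambda>x. complex_of_real (hermite (Suc 0) (l x)))" by (simp del: hermite.simps(1))
next
  case (ge2 n)
  have "smooth (\<lambda>x. complex_of_real (1 / sqrt (real (Suc (Suc n)))) * (complex_of_real (sqrt 2) * (complex_of_real (l x) * complex_of_real (hermite (Suc n) (l x)))
      + complex_of_real (- sqrt (real (Suc n))) * complex_of_real (hermite n (l x))))"
    by (intro smooth_mult smooth_add smooth_const smooth_bounded_linear[OF l] ge2)
  then show ?case
    by (simp add: field_simps)
qed

lemma smooth_hfun2: "smooth (hfun2 p q)"
  using smooth_mult[OF smooth_hermite[OF bounded_linear_fst, of p] smooth_hermite[OF bounded_linear_snd, of q]]
  by (simp add: hfun2_def[abs_def])

lemma borel_measurable_hfun2 [measurable]: "hfun2 p q \<in> borel_measurable borel"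
  by (rule smooth_imp_measurable[OF smooth_hfun2])

lemma sq_integrable_hfun2: "sq_integrable (hfun2 p q)"
proof -
  have "integrable lborel (\<lambda>x. (hermite p (fst x) * hermite p (fst x)) * (hermite q (snd x) * hermite q (snd x)))"
    by (intro integrable_prod_mult integrable_hermite_mult)
  then show ?thesis
    by (simp add: sq_integrable_def hfun2_def norm_mult power2_eq_square abs_mult mult_ac abs_mult_self_eq)
qed

lemma pd_hfun2_1: "pd (1, 0) (hfun2 p q) x = (complex_of_real (sqrt (real p)) * hfun2 (p - 1) q x
    - complex_of_real (sqrt (real (p + 1))) * hfun2 (p + 1) q x) / complex_of_real (sqrt 2)"
proof -
  have "((\<lambda>x. hermite p (fst x) * hermite q (snd x)) has_derivative (\<lambda>v.
     hermite p (fst x) * ((sqrt (real q) * hermite (q - 1) (snd x) - sqrt (real (q + 1)) * hermite (q + 1) (snd x)) / sqrt 2 * snd v)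
     + (sqrt (real p) * hermite (p - 1) (fst x) - sqrt (real (p + 1)) * hermite (p + 1) (fst x)) / sqrt 2 * fst v * hermite q (snd x))) (at x)"
    by (intro has_derivative_mult has_derivative_compose[OF _ hermite_deriv[unfolded has_field_derivative_def]]
        has_derivative_fst has_derivative_snd has_derivative_ident)
  then have "((\<lambda>x. complex_of_real (hermite p (fst x) * hermite q (snd x))) has_derivative (\<lambda>v. complex_of_real (
     hermite p (fst x) * ((sqrt (real q) * hermite (q - 1) (snd x) - sqrt (real (q + 1)) * hermite (q + 1) (snd x)) / sqrt 2 * snd v)
     + (sqrt (real p) * hermite (p - 1) (fst x) - sqrt (real (p + 1)) * hermite (p + 1) (fst x)) / sqrt 2 * fst v * hermite q (snd x)))) (at x)"
    by (rule has_derivative_of_real)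
  from pd_eqI[OF this, of "(1, 0)"] show ?thesis
    by (simp add: hfun2_def[abs_def] algebra_simps diff_divide_distrib)
qed

lemma pd_hfun2_2: "pd (0, 1) (hfun2 p q) x = (complex_of_real (sqrt (real q)) * hfun2 p (q - 1) x
    - complex_of_real (sqrt (real (q + 1))) * hfun2 p (q + 1) x) / complex_of_real (sqrt 2)"
proof -
  have "((\<lambda>x. hermite p (fst x) * hermite q (snd x)) has_derivative (\<lambda>v.
     hermite p (fst x) * ((sqrt (real q) * hermite (q - 1) (snd x) - sqrt (real (q + 1)) * hermite (q + 1) (snd x)) / sqrt 2 * snd v)
     + (sqrt (real p) * hermite (p - 1) (fst x) - sqrt (real (p + 1)) * hermite (p + 1) (fst x)) / sqrt 2 * fst v * hermite q (snd x))) (at x)"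
    by (intro has_derivative_mult has_derivative_compose[OF _ hermite_deriv[unfolded has_field_derivative_def]]
        has_derivative_fst has_derivative_snd has_derivative_ident)
  then have "((\<lambda>x. complex_of_real (hermite p (fst x) * hermite q (snd x))) has_derivative (\<lambda>v. complex_of_real (
     hermite p (fst x) * ((sqrt (real q) * hermite (q - 1) (snd x) - sqrt (real (q + 1)) * hermite (q + 1) (snd x)) / sqrt 2 * snd v)
     + (sqrt (real p) * hermite (p - 1) (fst x) - sqrt (real (p + 1)) * hermite (p + 1) (fst x)) / sqrt 2 * fst v * hermite q (snd x)))) (at x)"
    by (rule has_derivative_of_real)
  from pd_eqI[OF this, of "(0, 1)"] show ?thesis
    by (simp add: hfun2_def[abs_def] algebra_simps diff_divide_distrib)
qed

lemma mult_hfun2_1: "complex_of_real (fst x) * hfun2 p q x = (complex_of_real (sqrt (real p)) * hfun2 (p - 1) q x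
    + complex_of_real (sqrt (real (p + 1))) * hfun2 (p + 1) q x) / complex_of_real (sqrt 2)"
proof -
  have "complex_of_real (fst x) * hfun2 p q x = complex_of_real ((fst x * hermite p (fst x)) * hermite q (snd x))"
    by (simp add: hfun2_def)
  then show ?thesis
    unfolding mult_hermite hfun2_def by (simp add: algebra_simps add_divide_distrib)
qed

lemma mult_hfun2_2: "complex_of_real (snd x) * hfun2 p q x = (complex_of_real (sqrt (real q)) * hfun2 p (q - 1) x
    + complex_of_real (sqrt (real (q + 1))) * hfun2 p (q + 1) x) / complex_of_real (sqrt 2)"
proof -
  have "complex_of_real (snd x) * hfun2 p q x = complex_of_real (hermite p (fst x) * (snd x * hermite q (snd x)))"
    by (simp add: hfun2_def)
  then show ?thesis
    unfolding mult_hermite hfun2_def by (simp add: algebra_simps add_divide_distrib)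
qed

lemma cinner_hfun2: "cinner (abs_l2 (hfun2 p q)) (abs_l2 (hfun2 r s)) = (if p = r \<and> q = s then 1 else 0)"
proof -
  have "cinner (abs_l2 (hfun2 p q)) (abs_l2 (hfun2 r s)) = (LINT x|lborel. cnj (hfun2 p q x) * hfun2 r s x)"
    by (rule cinner_abs_l2) (rule sq_integrable_hfun2)+
  also have "\<dots> = complex_of_real (LINT x|lborel. (hermite p (fst x) * hermite r (fst x)) * (hermite q (snd x) * hermite s (snd x)))"
    unfolding integral_complex_of_real[symmetric] by (simp add: hfun2_def mult_ac)
  also have "\<dots> = (if p = r \<and> q = s then 1 else 0)"
    by (subst integrable_prod_mult(2)[OF integrable_hermite_mult integrable_hermite_mult])
       (simp add: hermite_orthonormal)
  finally show ?thesis .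
qed

text \<open>
  Since \<open>x * hermite n x\<close> is a combination of Hermite functions, vanishing coefficients imply
  vanishing moments.
\<close>

lemma hfun2_orthogonal_imp_zero:
  assumes zero: "\<And>p q. (LINT x|lborel. rep_l2 u x * hfun2 p q x) = 0"
  shows "u = 0"
proof -
  let ?u = "rep_l2 u"
  have int: "integrable lborel (\<lambda>x. ?u x * hfun2 p q x)" for p q
    by (intro integrable_mult_sq_integrable sq_integrable_rep_l2 sq_integrable_hfun2)
  have comb: "integrable lborel (\<lambda>x. c * f x + d * g x) \<and> (LINT x|lborel. c * f x + d * g x) = 0"
    if "integrable lborel f \<and> (LINT x|lborel. f x) = 0" "integrable lborel g \<and> (LINT x|lborel. g x) = 0"
    for c d :: complex and f g :: "real \<times> real \<Rightarrow> complex"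
    using that by simp
  have mom: "integrable lborel (\<lambda>x. complex_of_real (fst x ^ a * snd x ^ b) * (?u x * hfun2 p q x)) \<and>
      (LINT x|lborel. complex_of_real (fst x ^ a * snd x ^ b) * (?u x * hfun2 p q x)) = 0" for a b p q
  proof (induction a arbitrary: p q)
    case 0
    show ?case
    proof (induction b arbitrary: p q)
      case 0
      then show ?case using int zero by simp
    next
      case (Suc b)
      have eq: "complex_of_real (fst x ^ 0 * snd x ^ Suc b) * (?u x * hfun2 p q x)
          = complex_of_real (sqrt (real q) / sqrt 2) * (complex_of_real (fst x ^ 0 * snd x ^ b) * (?u x * hfun2 p (q - 1) x))
          + complex_of_real (sqrt (real (q + 1)) / sqrt 2) * (complex_of_real (fst x ^ 0 * snd x ^ b) * (?u x * hfun2 p (q + 1) x))" for x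
      proof -
        have "complex_of_real (fst x ^ 0 * snd x ^ Suc b) * (?u x * hfun2 p q x)
            = complex_of_real (fst x ^ 0 * snd x ^ b) * ?u x * (complex_of_real (snd x) * hfun2 p q x)"
          by simp
        then show ?thesis
          unfolding mult_hfun2_2 by (simp add: add_divide_distrib distrib_left distrib_right mult_ac)
      qed
      show ?case
        unfolding eq by (rule comb[OF Suc.IH Suc.IH])
    qed
  next
    case (Suc a)
    have eq: "complex_of_real (fst x ^ Suc a * snd x ^ b) * (?u x * hfun2 p q x)
        = complex_of_real (sqrt (real p) / sqrt 2) * (complex_of_real (fst x ^ a * snd x ^ b) * (?u x * hfun2 (p - 1) q x))
        + complex_of_real (sqrt (real (p + 1)) / sqrt 2) * (complex_of_real (fst x ^ a * snd x ^ b) * (?u x * hfun2 (p + 1) q x))" for x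
    proof -
      have "complex_of_real (fst x ^ Suc a * snd x ^ b) * (?u x * hfun2 p q x)
          = complex_of_real (fst x ^ a * snd x ^ b) * ?u x * (complex_of_real (fst x) * hfun2 p q x)"
        by simp
      then show ?thesis
        unfolding mult_hfun2_1 by (simp add: add_divide_distrib distrib_left distrib_right mult_ac)
    qed
    show ?case
      unfolding eq by (rule comb[OF Suc.IH Suc.IH])
  qed
  define F where "F x = ?u x * hfun2 0 0 x" for x
  have [measurable]: "F \<in> borel_measurable borel"
    unfolding F_def by measurable
  \<comment> \<open>The Gaussian outweighs the exponential, so the weighted \<open>hfun2 0 0\<close>
    is still square integrable and can be paired with \<open>u\<close>.\<close>
  have expF: "integrable lborel (\<lambda>x. complex_of_real (exp (k * (\<bar>fst x\<bar> + \<bar>snd x\<bar>))) * F x)" for k :: nat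
  proof -
    let ?G = "\<lambda>x::real \<times> real. complex_of_real (exp (k * (\<bar>fst x\<bar> + \<bar>snd x\<bar>))) * hfun2 0 0 x"
    have [measurable]: "?G \<in> borel_measurable borel"
      by (intro borel_measurable_continuous_onI continuous_intros smooth_imp_continuous[OF smooth_hfun2])
    have "sq_integrable ?G"
      unfolding sq_integrable_def
    proof
      show "integrable lborel (\<lambda>x. (cmod (?G x))\<^sup>2)"
      proof (rule Bochner_Integration.integrable_bound)
        let ?C = "exp ((real k)\<^sup>2) / sqrt (sqrt pi)"
        show "integrable lborel (\<lambda>x::real \<times> real. ?C ^ 4 * (exp (- (fst x)\<^sup>2 / 2) * exp (- (snd x)\<^sup>2 / 2)))"
          by (intro integrable_mult_right integrable_prod_mult integrable_gaussian)
        have b: "exp (real k * \<bar>t\<bar>) * hermite 0 t \<le> ?C * exp (- t\<^sup>2 / 4)" for t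
        proof -
          have "exp (real k * \<bar>t\<bar> - t\<^sup>2 / 2) \<le> exp ((real k)\<^sup>2 - t\<^sup>2 / 4)"
            using linear_minus_quadratic_le[of "real k" "\<bar>t\<bar>"] by simp
          then have "exp (real k * \<bar>t\<bar> - t\<^sup>2 / 2) / sqrt (sqrt pi) \<le> exp ((real k)\<^sup>2 - t\<^sup>2 / 4) / sqrt (sqrt pi)"
            by (intro divide_right_mono) auto
          moreover have "exp (real k * \<bar>t\<bar>) * hermite 0 t = exp (real k * \<bar>t\<bar> - t\<^sup>2 / 2) / sqrt (sqrt pi)"
            "?C * exp (- t\<^sup>2 / 4) = exp ((real k)\<^sup>2 - t\<^sup>2 / 4) / sqrt (sqrt pi)"
            by (simp_all flip: exp_add)
          ultimately show ?thesis
            by (simp only:)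
        qed
        show "AE x in lborel. norm ((cmod (?G x))\<^sup>2) \<le> norm (?C ^ 4 * (exp (- (fst x)\<^sup>2 / 2) * exp (- (snd x)\<^sup>2 / 2)))"
        proof (rule AE_I2)
          fix x :: "real \<times> real"
          have pos: "0 \<le> hermite 0 t" for t by simp
          have "cmod (?G x) = (exp (k * \<bar>fst x\<bar>) * hermite 0 (fst x)) * (exp (k * \<bar>snd x\<bar>) * hermite 0 (snd x))"
            using pos[of "fst x"] pos[of "snd x"]
            by (simp add: hfun2_def norm_mult exp_add distrib_left del: hermite.simps)
          also have "\<dots> \<le> (?C * exp (- (fst x)\<^sup>2 / 4)) * (?C * exp (- (snd x)\<^sup>2 / 4))"
            by (intro mult_mono b mult_nonneg_nonneg pos) auto
          finally have "(cmod (?G x))\<^sup>2 \<le> ((?C * exp (- (fst x)\<^sup>2 / 4)) * (?C * exp (- (snd x)\<^sup>2 / 4)))\<^sup>2"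
            by (intro power_mono) auto
          also have "\<dots> = ?C ^ 4 * ((exp (- (fst x)\<^sup>2 / 4))\<^sup>2 * (exp (- (snd x)\<^sup>2 / 4))\<^sup>2)"
            by (simp only: power2_eq_square power4_eq_xxxx mult_ac)
          also have "\<dots> = ?C ^ 4 * (exp (- (fst x)\<^sup>2 / 2) * exp (- (snd x)\<^sup>2 / 2))"
            by (simp flip: exp_double)
          finally show "norm ((cmod (?G x))\<^sup>2) \<le> norm (?C ^ 4 * (exp (- (fst x)\<^sup>2 / 2) * exp (- (snd x)\<^sup>2 / 2)))"
            by simp
        qed
      qed measurable
    qed simp
    then show ?thesis
      using integrable_mult_sq_integrable[OF sq_integrable_rep_l2[of u], of ?G]
      by (simp add: F_def mult_ac)
  qed
  have mF: "integrable lborel (\<lambda>x. complex_of_real (fst x ^ a * snd x ^ b) * F x)"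
     "(LINT x|lborel. complex_of_real (fst x ^ a * snd x ^ b) * F x) = 0" for a b
    using mom[of a b 0 0] by (simp_all add: F_def)
  have "AE x in lborel. Re (F x) = 0"
  proof (rule moments_zero_AE_zero_plane)
    show "integrable lborel (\<lambda>x. exp (k * (\<bar>fst x\<bar> + \<bar>snd x\<bar>)) * Re (F x))" for k :: nat
      using integrable_Re[OF expF[of k]] by simp
    show "(LINT x|lborel. fst x ^ a * snd x ^ b * Re (F x)) = 0" for a b
      using arg_cong[OF mF(2)[of a b], of Re] mF(1)[of a b] by (simp flip: integral_Re)
  qed measurable
  moreover have "AE x in lborel. Im (F x) = 0"
  proof (rule moments_zero_AE_zero_plane)
    show "integrable lborel (\<lambda>x. exp (k * (\<bar>fst x\<bar> + \<bar>snd x\<bar>)) * Im (F x))" for k :: nat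
      using integrable_Im[OF expF[of k]] by simp
    show "(LINT x|lborel. fst x ^ a * snd x ^ b * Im (F x)) = 0" for a b
      using arg_cong[OF mF(2)[of a b], of Im] mF(1)[of a b] by (simp flip: integral_Im)
  qed measurable
  ultimately have "AE x in lborel. ?u x = rep_l2 0 x"
    using AE_rep_l2_zero
  proof eventually_elim
    case (elim x)
    then have "F x = 0" by (simp add: complex_eq_iff)
    \<comment> \<open>The Gaussian \<open>hfun2 0 0\<close> has no zeros and can be divided
      out.\<close>
    with elim show ?case by (simp add: F_def hfun2_def)
  qed
  then show ?thesis
    by (simp only: l2_eq_iff_AE[of u])
qed

section \<open>Weak derivatives in terms of Hermite coefficients\<close>

lemma test_function_smooth: "\<phi> \<in> test_functions \<Longrightarrow> smooth \<phi>"
  by (simp add: test_functions_def smooth_def)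

lemma test_function_support:
  assumes "\<phi> \<in> test_functions"
  obtains R where "\<And>x. norm x \<ge> R \<Longrightarrow> \<phi> x = 0" "\<And>v x. norm x \<ge> R \<Longrightarrow> pd v \<phi> x = 0"
proof -
  have "bounded {x. \<phi> x \<noteq> 0}"
    using assms by (simp add: test_functions_def compact_closure)
  then obtain R where R: "\<And>x. \<phi> x \<noteq> 0 \<Longrightarrow> norm x \<le> R"
    unfolding bounded_iff by blast
  have "pd v \<phi> x = 0" if "norm x > R" for v x
  proof (rule pd_eqI)
    have "((\<lambda>x. 0) has_derivative (\<lambda>v. 0)) (at x)" by simp
    then show "(\<phi> has_derivative (\<lambda>v. 0)) (at x)"
    proof (rule has_derivative_transform_within_open[OF _ open_Compl[OF closed_cball[of 0 R]]])
      show "0 = \<phi> y" if "y \<in> - cball 0 R" for y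
        using R[of y] that by auto
    qed (use that in auto)
  qed
  moreover have "\<phi> x = 0" if "norm x > R" for x
    using R[of x] that by force
  ultimately show ?thesis
    by (intro that[of "R + 1"]) auto
qed

lemma test_functionI:
  assumes "smooth f" "\<And>x. norm x \<ge> R \<Longrightarrow> f x = 0"
  shows "f \<in> test_functions"
proof -
  have "bounded {x. f x \<noteq> 0}"
    unfolding bounded_iff using assms(2) by (intro exI[of _ R]) force
  then show ?thesis
    using assms(1) by (simp add: test_functions_def compact_closure smooth_def)
qed

lemma test_function_pd: "\<phi> \<in> test_functions \<Longrightarrow> pd v \<phi> \<in> test_functions"
  by (metis test_function_support test_functionI smooth_pd test_function_smooth)

lemma test_function_mult_smooth: "\<phi> \<in> test_functions \<Longrightarrow> smooth f \<Longrightarrow> (\<lambda>x. f x * \<phi> x) \<in> test_functions"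
  by (metis (no_types, lifting) test_function_support test_functionI smooth_mult test_function_smooth mult_zero_right)

lemma integrable_test_function:
  assumes "\<phi> \<in> test_functions"
  shows "integrable lborel \<phi>"
proof -
  obtain R where R: "\<And>x. norm x \<ge> R \<Longrightarrow> \<phi> x = 0"
    using test_function_support[OF assms] by metis
  have "integrable lborel (\<lambda>x. indicator (cball 0 R) x *\<^sub>R \<phi> x)"
    by (intro borel_integrable_compact compact_cball continuous_on_subset[OF smooth_imp_continuous[OF test_function_smooth[OF assms]]]) auto
  also have "(\<lambda>x. indicator (cball 0 R) x *\<^sub>R \<phi> x) = \<phi>"
    using R by (auto simp: fun_eq_iff indicator_def)
  finally show ?thesis .
qed

lemma sq_integrable_test_function:
  assumes "\<phi> \<in> test_functions"
  shows "sq_integrable \<phi>"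
proof -
  obtain R where R: "\<And>x. norm x \<ge> R \<Longrightarrow> \<phi> x = 0"
    using test_function_support[OF assms] by metis
  have cont: "continuous_on UNIV \<phi>"
    by (intro smooth_imp_continuous test_function_smooth assms)
  have "integrable lborel (\<lambda>x. indicator (cball 0 R) x *\<^sub>R (cmod (\<phi> x))\<^sup>2)"
    by (intro borel_integrable_compact compact_cball continuous_intros continuous_on_subset[OF cont]) auto
  also have "(\<lambda>x. indicator (cball 0 R) x *\<^sub>R (cmod (\<phi> x))\<^sup>2) = (\<lambda>x. (cmod (\<phi> x))\<^sup>2)"
    using R by (auto simp: fun_eq_iff indicator_def)
  finally show ?thesis
    using borel_measurable_continuous_onI[OF cont] by (simp add: sq_integrable_def)
qed

lemma integral_line_pd_test_function:
  assumes \<phi>: "\<phi> \<in> test_functions" and v: "norm v = 1"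
  shows "(LINT t|lborel. pd v \<phi> (x0 + t *\<^sub>R v)) = 0"
proof -
  obtain R where R: "\<And>x. norm x \<ge> R \<Longrightarrow> \<phi> x = 0" "\<And>x. norm x \<ge> R \<Longrightarrow> pd v \<phi> x = 0"
    using test_function_support[OF \<phi>] by metis
  define T where "T = \<bar>R\<bar> + norm x0"
  have T: "norm (x0 + t *\<^sub>R v) \<ge> R" if "\<bar>t\<bar> \<ge> T" for t
    using norm_triangle_ineq2[of "t *\<^sub>R v" "- x0"] that v by (simp add: T_def add.commute)
  let ?g = "\<lambda>t. pd v \<phi> (x0 + t *\<^sub>R v)"
  have deriv: "((\<lambda>t. \<phi> (x0 + t *\<^sub>R v)) has_vector_derivative ?g t) (at t within S)" for t S
  proof -
    have d: "(\<phi> has_derivative (\<lambda>w. pd w \<phi> (x0 + t *\<^sub>R v))) (at (x0 + t *\<^sub>R v))"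
      by (intro has_derivative_pd smooth_imp_differentiable test_function_smooth \<phi>)
    have "((\<lambda>t. \<phi> (x0 + t *\<^sub>R v)) has_derivative (\<lambda>h. pd (h *\<^sub>R v) \<phi> (x0 + t *\<^sub>R v))) (at t within S)"
      by (rule has_derivative_compose[where g = \<phi> and f = "\<lambda>t. x0 + t *\<^sub>R v" and f' = "\<lambda>h. h *\<^sub>R v", OF _ d])
         (auto intro!: derivative_eq_intros)
    moreover have "pd (h *\<^sub>R v) \<phi> (x0 + t *\<^sub>R v) = h *\<^sub>R ?g t" for h
      using linear_cmul[OF has_derivative_linear[OF d]] by simp
    ultimately show ?thesis
      by (simp add: has_vector_derivative_def)
  qed
  have "(LINT t|lborel. indicator {- T..T} t *\<^sub>R ?g t) = \<phi> (x0 + T *\<^sub>R v) - \<phi> (x0 + (- T) *\<^sub>R v)"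
  proof (rule integral_FTC_Icc)
    show "continuous_on {- T..T} ?g"
      by (intro continuous_on_compose2[OF smooth_imp_continuous[OF smooth_pd[OF test_function_smooth[OF \<phi>]]]] continuous_intros) auto
  qed (use deriv in \<open>auto simp: T_def\<close>)
  also have "\<dots> = 0"
    using R(1)[OF T[of T]] R(1)[OF T[of "- T"]] by simp
  also have "(\<lambda>t. indicator {- T..T} t *\<^sub>R ?g t) = ?g"
  proof
    show "indicator {- T..T} t *\<^sub>R ?g t = ?g t" for t
      using R(2)[OF T[of t]] by (auto simp: indicator_def)
  qed
  finally show ?thesis .
qed

section \<open>Both coordinates at once\<close>

text \<open>Coding the coordinate by a Boolean, with True for the first one, lets each statement
  about derivatives, multiplications and index shifts be proved once for both axes.\<close>

definition unit_dir :: "bool \<Rightarrow> real \<times> real" where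
  "unit_dir k = (if k then (1, 0) else (0, 1))"

definition coord :: "bool \<Rightarrow> real \<times> real \<Rightarrow> real" where
  "coord k x = (if k then fst x else snd x)"

lemma unit_dir_simps: "unit_dir True = (1, 0)" "unit_dir False = (0, 1)"
  by (simp_all add: unit_dir_def)

lemma coord_simps: "coord True = fst" "coord False = snd"
  by (simp_all add: coord_def fun_eq_iff)

lemma norm_unit_dir: "norm (unit_dir k) = 1"
  by (simp add: unit_dir_def norm_prod_def)

lemma borel_measurable_coord [measurable]: "coord k \<in> borel_measurable borel"
  by (cases k) (simp_all add: coord_simps borel_measurable_continuous_onI continuous_intros)

lemma integral_pd_test_function:
  assumes \<phi>: "\<phi> \<in> test_functions"
  shows "(LINT x|lborel. pd (unit_dir k) \<phi> x) = 0"
proof -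
  have int: "integrable (lborel \<Otimes>\<^sub>M lborel) (pd (unit_dir k) \<phi>)"
    unfolding lborel_prod by (intro integrable_test_function test_function_pd \<phi>)
  show ?thesis
  proof (cases k)
    case False
    have "(LINT y|lborel. pd (unit_dir k) \<phi> (x, y)) = 0" for x
      using integral_line_pd_test_function[OF \<phi> norm_unit_dir, of False "(x, 0)"] False by (simp add: unit_dir_simps)
    then show ?thesis
      using lborel_pair.integral_fst'[OF int] by (simp add: lborel_prod)
  next
    case True
    have "(LINT x|lborel. pd (unit_dir k) \<phi> (x, y)) = 0" for y
      using integral_line_pd_test_function[OF \<phi> norm_unit_dir, of True "(0, y)"] True by (simp add: unit_dir_simps)
    then show ?thesis
      using lborel_pair.integral_snd[of "\<lambda>x y. pd (unit_dir k) \<phi> (x, y)"] int by (simp add: lborel_prod)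
  qed
qed

text \<open>Integration by parts: \<open>f\<close> times a test function is again a test function,
  and the integral of its derivative is zero.\<close>

lemma has_weak_deriv_abs_l2:
  assumes f: "smooth f" "sq_integrable f" "sq_integrable (pd (unit_dir k) f)"
  shows "has_weak_deriv (unit_dir k) (abs_l2 f) (abs_l2 (pd (unit_dir k) f))"
  unfolding has_weak_deriv_def
proof
  fix \<phi> assume \<phi>: "\<phi> \<in> test_functions"
  note sq = sq_integrable_test_function[OF \<phi>] sq_integrable_test_function[OF test_function_pd[OF \<phi>, of "unit_dir k"]]
  have rep: "(LINT x|lborel. rep_l2 (abs_l2 g) x * \<psi> x) = (LINT x|lborel. g x * \<psi> x)"
    if g: "sq_integrable g" and \<psi>: "sq_integrable \<psi>" for g \<psi>
    using AE_rep_abs_l2[OF g] g \<psi> by (intro integral_cong_AE) (auto simp: sq_integrable_def)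
  have "(LINT x|lborel. f x * pd (unit_dir k) \<phi> x) + (LINT x|lborel. pd (unit_dir k) f x * \<phi> x)
      = (LINT x|lborel. f x * pd (unit_dir k) \<phi> x + pd (unit_dir k) f x * \<phi> x)"
    using f sq by (intro Bochner_Integration.integral_add[symmetric] integrable_mult_sq_integrable)
  also have "\<dots> = (LINT x|lborel. pd (unit_dir k) (\<lambda>x. f x * \<phi> x) x)"
    by (simp add: pd_mult smooth_imp_differentiable f test_function_smooth \<phi>)
  also have "\<dots> = 0"
    by (intro integral_pd_test_function test_function_mult_smooth \<phi> f)
  finally show "(LINT x|lborel. rep_l2 (abs_l2 f) x * pd (unit_dir k) \<phi> x) = - (LINT x|lborel. rep_l2 (abs_l2 (pd (unit_dir k) f)) x * \<phi> x)"
    using f sq by (simp add: rep eq_neg_iff_add_eq_0)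
qed

definition idx :: "bool \<Rightarrow> nat \<times> nat \<Rightarrow> nat" where
  "idx k i = (if k then fst i else snd i)"

definition raise_idx :: "bool \<Rightarrow> nat \<times> nat \<Rightarrow> nat \<times> nat" where
  "raise_idx k i = (if k then (fst i + 1, snd i) else (fst i, snd i + 1))"

text \<open>The index 0 is mapped to itself by truncated subtraction. Such terms always carry the
  coefficient \<open>sqrt 0\<close>, so no spurious contribution arises.\<close>

definition lower_idx :: "bool \<Rightarrow> nat \<times> nat \<Rightarrow> nat \<times> nat" where
  "lower_idx k i = (if k then (fst i - 1, snd i) else (fst i, snd i - 1))"

definition level :: "nat \<times> nat \<Rightarrow> nat" where
  "level i = fst i + snd i"

definition hvec :: "nat \<times> nat \<Rightarrow> l2" where
  "hvec i = abs_l2 (hfun2 (fst i) (snd i))"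

definition hfun :: "nat \<times> nat \<Rightarrow> real \<times> real \<Rightarrow> complex" where
  "hfun i = hfun2 (fst i) (snd i)"

definition hcoeff :: "l2 \<Rightarrow> nat \<times> nat \<Rightarrow> complex" where
  "hcoeff u i = cinner (hvec i) u"

lemmas idx_defs = idx_def raise_idx_def lower_idx_def level_def

lemma lower_idx_raise_idx: "lower_idx k (raise_idx k i) = i"
  by (simp add: idx_defs)

lemma raise_idx_lower_idx: "idx k i > 0 \<Longrightarrow> raise_idx k (lower_idx k i) = i"
  by (cases i) (auto simp: idx_defs)

lemma idx_raise_idx: "idx k (raise_idx k i) = idx k i + 1" and idx_lower_idx: "idx k (lower_idx k i) = idx k i - 1"
  by (auto simp: idx_defs)

lemma level_raise_idx: "level (raise_idx k i) = level i + 1"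
  by (simp add: idx_defs)

lemma idx_le_level: "idx k i \<le> level i"
  by (simp add: idx_defs)

lemma inj_raise_idx: "inj (raise_idx k)"
  by (rule inj_on_inverseI[of _ "lower_idx k"]) (rule lower_idx_raise_idx)

lemma hvec_eq: "hvec i = abs_l2 (hfun i)"
  by (simp add: hvec_def hfun_def)

lemma smooth_hfun: "smooth (hfun i)" and sq_integrable_HI: "sq_integrable (hfun i)"
  and borel_measurable_hfun [measurable]: "hfun i \<in> borel_measurable borel"
  by (simp_all add: hfun_def smooth_hfun2 sq_integrable_hfun2)

lemma hcoeff_eq: "hcoeff u i = (LINT x|lborel. rep_l2 u x * hfun i x)"
  unfolding hcoeff_def hvec_eq by (simp add: cinner_abs_l2_left sq_integrable_HI) (simp add: hfun_def hfun2_def mult.commute)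

lemma cinner_hvec: "cinner (hvec i) (hvec j) = (if i = j then 1 else 0)"
  by (simp add: hvec_def cinner_hfun2 prod_eq_iff)

lemma norm_hvec: "norm (hvec i) = 1"
  by (simp add: norm_l2_eq_cinner cinner_hvec)

lemma hcoeff_hvec: "hcoeff (hvec j) i = (if i = j then 1 else 0)"
  by (simp add: hcoeff_def cinner_hvec)

lemma hcoeff_zero_imp_zero:
  assumes "\<And>i. hcoeff u i = 0"
  shows "u = 0"
proof (rule hfun2_orthogonal_imp_zero)
  show "(LINT x|lborel. rep_l2 u x * hfun2 p q x) = 0" for p q
    using assms[of "(p, q)"] by (simp add: hcoeff_eq hfun_def)
qed

lemma hcoeff_add: "hcoeff (u + v) i = hcoeff u i + hcoeff v i"
  and hcoeff_diff: "hcoeff (u - v) i = hcoeff u i - hcoeff v i"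
  and hcoeff_minus: "hcoeff (- u) i = - hcoeff u i"
  and hcoeff_scaleC: "hcoeff (c *\<^sub>C u) i = c * hcoeff u i"
  and hcoeff_zero: "hcoeff 0 i = 0"
  and hcoeff_sum: "hcoeff (\<Sum>a\<in>A. f a) i = (\<Sum>a\<in>A. hcoeff (f a) i)"
  by (simp_all add: hcoeff_def cinner_add_right cinner_diff_right cinner_minus_right cinner_scaleC_right cinner_sum_right)

lemma hcoeff_eqI: "(\<And>i. hcoeff u i = hcoeff v i) \<Longrightarrow> u = v"
  using hcoeff_zero_imp_zero[of "u - v"] by (simp add: hcoeff_diff)

lemma pd_hfun: "pd (unit_dir k) (hfun i) = (\<lambda>x. (complex_of_real (sqrt (real (idx k i))) * hfun (lower_idx k i) x
    - complex_of_real (sqrt (real (idx k i + 1))) * hfun (raise_idx k i) x) / complex_of_real (sqrt 2))"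
  by (rule ext, cases k) (simp_all add: hfun_def idx_defs unit_dir_simps pd_hfun2_1 pd_hfun2_2)

lemma coord_hfun: "complex_of_real (coord k x) * hfun i x = (complex_of_real (sqrt (real (idx k i))) * hfun (lower_idx k i) x
    + complex_of_real (sqrt (real (idx k i + 1))) * hfun (raise_idx k i) x) / complex_of_real (sqrt 2)"
  by (cases k) (simp_all add: hfun_def idx_defs coord_simps mult_hfun2_1 mult_hfun2_2)

lemma sq_integrable_combination:
  "sq_integrable f \<Longrightarrow> sq_integrable g \<Longrightarrow> sq_integrable (\<lambda>x. (a * f x + b * g x) / c)"
  using sq_integrable_scale[OF sq_integrable_add[OF sq_integrable_scale[of f a] sq_integrable_scale[of g b]], of "1 / c"]
  by simp

lemma sq_integrable_combination_diff:
  "sq_integrable f \<Longrightarrow> sq_integrable g \<Longrightarrow> sq_integrable (\<lambda>x. (a * f x - b * g x) / c)"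
  using sq_integrable_combination[of f g a "- b" c] by simp

lemma sq_integrable_pd_hfun: "sq_integrable (pd (unit_dir k) (hfun i))"
  unfolding pd_hfun by (intro sq_integrable_combination_diff sq_integrable_HI)

lemma sq_integrable_coord_hfun: "sq_integrable (\<lambda>x. complex_of_real (coord k x) * hfun i x)"
  unfolding coord_hfun by (intro sq_integrable_combination sq_integrable_HI)

text \<open>Testing with \<open>hfun i\<close> moves the derivative to the Hermite function, where
  the ladder formula applies; the sign of integration by parts exchanges the two signs of that
  formula.\<close>

lemma has_weak_deriv_hcoeff:
  assumes "has_weak_deriv (unit_dir k) u w"
  shows "hcoeff w i = (complex_of_real (sqrt (real (idx k i + 1))) * hcoeff u (raise_idx k i)
    - complex_of_real (sqrt (real (idx k i))) * hcoeff u (lower_idx k i)) / complex_of_real (sqrt 2)"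
proof -
  have int: "integrable lborel (\<lambda>x. rep_l2 u x * hfun i x)" for i
    by (intro integrable_mult_sq_integrable sq_integrable_rep_l2 sq_integrable_HI)
  have "(LINT x|lborel. rep_l2 u x * pd (unit_dir k) (hfun i) x) = - hcoeff w i"
    unfolding hcoeff_eq by (intro has_weak_deriv_smooth assms norm_unit_dir smooth_hfun sq_integrable_HI sq_integrable_pd_hfun)
  also have "(\<lambda>x. rep_l2 u x * pd (unit_dir k) (hfun i) x)
      = (\<lambda>x. complex_of_real (sqrt (real (idx k i)) / sqrt 2) * (rep_l2 u x * hfun (lower_idx k i) x)
        - complex_of_real (sqrt (real (idx k i + 1)) / sqrt 2) * (rep_l2 u x * hfun (raise_idx k i) x))"
    unfolding pd_hfun by (simp add: fun_eq_iff diff_divide_distrib right_diff_distrib mult_ac)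
  also have "(LINT x|lborel. complex_of_real (sqrt (real (idx k i)) / sqrt 2) * (rep_l2 u x * hfun (lower_idx k i) x)
        - complex_of_real (sqrt (real (idx k i + 1)) / sqrt 2) * (rep_l2 u x * hfun (raise_idx k i) x))
      = complex_of_real (sqrt (real (idx k i)) / sqrt 2) * hcoeff u (lower_idx k i)
        - complex_of_real (sqrt (real (idx k i + 1)) / sqrt 2) * hcoeff u (raise_idx k i)"
    by (subst Bochner_Integration.integral_diff) (simp_all only: integrable_mult_right int integral_mult_right_zero hcoeff_eq)
  finally have *: "complex_of_real (sqrt (real (idx k i)) / sqrt 2) * hcoeff u (lower_idx k i)
        - complex_of_real (sqrt (real (idx k i + 1)) / sqrt 2) * hcoeff u (raise_idx k i) = - hcoeff w i" .
  have "hcoeff w i = - (- hcoeff w i)" by simp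
  then show ?thesis
    unfolding *[symmetric] by (simp add: diff_divide_distrib)
qed

text \<open>A relation parallel to \<open>has_weak_deriv\<close>: it asserts that the product is
  represented by an element of \<open>l2\<close>, so the unspecified values of
  \<open>mult_op\<close> outside its domain never enter an argument.\<close>

definition has_mult :: "(real \<times> real \<Rightarrow> real) \<Rightarrow> l2 \<Rightarrow> l2 \<Rightarrow> bool" where
  "has_mult m u w \<longleftrightarrow> (AE x in lborel. rep_l2 w x = complex_of_real (m x) * rep_l2 u x)"

lemma has_mult_hcoeff:
  assumes "has_mult (coord k) u w"
  shows "hcoeff w i = (complex_of_real (sqrt (real (idx k i + 1))) * hcoeff u (raise_idx k i)
    + complex_of_real (sqrt (real (idx k i))) * hcoeff u (lower_idx k i)) / complex_of_real (sqrt 2)"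
proof -
  have int: "integrable lborel (\<lambda>x. rep_l2 u x * hfun i x)" for i
    by (intro integrable_mult_sq_integrable sq_integrable_rep_l2 sq_integrable_HI)
  have "hcoeff w i = (LINT x|lborel. rep_l2 u x * (complex_of_real (coord k x) * hfun i x))"
    unfolding hcoeff_eq by (rule integral_cong_AE) (use assms in \<open>auto simp: has_mult_def\<close>)
  also have "\<dots> = (LINT x|lborel. complex_of_real (sqrt (real (idx k i)) / sqrt 2) * (rep_l2 u x * hfun (lower_idx k i) x)
        + complex_of_real (sqrt (real (idx k i + 1)) / sqrt 2) * (rep_l2 u x * hfun (raise_idx k i) x))"
    unfolding coord_hfun by (simp add: add_divide_distrib distrib_left mult_ac)
  also have "\<dots> = complex_of_real (sqrt (real (idx k i)) / sqrt 2) * hcoeff u (lower_idx k i)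
        + complex_of_real (sqrt (real (idx k i + 1)) / sqrt 2) * hcoeff u (raise_idx k i)"
    by (subst Bochner_Integration.integral_add) (simp_all only: integrable_mult_right int integral_mult_right_zero hcoeff_eq)
  finally show ?thesis
    by (simp add: add_divide_distrib)
qed

text \<open>The difference of two weak derivatives is orthogonal to all test functions, hence, after
  removal of the cutoff, to all Hermite functions; completeness makes it zero.\<close>

lemma has_weak_deriv_unique:
  assumes "has_weak_deriv v u w" "has_weak_deriv v u w'"
  shows "w = w'"
proof -
  have "hcoeff (w - w') i = 0" for i
    unfolding hcoeff_eq
  proof (rule test_orthogonal_imp_smooth_orthogonal[OF _ sq_integrable_rep_l2 smooth_hfun sq_integrable_HI])
    fix \<phi> assume \<phi>: "\<phi> \<in> test_functions"
    note sq = sq_integrable_test_function[OF \<phi>]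
    have [measurable]: "\<phi> \<in> borel_measurable borel" using sq by (simp add: sq_integrable_def)
    have "(LINT x|lborel. rep_l2 (w - w') x * \<phi> x) = (LINT x|lborel. rep_l2 w x * \<phi> x - rep_l2 w' x * \<phi> x)"
      by (rule integral_cong_AE) (use AE_rep_l2_diff[of w w'] in \<open>auto simp: left_diff_distrib\<close>)
    also have "\<dots> = (LINT x|lborel. rep_l2 w x * \<phi> x) - (LINT x|lborel. rep_l2 w' x * \<phi> x)"
      by (intro Bochner_Integration.integral_diff integrable_mult_sq_integrable sq_integrable_rep_l2 sq)
    also have "\<dots> = 0"
      using assms \<phi> unfolding has_weak_deriv_def by (metis cancel_comm_monoid_add_class.diff_cancel neg_equal_iff_equal)
    finally show "(LINT x|lborel. rep_l2 (w - w') x * \<phi> x) = 0" .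
  qed
  then have "w - w' = 0"
    by (rule hcoeff_zero_imp_zero)
  then show ?thesis by simp
qed

lemma weak_deriv_eqI: "has_weak_deriv v u w \<Longrightarrow> weak_deriv v u = w"
  unfolding weak_deriv_def using has_weak_deriv_unique by blast

lemma mult_op_eqI:
  assumes "has_mult m u w" and [measurable]: "m \<in> borel_measurable borel"
  shows "u \<in> mult_dom m" "mult_op m u = w"
proof -
  let ?f = "\<lambda>x. complex_of_real (m x) * rep_l2 u x"
  have ae: "AE x in lborel. (cmod (rep_l2 w x))\<^sup>2 = (cmod (?f x))\<^sup>2"
    using assms(1) unfolding has_mult_def by eventually_elim simp
  have "integrable lborel (\<lambda>x. (cmod (rep_l2 w x))\<^sup>2)"
    using sq_integrable_rep_l2[of w] by (simp add: sq_integrable_def)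
  then have sq: "sq_integrable ?f"
    unfolding sq_integrable_def by (subst (asm) integrable_cong_AE[OF _ _ ae]) auto
  then show "u \<in> mult_dom m" by (simp add: mult_dom_def)
  have "AE x in lborel. ?f x = rep_l2 w x"
    using assms(1) unfolding has_mult_def by eventually_elim simp
  then show "mult_op m u = w"
    unfolding mult_op_def using abs_l2_eq_iff[OF sq sq_integrable_rep_l2[of w]] by (simp add: abs_rep_l2)
qed

lemma mult_dom_has_mult: "u \<in> mult_dom m \<Longrightarrow> has_mult m u (mult_op m u)"
  unfolding has_mult_def mult_dom_def mult_op_def by (auto dest: AE_rep_abs_l2)

section \<open>Weak operators and convergent series\<close>

lemma cinner_has_sum:
  assumes "(f has_sum u) A"
  shows "((\<lambda>i. cinner a (f i)) has_sum cinner a u) A"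
  using has_sum_bounded_linear[OF bounded_linear_cinner_right assms, of a] by (simp add: o_def)

text \<open>This is closedness in the form used here: a relation between \<open>u\<close> and
  \<open>w\<close> that consists of equalities of bounded functionals passes to the sums of
  series.\<close>

lemma cinner_eq_has_sum:
  assumes "(f has_sum u) A" "(g has_sum w) A" "\<And>i. i \<in> A \<Longrightarrow> cinner a (f i) = cinner b (g i)"
  shows "cinner a u = cinner b w"
proof (rule has_sum_unique[OF cinner_has_sum[OF assms(1)]])
  show "((\<lambda>i. cinner a (f i)) has_sum cinner b w) A"
    by (rule iffD2[OF has_sum_cong cinner_has_sum[OF assms(2)]]) (rule assms(3))
qed

text \<open>The definition is recast as equalities of bounded functionals, so that it passes to
  series. The conjugates compensate the antilinearity of \<open>cinner\<close> in its first
  argument.\<close>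

lemma has_weak_deriv_iff_cinner:
  "has_weak_deriv v u w \<longleftrightarrow> (\<forall>\<phi>\<in>test_functions.
     cinner (abs_l2 (\<lambda>x. cnj (pd v \<phi> x))) u = cinner (- abs_l2 (\<lambda>x. cnj (\<phi> x))) w)"
proof -
  have *: "cinner (abs_l2 (\<lambda>x. cnj (\<phi> x))) u = (LINT x|lborel. rep_l2 u x * \<phi> x)" if "\<phi> \<in> test_functions" for \<phi> u
    using that by (simp add: cinner_abs_l2_left sq_integrable_cnj sq_integrable_test_function mult.commute)
  have m: "cinner (- a) b = - cinner a b" for a b
    using cinner_scaleC_left[of "-1" a b] by (simp add: uminus_l2_eq_scaleC[symmetric])
  show ?thesis
    unfolding has_weak_deriv_def by (simp add: * m test_function_pd)
qed

lemma has_weak_deriv_has_sum: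
  assumes "(f has_sum u) A" "(g has_sum w) A" "\<And>i. i \<in> A \<Longrightarrow> has_weak_deriv v (f i) (g i)"
  shows "has_weak_deriv v u w"
  using assms(3) cinner_eq_has_sum[OF assms(1,2)] unfolding has_weak_deriv_iff_cinner by blast

lemma has_weak_deriv_scaleC: "has_weak_deriv v u w \<Longrightarrow> has_weak_deriv v (c *\<^sub>C u) (c *\<^sub>C w)"
  unfolding has_weak_deriv_iff_cinner by (simp add: cinner_scaleC_right)

text \<open>For unbounded \<open>m\<close> the equation has to be divided by \<open>1 + m^2\<close>:
  then both multipliers are bounded by 1, can be moved to the Hermite function, and each equation
  compares two bounded functionals. Dividing by a function without zeros loses nothing, and the
  Hermite functions detect equality almost everywhere.\<close>

lemma has_mult_iff_cinner:
  assumes [measurable]: "m \<in> borel_measurable borel"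
  shows "has_mult m u w \<longleftrightarrow> (\<forall>i. cinner (abs_l2 (\<lambda>x. complex_of_real (m x / (1 + (m x)\<^sup>2)) * hfun i x)) u
     = cinner (abs_l2 (\<lambda>x. complex_of_real (1 / (1 + (m x)\<^sup>2)) * hfun i x)) w)"
proof -
  have bounded_mult: "sq_integrable (\<lambda>x. complex_of_real (b x) * f x)"
    if [measurable]: "b \<in> borel_measurable borel" and b: "\<And>x. \<bar>b x\<bar> \<le> 1" and f: "sq_integrable f" for b f
    unfolding sq_integrable_def
  proof
    have [measurable]: "f \<in> borel_measurable borel" using f by (simp add: sq_integrable_def)
    show "(\<lambda>x. complex_of_real (b x) * f x) \<in> borel_measurable lborel" by simp
    have "integrable lborel (\<lambda>x. (cmod (f x))\<^sup>2)" using f by (simp add: sq_integrable_def)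
    then show "integrable lborel (\<lambda>x. (cmod (complex_of_real (b x) * f x))\<^sup>2)"
    proof (rule Bochner_Integration.integrable_bound)
      have "(cmod (complex_of_real (b x) * f x))\<^sup>2 \<le> (cmod (f x))\<^sup>2" for x
        using b[of x] by (intro power_mono) (auto simp: norm_mult mult_left_le_one_le)
      then show "AE x in lborel. norm ((cmod (complex_of_real (b x) * f x))\<^sup>2) \<le> norm ((cmod (f x))\<^sup>2)"
        by simp
    qed simp
  qed
  define b where "b x = 1 / (1 + (m x)\<^sup>2)" for x
  have [measurable]: "b \<in> borel_measurable borel" unfolding b_def by measurable
  have pos: "1 + (m x)\<^sup>2 > 0" for x
    by (simp add: add_pos_nonneg)
  have b: "\<bar>b x\<bar> \<le> 1" "b x \<noteq> 0" for x
    using pos[of x] by (simp_all add: b_def)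
  have bm: "\<bar>m x * b x\<bar> \<le> 1" for x
  proof -
    have "0 \<le> (\<bar>m x\<bar> - 1/2)\<^sup>2 + 3/4" by simp
    then have "\<bar>m x\<bar> \<le> 1 + (m x)\<^sup>2" by (simp add: power2_eq_square algebra_simps)
    then show ?thesis using pos[of x] by (simp add: b_def abs_mult)
  qed
  have s1: "sq_integrable (\<lambda>x. complex_of_real (b x) * rep_l2 w x)"
    and s2: "sq_integrable (\<lambda>x. complex_of_real (m x * b x) * rep_l2 u x)"
    by (intro bounded_mult b bm sq_integrable_rep_l2; measurable)+
  have c1: "cinner (abs_l2 (\<lambda>x. complex_of_real (b x) * hfun i x)) w = hcoeff (abs_l2 (\<lambda>x. complex_of_real (b x) * rep_l2 w x)) i" for i
  proof -
    have "cinner (abs_l2 (\<lambda>x. complex_of_real (b x) * hfun i x)) w = (LINT x|lborel. cnj (complex_of_real (b x) * hfun i x) * rep_l2 w x)"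
      by (intro cinner_abs_l2_left bounded_mult b sq_integrable_HI) measurable
    also have "\<dots> = hcoeff (abs_l2 (\<lambda>x. complex_of_real (b x) * rep_l2 w x)) i"
      unfolding hcoeff_def hvec_eq cinner_abs_l2[OF sq_integrable_HI s1] by (simp add: mult_ac)
    finally show ?thesis .
  qed
  have c2: "cinner (abs_l2 (\<lambda>x. complex_of_real (m x * b x) * hfun i x)) u = hcoeff (abs_l2 (\<lambda>x. complex_of_real (m x * b x) * rep_l2 u x)) i" for i
  proof -
    have "cinner (abs_l2 (\<lambda>x. complex_of_real (m x * b x) * hfun i x)) u = (LINT x|lborel. cnj (complex_of_real (m x * b x) * hfun i x) * rep_l2 u x)"
      by (intro cinner_abs_l2_left bounded_mult bm sq_integrable_HI) measurable
    also have "\<dots> = hcoeff (abs_l2 (\<lambda>x. complex_of_real (m x * b x) * rep_l2 u x)) i"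
      unfolding hcoeff_def hvec_eq cinner_abs_l2[OF sq_integrable_HI s2] by (simp add: mult_ac)
    finally show ?thesis .
  qed
  have "(\<forall>i. cinner (abs_l2 (\<lambda>x. complex_of_real (m x * b x) * hfun i x)) u = cinner (abs_l2 (\<lambda>x. complex_of_real (b x) * hfun i x)) w)
     \<longleftrightarrow> abs_l2 (\<lambda>x. complex_of_real (m x * b x) * rep_l2 u x) = abs_l2 (\<lambda>x. complex_of_real (b x) * rep_l2 w x)"
    unfolding c1 c2 by (auto intro: hcoeff_eqI)
  also have "\<dots> \<longleftrightarrow> (AE x in lborel. complex_of_real (m x * b x) * rep_l2 u x = complex_of_real (b x) * rep_l2 w x)"
    by (rule abs_l2_eq_iff[OF s2 s1])
  also have "\<dots> \<longleftrightarrow> has_mult m u w"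
    unfolding has_mult_def using b(2) by (intro AE_cong) (auto simp: mult_ac)
  finally show ?thesis by (simp add: b_def)
qed

lemma has_mult_has_sum:
  assumes "(f has_sum u) A" "(g has_sum w) A" "\<And>i. i \<in> A \<Longrightarrow> has_mult m (f i) (g i)" "m \<in> borel_measurable borel"
  shows "has_mult m u w"
  using assms(3) cinner_eq_has_sum[OF assms(1,2)] unfolding has_mult_iff_cinner[OF assms(4)] by blast

lemma has_mult_scaleC: "m \<in> borel_measurable borel \<Longrightarrow> has_mult m u w \<Longrightarrow> has_mult m (c *\<^sub>C u) (c *\<^sub>C w)"
  by (simp add: has_mult_iff_cinner cinner_scaleC_right)

section \<open>The Hermite expansion and the domain of the oscillator\<close>

lemma cinner_scaled_hvec:
  "cinner (a *\<^sub>C hvec i) (b *\<^sub>C hvec j) = (if i = j then cnj a * b else 0)"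
  by (simp add: cinner_scaleC_left cinner_scaleC_right cinner_hvec)

text \<open>Injectivity of \<open>r\<close> is asked for only where \<open>c\<close> is nonzero
  because \<open>lower_idx\<close> sends the indices 0 and 1 to the same value; the coefficient
  belonging to 0 vanishes there.\<close>

lemma summable_on_scaled_hvec:
  assumes inj: "\<And>i j. c i \<noteq> 0 \<Longrightarrow> c j \<noteq> 0 \<Longrightarrow> r i = r j \<Longrightarrow> i = j"
    and sq: "(\<lambda>i. (cmod (c i))\<^sup>2) summable_on A"
  shows "(\<lambda>i. c i *\<^sub>C hvec (r i)) summable_on A"
proof (rule summable_on_orthogonal)
  show "cinner (c i *\<^sub>C hvec (r i)) (c j *\<^sub>C hvec (r j)) = 0" if "i \<noteq> j" for i j
    using inj[of i j] that by (auto simp: cinner_scaled_hvec)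
  show "(\<lambda>i. (norm (c i *\<^sub>C hvec (r i)))\<^sup>2) summable_on A"
    using sq by (simp add: norm_scaleC norm_hvec)
qed

lemma Bessel:
  assumes "finite F"
  shows "(\<Sum>i\<in>F. (cmod (hcoeff u i))\<^sup>2) \<le> (norm u)\<^sup>2"
proof -
  define p where "p = (\<Sum>i\<in>F. hcoeff u i *\<^sub>C hvec i)"
  have "cinner p u = complex_of_real (\<Sum>i\<in>F. (cmod (hcoeff u i))\<^sup>2)"
    by (simp add: p_def cinner_sum_left cinner_scaleC_left hcoeff_def[symmetric] complex_norm_square mult.commute del: of_real_power)
  then have "cmod (cinner p u) = (\<Sum>i\<in>F. (cmod (hcoeff u i))\<^sup>2)"
    by (simp only: norm_of_real abs_of_nonneg sum_nonneg zero_le_power2)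
  moreover have pp: "(norm p)\<^sup>2 = (\<Sum>i\<in>F. (cmod (hcoeff u i))\<^sup>2)"
    unfolding p_def by (subst norm_sum_orthogonal[OF assms]) (auto simp: cinner_scaled_hvec norm_scaleC norm_hvec)
  ultimately have "(norm p)\<^sup>2 \<le> norm p * norm u"
    using norm_cinner_le[of p u] by (simp only:)
  then have "norm p \<le> norm u"
    by (cases "norm p = 0") (auto simp: power2_eq_square)
  then have "(norm p)\<^sup>2 \<le> (norm u)\<^sup>2"
    by (intro power_mono) auto
  then show ?thesis by (simp only: pp)
qed

lemma hcoeff_square_summable: "(\<lambda>i. (cmod (hcoeff u i))\<^sup>2) summable_on UNIV"
  by (intro nonneg_bdd_above_summable_on bdd_aboveI2[where M = "(norm u)\<^sup>2"] Bessel) auto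

lemma hcoeff_has_sum:
  assumes "((\<lambda>i. c i *\<^sub>C hvec i) has_sum u) UNIV"
  shows "hcoeff u j = c j"
proof -
  have "((\<lambda>i. cinner (hvec j) (c i *\<^sub>C hvec i)) has_sum hcoeff u j) UNIV"
    unfolding hcoeff_def by (rule cinner_has_sum[OF assms])
  moreover have "((\<lambda>i. cinner (hvec j) (c i *\<^sub>C hvec i)) has_sum c j) UNIV"
  proof -
    have "((\<lambda>i. cinner (hvec j) (c i *\<^sub>C hvec i)) has_sum (\<Sum>i\<in>{j}. cinner (hvec j) (c i *\<^sub>C hvec i))) {j}"
      by (rule has_sum_finite) simp
    also have "?this \<longleftrightarrow> ((\<lambda>i. cinner (hvec j) (c i *\<^sub>C hvec i)) has_sum (\<Sum>i\<in>{j}. cinner (hvec j) (c i *\<^sub>C hvec i))) UNIV"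
      by (rule has_sum_cong_neutral) (auto simp: cinner_scaleC_right cinner_hvec)
    finally show ?thesis
      by (simp add: cinner_scaleC_right cinner_hvec)
  qed
  ultimately show ?thesis
    by (rule has_sum_unique)
qed

text \<open>By the Bessel inequality the series converges to something; the sum has the same
  coefficients as \<open>u\<close>, and completeness identifies the two.\<close>

lemma Hermite_expansion: "((\<lambda>i. hcoeff u i *\<^sub>C hvec i) has_sum u) UNIV"
proof -
  obtain v where v: "((\<lambda>i. hcoeff u i *\<^sub>C hvec i) has_sum v) UNIV"
    using summable_on_scaled_hvec[of "hcoeff u" "\<lambda>i. i", OF _ hcoeff_square_summable] unfolding summable_on_def by blast
  then have "v = u"
    by (intro hcoeff_eqI) (rule hcoeff_has_sum)
  with v show ?thesis by simp
qed

section \<open>Weighted coefficient spaces\<close>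

text \<open>Since \<open>H0\<close> multiplies the coefficient at \<open>i\<close> by
  \<open>level i + 1\<close>, this is the domain of the power \<open>n / 2\<close> of the
  oscillator: \<open>osc_dom 2\<close> is the operator domain, \<open>osc_dom 1\<close> the form
  domain, on which derivatives and multiplications by coordinates exist.\<close>

definition osc_dom :: "nat \<Rightarrow> l2 set" where
  "osc_dom n = {u. (\<lambda>i. real (level i + 1) ^ n * (cmod (hcoeff u i))\<^sup>2) summable_on UNIV}"

lemma summable_on_comparison:
  fixes f g :: "'i \<Rightarrow> real"
  assumes "g summable_on A" "\<And>i. i \<in> A \<Longrightarrow> 0 \<le> f i" "\<And>i. i \<in> A \<Longrightarrow> f i \<le> g i"
  shows "f summable_on A"
  by (rule summable_on_comparison_test[OF assms(1)]) (use assms in auto)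

lemma osc_dom_mono: "m \<le> n \<Longrightarrow> osc_dom n \<subseteq> osc_dom m"
  unfolding osc_dom_def
  by (auto intro!: mult_right_mono power_increasing elim!: summable_on_comparison)

lemma sqrt_half_bound: "(cmod (a * complex_of_real (sqrt (real n) / sqrt 2)))\<^sup>2 = real n / 2 * (cmod a)\<^sup>2"
  by (simp add: norm_mult power_mult_distrib power_divide norm_divide)

lemma abs_l2_combination:
  assumes "sq_integrable f" "sq_integrable g"
  shows "abs_l2 (\<lambda>x. a * f x + b * g x) = a *\<^sub>C abs_l2 f + b *\<^sub>C abs_l2 g"
  using assms plus_l2.abs_eq[of "\<lambda>x. a * f x" "\<lambda>x. b * g x"] scaleC.abs_eq[of f a] scaleC.abs_eq[of g b]
  by (simp add: l2_eq_def sq_integrable_scale)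

lemma pd_hfun_sum: "pd (unit_dir k) (hfun i) = (\<lambda>x. complex_of_real (sqrt (real (idx k i)) / sqrt 2) * hfun (lower_idx k i) x
    + (- complex_of_real (sqrt (real (idx k i + 1)) / sqrt 2)) * hfun (raise_idx k i) x)"
  unfolding pd_hfun by (simp add: fun_eq_iff diff_divide_distrib)

text \<open>
  Differentiation and multiplication send \<open>hvec i\<close> to combinations of its two neighbours, so the
  image of the Hermite expansion splits into two orthogonal series.
\<close>

lemma
  assumes "u \<in> osc_dom 1"
  shows ex_has_weak_deriv: "\<exists>w. has_weak_deriv (unit_dir k) u w"
    and ex_has_mult_coord: "\<exists>w. has_mult (coord k) u w"
proof -
  let ?a = "\<lambda>i. hcoeff u i * complex_of_real (sqrt (real (idx k i)) / sqrt 2)"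
  let ?b = "\<lambda>i. hcoeff u i * complex_of_real (sqrt (real (idx k i + 1)) / sqrt 2)"
  have sum: "(\<lambda>i. real (level i + 1) * (cmod (hcoeff u i))\<^sup>2) summable_on UNIV"
    using assms by (simp add: osc_dom_def)
  have "(\<lambda>i. ?a i *\<^sub>C hvec (lower_idx k i)) summable_on UNIV"
  proof (rule summable_on_scaled_hvec)
    show "i = j" if "?a i \<noteq> 0" "?a j \<noteq> 0" "lower_idx k i = lower_idx k j" for i j
    proof -
      have "idx k i > 0" "idx k j > 0"
        using that(1,2) by (auto intro: gr0I)
      then show ?thesis
        using that(3) by (metis raise_idx_lower_idx)
    qed
    show "(\<lambda>i. (cmod (?a i))\<^sup>2) summable_on UNIV"
      unfolding sqrt_half_bound
    proof (rule summable_on_comparison[OF sum])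
      show "real (idx k i) / 2 * (cmod (hcoeff u i))\<^sup>2 \<le> real (level i + 1) * (cmod (hcoeff u i))\<^sup>2" for i
        using idx_le_level[of k i] by (intro mult_right_mono) auto
    qed simp
  qed
  then obtain A where A: "((\<lambda>i. ?a i *\<^sub>C hvec (lower_idx k i)) has_sum A) UNIV"
    by (auto simp: summable_on_def)
  have "(\<lambda>i. ?b i *\<^sub>C hvec (raise_idx k i)) summable_on UNIV"
  proof (rule summable_on_scaled_hvec)
    show "i = j" if "raise_idx k i = raise_idx k j" for i j
      using that injD[OF inj_raise_idx] by blast
    show "(\<lambda>i. (cmod (?b i))\<^sup>2) summable_on UNIV"
      unfolding sqrt_half_bound
    proof (rule summable_on_comparison[OF sum])
      show "real (idx k i + 1) / 2 * (cmod (hcoeff u i))\<^sup>2 \<le> real (level i + 1) * (cmod (hcoeff u i))\<^sup>2" for i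
        using idx_le_level[of k i] by (intro mult_right_mono) auto
    qed simp
  qed
  then obtain B where B: "((\<lambda>i. ?b i *\<^sub>C hvec (raise_idx k i)) has_sum B) UNIV"
    by (auto simp: summable_on_def)
  have diff: "((\<lambda>i. ?a i *\<^sub>C hvec (lower_idx k i) + (- (?b i *\<^sub>C hvec (raise_idx k i)))) has_sum (A + (- B))) UNIV"
    by (intro has_sum_add A) (use B in \<open>simp add: has_sum_uminus\<close>)
  have add: "((\<lambda>i. ?a i *\<^sub>C hvec (lower_idx k i) + ?b i *\<^sub>C hvec (raise_idx k i)) has_sum (A + B)) UNIV"
    by (intro has_sum_add A B)
  have "has_weak_deriv (unit_dir k) (hcoeff u i *\<^sub>C hvec i) (?a i *\<^sub>C hvec (lower_idx k i) + (- (?b i *\<^sub>C hvec (raise_idx k i))))" for i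
  proof -
    have "has_weak_deriv (unit_dir k) (hcoeff u i *\<^sub>C hvec i) (hcoeff u i *\<^sub>C abs_l2 (pd (unit_dir k) (hfun i)))"
      unfolding hvec_eq by (intro has_weak_deriv_scaleC has_weak_deriv_abs_l2 smooth_hfun sq_integrable_HI sq_integrable_pd_hfun)
    also have "hcoeff u i *\<^sub>C abs_l2 (pd (unit_dir k) (hfun i)) = ?a i *\<^sub>C hvec (lower_idx k i) + (- (?b i *\<^sub>C hvec (raise_idx k i)))"
      unfolding pd_hfun_sum abs_l2_combination[OF sq_integrable_HI sq_integrable_HI] hvec_eq[symmetric]
      by (simp only: L2.scale_right_distrib L2.scale_scale L2.scale_minus_left L2.scale_minus_right)
    finally show ?thesis .
  qed
  from has_weak_deriv_has_sum[OF Hermite_expansion diff this] show "\<exists>w. has_weak_deriv (unit_dir k) u w" by blast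
  have "has_mult (coord k) (hcoeff u i *\<^sub>C hvec i) (?a i *\<^sub>C hvec (lower_idx k i) + ?b i *\<^sub>C hvec (raise_idx k i))" for i
  proof -
    let ?w = "abs_l2 (\<lambda>x. complex_of_real (coord k x) * hfun i x)"
    have m: "has_mult (coord k) (hvec i) ?w"
      unfolding has_mult_def hvec_eq
      using AE_rep_abs_l2[OF sq_integrable_HI[of i]] AE_rep_abs_l2[OF sq_integrable_coord_hfun[of k i]]
      by eventually_elim simp
    have "hcoeff u i *\<^sub>C ?w = ?a i *\<^sub>C hvec (lower_idx k i) + ?b i *\<^sub>C hvec (raise_idx k i)"
    proof -
      have "(\<lambda>x. complex_of_real (coord k x) * hfun i x) = (\<lambda>x. complex_of_real (sqrt (real (idx k i)) / sqrt 2) * hfun (lower_idx k i) x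
          + complex_of_real (sqrt (real (idx k i + 1)) / sqrt 2) * hfun (raise_idx k i) x)"
        unfolding coord_hfun by (simp add: fun_eq_iff add_divide_distrib)
      then have "?w = complex_of_real (sqrt (real (idx k i)) / sqrt 2) *\<^sub>C hvec (lower_idx k i) + complex_of_real (sqrt (real (idx k i + 1)) / sqrt 2) *\<^sub>C hvec (raise_idx k i)"
        by (simp only: abs_l2_combination[OF sq_integrable_HI sq_integrable_HI] hvec_eq)
      then show ?thesis
        by (simp only: L2.scale_right_distrib L2.scale_scale)
    qed
    with has_mult_scaleC[OF _ m, of "hcoeff u i"] show ?thesis by simp
  qed
  from has_mult_has_sum[OF Hermite_expansion add this borel_measurable_coord] show "\<exists>w. has_mult (coord k) u w" by blast
qed

lemma shift_raise_idx_summable: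
  fixes G :: "nat \<times> nat \<Rightarrow> real"
  assumes "G summable_on UNIV"
  shows "(\<lambda>i. G (raise_idx k i)) summable_on UNIV"
  using summable_on_reindex[OF inj_raise_idx, of G k] summable_on_subset_banach[OF assms, of "range (raise_idx k)"]
  by (simp add: o_def)

lemma shift_lower_idx_summable:
  fixes G :: "nat \<times> nat \<Rightarrow> real"
  assumes "G summable_on UNIV"
  shows "(\<lambda>i. if idx k i = 0 then 0 else G (lower_idx k i)) summable_on UNIV"
proof -
  let ?F = "\<lambda>i. if idx k i = 0 then 0 else G (lower_idx k i)"
  have "(\<lambda>i. ?F (raise_idx k i)) summable_on UNIV"
    using assms by (simp add: idx_raise_idx lower_idx_raise_idx)
  then have "?F summable_on (range (raise_idx k))"
    using summable_on_reindex[OF inj_raise_idx, of ?F k] by (simp add: o_def)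
  moreover have "?F i = 0" if "i \<notin> range (raise_idx k)" for i
    using raise_idx_lower_idx[of k i] that by (metis gr0I rangeI)
  ultimately show ?thesis
    using summable_on_cong_neutral[of UNIV "range (raise_idx k)" ?F ?F] by auto
qed

text \<open>Shifting a coefficient by one level costs one power of the weight.\<close>

lemma osc_dom_shift:
  assumes u: "u \<in> osc_dom 2"
    and w: "\<And>i. hcoeff w i = \<alpha> * complex_of_real (sqrt (real (idx k i + 1))) * hcoeff u (raise_idx k i)
      + \<beta> * complex_of_real (sqrt (real (idx k i))) * hcoeff u (lower_idx k i)"
  shows "w \<in> osc_dom 1"
proof -
  have sum: "(\<lambda>i. real (level i + 1) ^ 2 * (cmod (hcoeff u i))\<^sup>2) summable_on UNIV"
    using u by (simp add: osc_dom_def)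
  \<comment> \<open>One factor 2 in each weight comes from
    \<open>(x + y)^2 \<le> 2 * x^2 + 2 * y^2\<close>. The further 2 in \<open>?K\<close> pays for
    comparing \<open>level i + 1\<close> with the smaller weight at the lowered index.\<close>
  let ?G = "\<lambda>i. 2 * (cmod \<alpha>)\<^sup>2 * (real (level i + 1) ^ 2 * (cmod (hcoeff u i))\<^sup>2)"
  let ?K = "\<lambda>i. 4 * (cmod \<beta>)\<^sup>2 * (real (level i + 1) ^ 2 * (cmod (hcoeff u i))\<^sup>2)"
  have "(\<lambda>i. ?G (raise_idx k i) + (if idx k i = 0 then 0 else ?K (lower_idx k i))) summable_on UNIV"
    by (intro summable_on_add shift_raise_idx_summable shift_lower_idx_summable summable_on_cmult_right sum)
  then have "(\<lambda>i. real (level i + 1) ^ 1 * (cmod (hcoeff w i))\<^sup>2) summable_on UNIV"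
  proof (rule summable_on_comparison)
    fix i
    show "0 \<le> real (level i + 1) ^ 1 * (cmod (hcoeff w i))\<^sup>2" by simp
    let ?x = "cmod (\<alpha> * complex_of_real (sqrt (real (idx k i + 1))) * hcoeff u (raise_idx k i))"
    let ?y = "cmod (\<beta> * complex_of_real (sqrt (real (idx k i))) * hcoeff u (lower_idx k i))"
    have "(cmod (hcoeff w i))\<^sup>2 \<le> (?x + ?y)\<^sup>2"
      unfolding w by (intro power_mono norm_triangle_ineq) auto
    also have "\<dots> \<le> 2 * ?x\<^sup>2 + 2 * ?y\<^sup>2"
      using sum_squares_bound[of ?x ?y] by (simp add: power2_sum)
    finally have "real (level i + 1) * (cmod (hcoeff w i))\<^sup>2 \<le> real (level i + 1) * (2 * ?x\<^sup>2 + 2 * ?y\<^sup>2)"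
      by (intro mult_left_mono) auto
    also have "\<dots> = 2 * (real (level i + 1) * ?x\<^sup>2) + 2 * (real (level i + 1) * ?y\<^sup>2)"
      by (simp add: algebra_simps)
    also have "\<dots> \<le> ?G (raise_idx k i) + (if idx k i = 0 then 0 else ?K (lower_idx k i))"
    proof (rule add_mono)
      have "real (level i + 1) * real (idx k i + 1) \<le> (real (level (raise_idx k i) + 1))\<^sup>2"
        unfolding power2_eq_square using idx_le_level[of k i] by (intro mult_mono) (auto simp: level_raise_idx)
      then have "(real (level i + 1) * real (idx k i + 1)) * ((cmod \<alpha>)\<^sup>2 * (cmod (hcoeff u (raise_idx k i)))\<^sup>2)
          \<le> (real (level (raise_idx k i) + 1))\<^sup>2 * ((cmod \<alpha>)\<^sup>2 * (cmod (hcoeff u (raise_idx k i)))\<^sup>2)"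
        by (intro mult_right_mono) auto
      then show "2 * (real (level i + 1) * ?x\<^sup>2) \<le> ?G (raise_idx k i)"
        by (simp add: norm_mult power_mult_distrib mult_ac del: of_nat_add of_nat_Suc)
      show "2 * (real (level i + 1) * ?y\<^sup>2) \<le> (if idx k i = 0 then 0 else ?K (lower_idx k i))"
      proof (cases "idx k i = 0")
        case False
        then have level: "level i = level (lower_idx k i) + 1"
          using level_raise_idx[of k "lower_idx k i"] raise_idx_lower_idx[of k i] by simp
        have "real (level i + 1) * real (idx k i) \<le> (2 * real (level (lower_idx k i) + 1)) * real (level (lower_idx k i) + 1)"
          using idx_le_level[of k i] level by (intro mult_mono) auto
        then have "real (level i + 1) * real (idx k i) \<le> 2 * (real (level (lower_idx k i) + 1))\<^sup>2"
          by (simp only: power2_eq_square mult.assoc)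
        then have "(real (level i + 1) * real (idx k i)) * ((cmod \<beta>)\<^sup>2 * (cmod (hcoeff u (lower_idx k i)))\<^sup>2)
            \<le> (2 * (real (level (lower_idx k i) + 1))\<^sup>2) * ((cmod \<beta>)\<^sup>2 * (cmod (hcoeff u (lower_idx k i)))\<^sup>2)"
          by (intro mult_right_mono) auto
        with False show ?thesis
          by (simp add: norm_mult power_mult_distrib mult_ac del: of_nat_add of_nat_Suc)
      qed simp
    qed
    finally show "real (level i + 1) ^ 1 * (cmod (hcoeff w i))\<^sup>2 \<le> ?G (raise_idx k i) + (if idx k i = 0 then 0 else ?K (lower_idx k i))"
      by simp
  qed
  then show ?thesis by (simp add: osc_dom_def)
qed

lemma has_weak_deriv_osc_dom:
  assumes "u \<in> osc_dom 2" "has_weak_deriv (unit_dir k) u w"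
  shows "w \<in> osc_dom 1"
  by (rule osc_dom_shift[OF assms(1), of _ "1 / complex_of_real (sqrt 2)" k "- 1 / complex_of_real (sqrt 2)"])
     (simp add: has_weak_deriv_hcoeff[OF assms(2)] diff_divide_distrib)

lemma has_mult_osc_dom:
  assumes "u \<in> osc_dom 2" "has_mult (coord k) u w"
  shows "w \<in> osc_dom 1"
  by (rule osc_dom_shift[OF assms(1), of _ "1 / complex_of_real (sqrt 2)" k "1 / complex_of_real (sqrt 2)"])
     (simp add: has_mult_hcoeff[OF assms(2)] add_divide_distrib)

section \<open>The operators in terms of coefficients\<close>

text \<open>Applying the ladder formulas twice, the terms two indices away agree in the
  multiplication and in the second derivative, and cancel; the diagonal terms add up to the
  oscillator eigenvalue.\<close>

lemma second_derivative_hfun: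
  "complex_of_real ((coord k x)\<^sup>2) * hfun i x - pd (unit_dir k) (pd (unit_dir k) (hfun i)) x = of_nat (2 * idx k i + 1) * hfun i x"
proof -
  define s where "s n = complex_of_real (sqrt (real n))" for n
  define r where "r = complex_of_real (sqrt 2)"
  have r: "r * r = 2" "r \<noteq> 0" by (simp_all add: r_def flip: of_real_mult)
  have s: "s n * s n = of_nat n" for n by (simp add: s_def flip: of_real_mult)
  have pdHI: "pd (unit_dir k) (hfun i) = (\<lambda>x. (s (idx k i) / r) * hfun (lower_idx k i) x + (- s (idx k i + 1) / r) * hfun (raise_idx k i) x)" for i
    unfolding pd_hfun s_def r_def by (simp add: fun_eq_iff diff_divide_distrib)
  have cHI: "complex_of_real (coord k x) * hfun i x = (s (idx k i) * hfun (lower_idx k i) x + s (idx k i + 1) * hfun (raise_idx k i) x) / r" for i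
    unfolding coord_hfun s_def r_def ..
  have lin: "pd v (\<lambda>x. a * f x + b * g x) x = a * pd v f x + b * pd v g x" if "smooth f" "smooth g" for a b f g v x
    using that by (intro pd_eqI has_derivative_add has_derivative_mult_right has_derivative_pd smooth_imp_differentiable)
  have "pd (unit_dir k) (pd (unit_dir k) (hfun i)) x = (s (idx k i) / r) * pd (unit_dir k) (hfun (lower_idx k i)) x + (- s (idx k i + 1) / r) * pd (unit_dir k) (hfun (raise_idx k i)) x"
    unfolding pdHI[of i] by (intro lin smooth_hfun)
  also have "\<dots> = (s (idx k i) * (s (idx k i - 1) * hfun (lower_idx k (lower_idx k i)) x - s (idx k i - 1 + 1) * hfun (raise_idx k (lower_idx k i)) x)
       - s (idx k i + 1) * (s (idx k i + 1) * hfun i x - s (idx k i + 2) * hfun (raise_idx k (raise_idx k i)) x)) / (r * r)"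
    unfolding pdHI using r(2) by (simp add: idx_raise_idx idx_lower_idx lower_idx_raise_idx field_simps)
  finally have d: "pd (unit_dir k) (pd (unit_dir k) (hfun i)) x = \<dots>" .
  have "complex_of_real ((coord k x)\<^sup>2) * hfun i x = complex_of_real (coord k x) * (complex_of_real (coord k x) * hfun i x)"
    by (simp add: power2_eq_square)
  also have "\<dots> = (s (idx k i) * (complex_of_real (coord k x) * hfun (lower_idx k i) x) + s (idx k i + 1) * (complex_of_real (coord k x) * hfun (raise_idx k i) x)) / r"
    unfolding cHI[of i] by (simp add: algebra_simps)
  also have "\<dots> = (s (idx k i) * (s (idx k i - 1) * hfun (lower_idx k (lower_idx k i)) x + s (idx k i - 1 + 1) * hfun (raise_idx k (lower_idx k i)) x)
       + s (idx k i + 1) * (s (idx k i + 1) * hfun i x + s (idx k i + 2) * hfun (raise_idx k (raise_idx k i)) x)) / (r * r)"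
    unfolding cHI using r(2) by (simp add: idx_raise_idx idx_lower_idx lower_idx_raise_idx field_simps)
  finally have m: "complex_of_real ((coord k x)\<^sup>2) * hfun i x = \<dots>" .
  have "complex_of_real ((coord k x)\<^sup>2) * hfun i x - pd (unit_dir k) (pd (unit_dir k) (hfun i)) x
      = s (idx k i) * s (idx k i - 1 + 1) * hfun (raise_idx k (lower_idx k i)) x + s (idx k i + 1) * s (idx k i + 1) * hfun i x"
    unfolding d m r(1) by (simp add: field_simps)
  \<comment> \<open>At index 0, lowering and then raising is not the identity and
    \<open>0 - 1 + 1\<close> is 1, but then the factor \<open>s 0\<close> is zero on both
    sides.\<close>
  also have "s (idx k i) * s (idx k i - 1 + 1) * hfun (raise_idx k (lower_idx k i)) x = of_nat (idx k i) * hfun i x"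
    using s[of "idx k i"] raise_idx_lower_idx[of k i] s[of 0] by (cases "idx k i = 0") auto
  finally show ?thesis
    unfolding s by (simp add: algebra_simps)
qed

lemma sq_integrable_pd_pd_hfun: "sq_integrable (pd (unit_dir k) (pd (unit_dir k) (hfun i)))"
proof -
  let ?a = "complex_of_real (sqrt (real (idx k i)) / sqrt 2)"
  let ?b = "- complex_of_real (sqrt (real (idx k i + 1)) / sqrt 2)"
  have "pd (unit_dir k) (hfun i) = (\<lambda>x. ?a * hfun (lower_idx k i) x + ?b * hfun (raise_idx k i) x)"
    by (rule pd_hfun_sum)
  then have "pd (unit_dir k) (pd (unit_dir k) (hfun i)) = (\<lambda>x. ?a * pd (unit_dir k) (hfun (lower_idx k i)) x + ?b * pd (unit_dir k) (hfun (raise_idx k i)) x)"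
    by (simp only:) (intro ext pd_eqI has_derivative_add has_derivative_mult_right has_derivative_pd smooth_imp_differentiable smooth_hfun)
  then show ?thesis
    by (simp only:) (intro sq_integrable_add sq_integrable_scale sq_integrable_pd_hfun)
qed

text \<open>For one inclusion, \<open>r^2 * u\<close> minus the distributional Laplacian is an
  \<open>l2\<close> function whose coefficients are \<open>2 * (level i + 1)\<close> times those of
  \<open>u\<close>; their square summability is the weight condition. For the other, each
  first-order operation maps \<open>osc_dom 2\<close> into \<open>osc_dom 1\<close>, where a second
  one is available, so all second-order objects exist separately and can be added.\<close>

lemma H0_dom_eq: "H0_dom = osc_dom 2"
proof (intro equalityI subsetI)
  fix u assume u: "u \<in> H0_dom"
  then obtain w where w: "has_weak_laplacian u w"
    by (auto simp: H0_dom_def laplacian_dom_def)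
  let ?r = "\<lambda>x::real \<times> real. (fst x)\<^sup>2 + (snd x)\<^sup>2"
  obtain v where v: "has_mult ?r u v"
    using u mult_dom_has_mult by (auto simp: H0_dom_def)
  have cfd: "hcoeff (v - w) i = of_nat (2 * (level i + 1)) * hcoeff u i" for i
  proof -
    let ?L = "\<lambda>x. pd (1, 0) (pd (1, 0) (hfun i)) x + pd (0, 1) (pd (0, 1) (hfun i)) x"
    have sq: "sq_integrable (pd v (hfun i))" "sq_integrable (pd v (pd v (hfun i)))" if "v \<in> {(1, 0), (0, 1)}" for v
    proof -
      have "v = unit_dir True \<or> v = unit_dir False"
        using that by (simp add: unit_dir_simps)
      then show "sq_integrable (pd v (hfun i))" "sq_integrable (pd v (pd v (hfun i)))"
        using sq_integrable_pd_hfun[of _ i] sq_integrable_pd_pd_hfun[of _ i] by metis+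
    qed
    have L: "hcoeff w i = (LINT x|lborel. rep_l2 u x * ?L x)"
      unfolding hcoeff_eq by (intro has_weak_laplacian_smooth[OF w, symmetric] smooth_hfun sq_integrable_HI sq)
    have "sq_integrable ?L"
      by (intro sq_integrable_add sq) auto
    then have iL: "integrable lborel (\<lambda>x. rep_l2 u x * ?L x)"
      by (intro integrable_mult_sq_integrable sq_integrable_rep_l2)
    have "hcoeff (v - w) i = (LINT x|lborel. rep_l2 v x * hfun i x) - (LINT x|lborel. rep_l2 u x * ?L x)"
      unfolding hcoeff_diff L hcoeff_eq[of v] ..
    also have "\<dots> = (LINT x|lborel. rep_l2 v x * hfun i x - rep_l2 u x * ?L x)"
      by (intro Bochner_Integration.integral_diff[symmetric] iL integrable_mult_sq_integrable sq_integrable_rep_l2 sq_integrable_HI)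
    also have "\<dots> = (LINT x|lborel. of_nat (2 * (level i + 1)) * (rep_l2 u x * hfun i x))"
    proof (rule integral_cong_AE)
      show "AE x in lborel. rep_l2 v x * hfun i x - rep_l2 u x * ?L x = of_nat (2 * (level i + 1)) * (rep_l2 u x * hfun i x)"
        using v unfolding has_mult_def
      proof eventually_elim
        case (elim x)
        have "complex_of_real (?r x) * hfun i x - ?L x
            = (complex_of_real ((coord True x)\<^sup>2) * hfun i x - pd (unit_dir True) (pd (unit_dir True) (hfun i)) x)
            + (complex_of_real ((coord False x)\<^sup>2) * hfun i x - pd (unit_dir False) (pd (unit_dir False) (hfun i)) x)"
          by (simp add: coord_simps unit_dir_simps algebra_simps)
        also have "\<dots> = of_nat (2 * (level i + 1)) * hfun i x"
          unfolding second_derivative_hfun by (simp add: idx_defs algebra_simps)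
        finally have "complex_of_real (?r x) * hfun i x - ?L x = of_nat (2 * (level i + 1)) * hfun i x" .
        then have "rep_l2 u x * (complex_of_real (?r x) * hfun i x - ?L x) = rep_l2 u x * (of_nat (2 * (level i + 1)) * hfun i x)"
          by (simp only:)
        then show ?case
          unfolding elim by (simp only: right_diff_distrib mult_ac)
      qed
    qed (use iL in \<open>auto simp: borel_measurable_integrable\<close>)
    also have "\<dots> = of_nat (2 * (level i + 1)) * hcoeff u i"
      by (simp add: hcoeff_eq)
    finally show ?thesis .
  qed
  have "(\<lambda>i. (cmod (hcoeff (v - w) i))\<^sup>2) summable_on UNIV"
    by (rule hcoeff_square_summable)
  then show "u \<in> osc_dom 2"
    unfolding osc_dom_def mem_Collect_eq cfd
  proof (rule summable_on_comparison)
    fix i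
    have "(real (level i + 1) * cmod (hcoeff u i))\<^sup>2 \<le> (cmod (of_nat (2 * (level i + 1)) * hcoeff u i))\<^sup>2"
      unfolding norm_mult norm_of_nat by (intro power_mono mult_right_mono) auto
    then show "real (level i + 1) ^ 2 * (cmod (hcoeff u i))\<^sup>2 \<le> (cmod (of_nat (2 * (level i + 1)) * hcoeff u i))\<^sup>2"
      by (simp only: power_mult_distrib)
  qed simp
next
  fix u assume u: "u \<in> osc_dom 2"
  then have u1: "u \<in> osc_dom 1"
    using osc_dom_mono[of 1 2] by auto
  have "\<exists>w w'. has_weak_deriv (unit_dir k) u w \<and> has_weak_deriv (unit_dir k) w w'" for k
    using ex_has_weak_deriv[OF u1, of k] has_weak_deriv_osc_dom[OF u, of k] ex_has_weak_deriv by blast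
  then obtain w w' where w: "\<And>k. has_weak_deriv (unit_dir k) u (w k)" "\<And>k. has_weak_deriv (unit_dir k) (w k) (w' k)"
    by metis
  have "has_weak_laplacian u (w' True + w' False)"
    unfolding has_weak_laplacian_def
  proof
    fix \<phi> assume \<phi>: "\<phi> \<in> test_functions"
    have sq: "sq_integrable (pd (unit_dir k) (pd (unit_dir k) \<phi>))" "sq_integrable \<phi>" for k
      by (intro sq_integrable_test_function test_function_pd \<phi>)+
    then have [measurable]: "\<phi> \<in> borel_measurable borel" by (simp add: sq_integrable_def)
    have *: "(LINT x|lborel. rep_l2 u x * pd (unit_dir k) (pd (unit_dir k) \<phi>) x) = (LINT x|lborel. rep_l2 (w' k) x * \<phi> x)" for k
      using w test_function_pd[OF \<phi>, of "unit_dir k"] \<phi> unfolding has_weak_deriv_def by auto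
    have "(LINT x|lborel. rep_l2 u x * (pd (unit_dir True) (pd (unit_dir True) \<phi>) x + pd (unit_dir False) (pd (unit_dir False) \<phi>) x))
        = (LINT x|lborel. rep_l2 (w' True) x * \<phi> x) + (LINT x|lborel. rep_l2 (w' False) x * \<phi> x)"
      unfolding distrib_left
      by (subst Bochner_Integration.integral_add) (simp_all only: * integrable_mult_sq_integrable sq_integrable_rep_l2 sq)
    also have "\<dots> = (LINT x|lborel. rep_l2 (w' True) x * \<phi> x + rep_l2 (w' False) x * \<phi> x)"
      by (intro Bochner_Integration.integral_add[symmetric] integrable_mult_sq_integrable sq_integrable_rep_l2 sq)
    also have "\<dots> = (LINT x|lborel. rep_l2 (w' True + w' False) x * \<phi> x)"
      by (rule integral_cong_AE) (use AE_rep_l2_add[of "w' True" "w' False"] in \<open>auto simp: distrib_right\<close>)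
    finally show "(LINT x|lborel. rep_l2 u x * (pd (1, 0) (pd (1, 0) \<phi>) x + pd (0, 1) (pd (0, 1) \<phi>) x))
        = (LINT x|lborel. rep_l2 (w' True + w' False) x * \<phi> x)"
      by (simp only: unit_dir_simps)
  qed
  moreover
  have "\<exists>v v'. has_mult (coord k) u v \<and> has_mult (coord k) v v'" for k
    using ex_has_mult_coord[OF u1, of k] has_mult_osc_dom[OF u, of k] ex_has_mult_coord by blast
  then obtain v v' where v: "\<And>k. has_mult (coord k) u (v k)" "\<And>k. has_mult (coord k) (v k) (v' k)"
    by metis
  have "has_mult (\<lambda>x. (fst x)\<^sup>2 + (snd x)\<^sup>2) u (v' True + v' False)"
    using v[of True] v[of False] AE_rep_l2_add[of "v' True" "v' False"] unfolding has_mult_def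
    by eventually_elim (simp add: coord_simps power2_eq_square algebra_simps)
  then have "u \<in> mult_dom (\<lambda>x. (fst x)\<^sup>2 + (snd x)\<^sup>2)"
    by (rule mult_op_eqI) (intro borel_measurable_continuous_onI continuous_intros)
  ultimately show "u \<in> H0_dom"
    by (auto simp: H0_dom_def laplacian_dom_def)
qed

text \<open>On \<open>osc_dom 2\<close> the iterated derivatives exist, so the definite descriptions
  in \<open>H0\<close> denote true weak derivatives and the coefficient formulas can be applied
  twice, with the same cancellation as for the Hermite functions.\<close>

lemma second_order_hcoeff:
  assumes u: "u \<in> osc_dom 2"
  shows "hcoeff (- weak_deriv (unit_dir k) (weak_deriv (unit_dir k) u) + mult_op (\<lambda>x. (coord k x)\<^sup>2) u) i
    = of_nat (2 * idx k i + 1) * hcoeff u i"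
proof -
  have u1: "u \<in> osc_dom 1"
    using u osc_dom_mono[of 1 2] by auto
  obtain w w' where w: "has_weak_deriv (unit_dir k) u w" "has_weak_deriv (unit_dir k) w w'"
    using ex_has_weak_deriv[OF u1, of k] has_weak_deriv_osc_dom[OF u, of k] ex_has_weak_deriv by blast
  obtain v v' where v: "has_mult (coord k) u v" "has_mult (coord k) v v'"
    using ex_has_mult_coord[OF u1, of k] has_mult_osc_dom[OF u, of k] ex_has_mult_coord by blast
  have "has_mult (\<lambda>x. (coord k x)\<^sup>2) u v'"
    using v unfolding has_mult_def by eventually_elim (simp add: power2_eq_square)
  then have m: "mult_op (\<lambda>x. (coord k x)\<^sup>2) u = v'"
    by (rule mult_op_eqI) measurable
  define s where "s n = complex_of_real (sqrt (real n))" for n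
  define r where "r = complex_of_real (sqrt 2)"
  have r: "r * r = 2" "r \<noteq> 0" by (simp_all add: r_def flip: of_real_mult)
  have s: "s n * s n = of_nat n" for n by (simp add: s_def flip: of_real_mult)
  have "hcoeff (- w' + v') i = ((s (idx k i + 1) * (s (idx k i + 1) * hcoeff u i) + s (idx k i) * (s (idx k i - 1 + 1) * hcoeff u (raise_idx k (lower_idx k i)))) * 2) / (r * r)"
    unfolding hcoeff_add hcoeff_minus has_weak_deriv_hcoeff[OF w(2)] has_weak_deriv_hcoeff[OF w(1)] has_mult_hcoeff[OF v(2)] has_mult_hcoeff[OF v(1)]
      s_def[symmetric] r_def[symmetric]
    using r(2) by (simp add: idx_raise_idx idx_lower_idx lower_idx_raise_idx field_simps)
  also have "\<dots> = s (idx k i + 1) * s (idx k i + 1) * hcoeff u i + s (idx k i) * s (idx k i - 1 + 1) * hcoeff u (raise_idx k (lower_idx k i))"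
    unfolding r(1) by (simp add: algebra_simps)
  also have "s (idx k i) * s (idx k i - 1 + 1) * hcoeff u (raise_idx k (lower_idx k i)) = of_nat (idx k i) * hcoeff u i"
    using s[of "idx k i"] raise_idx_lower_idx[of k i] s[of 0] by (cases "idx k i = 0") auto
  finally show ?thesis
    unfolding weak_deriv_eqI[OF w(1)] weak_deriv_eqI[OF w(2)] m s by (simp add: algebra_simps)
qed

text \<open>In \<open>a1\<close> and \<open>a2_star\<close> the multiplication and the derivative
  combine so that only one neighbour of each coefficient survives. The composition thus carries one
  index to one index on the same level.\<close>

lemma V_hcoeff:
  assumes u: "u \<in> osc_dom 2"
  shows "hcoeff (V u) i = complex_of_real (sqrt (real (idx False i) * real (idx True i + 1))) * hcoeff u (raise_idx True (lower_idx False i))"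
proof -
  have u1: "u \<in> osc_dom 1"
    using u osc_dom_mono[of 1 2] by auto
  define s where "s n = complex_of_real (sqrt (real n))" for n
  define r where "r = complex_of_real (sqrt 2)"
  have r: "r * r = 2" "r \<noteq> 0" by (simp_all add: r_def flip: of_real_mult)
  have r': "complex_of_real (1 / sqrt 2) = 1 / r" by (simp add: r_def)
  obtain w where w: "has_weak_deriv (unit_dir True) u w"
    using ex_has_weak_deriv[OF u1] by blast
  obtain v where v: "has_mult (coord True) u v"
    using ex_has_mult_coord[OF u1] by blast
  have X: "X1 u = v"
    using mult_op_eqI(2)[OF v] by (simp add: coord_simps borel_measurable_continuous_onI continuous_intros)
  have D: "D1 u = w"
    using weak_deriv_eqI[OF w] by (simp add: unit_dir_simps)
  have a: "hcoeff (a1 u) i = s (idx True i + 1) * hcoeff u (raise_idx True i)" for i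
  proof -
    have "hcoeff (a1 u) i = (2 * (s (idx True i + 1) * hcoeff u (raise_idx True i))) / (r * r)"
      unfolding a1_def X D hcoeff_scaleC hcoeff_add has_weak_deriv_hcoeff[OF w] has_mult_hcoeff[OF v] s_def[symmetric] r_def[symmetric] r'
      using r(2) by (simp add: field_simps)
    then show ?thesis unfolding r(1) by simp
  qed
  \<comment> \<open>The coefficient shift with second coefficient 0. It ensures that
    \<open>X2\<close> and \<open>D2\<close> act on \<open>a1 u\<close> as genuine operators, so that
    \<open>a2_star (a1 u)\<close> is meaningful.\<close>
  have a1: "a1 u \<in> osc_dom 1"
    by (rule osc_dom_shift[OF u, of _ 1 True 0]) (simp add: a s_def)
  obtain w' where w': "has_weak_deriv (unit_dir False) (a1 u) w'"
    using ex_has_weak_deriv[OF a1] by blast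
  obtain v' where v': "has_mult (coord False) (a1 u) v'"
    using ex_has_mult_coord[OF a1] by blast
  have X': "X2 (a1 u) = v'"
    using mult_op_eqI(2)[OF v'] by (simp add: coord_simps borel_measurable_continuous_onI continuous_intros)
  have D': "D2 (a1 u) = w'"
    using weak_deriv_eqI[OF w'] by (simp add: unit_dir_simps)
  have "hcoeff (V u) i = (2 * (s (idx False i) * hcoeff (a1 u) (lower_idx False i))) / (r * r)"
    unfolding V_def a2_star_def X' D' hcoeff_scaleC hcoeff_diff has_weak_deriv_hcoeff[OF w'] has_mult_hcoeff[OF v'] s_def[symmetric] r_def[symmetric] r'
    using r(2) by (simp add: field_simps)
  also have "\<dots> = s (idx False i) * s (idx True (lower_idx False i) + 1) * hcoeff u (raise_idx True (lower_idx False i))"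
    unfolding r(1) a by simp
  also have "idx True (lower_idx False i) = idx True i"
    by (simp add: idx_defs)
  finally show ?thesis
    by (simp add: s_def real_sqrt_mult)
qed

lemma H_hcoeff:
  assumes u: "u \<in> osc_dom 2"
  shows "hcoeff (H g u) i = of_nat (level i + 1) * hcoeff u i + \<i> * complex_of_real g * hcoeff (V u) i"
proof -
  have "hcoeff (H0 u) i = (1/2) * (of_nat (2 * idx True i + 1) * hcoeff u i) + (1/2) * (of_nat (2 * idx False i + 1) * hcoeff u i)"
    using second_order_hcoeff[OF u, of True i] second_order_hcoeff[OF u, of False i]
    unfolding H0_def hcoeff_add[of "_ *\<^sub>C _"] hcoeff_scaleC unit_dir_simps coord_simps by (simp only:)
  then show ?thesis
    unfolding H_def hcoeff_add hcoeff_scaleC by (simp add: idx_defs algebra_simps)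
qed

section \<open>Decomposition into the oscillator levels\<close>

definition level_idx :: "nat \<Rightarrow> (nat \<times> nat) set" where
  "level_idx m = {i. level i = m}"

text \<open>Describing the level by vanishing coefficients makes it a closed subspace at once and
  lets membership be checked by coefficient formulas; that it is the span of finitely many
  \<open>hvec i\<close> is derived later.\<close>

definition Level :: "nat \<Rightarrow> l2 set" where
  "Level m = {u. \<forall>i. level i \<noteq> m \<longrightarrow> hcoeff u i = 0}"

definition level_proj :: "nat \<Rightarrow> l2 \<Rightarrow> l2" where
  "level_proj m u = (\<Sum>i\<in>level_idx m. hcoeff u i *\<^sub>C hvec i)"

lemma level_idx_eq: "level_idx m = (\<lambda>j. (j, m - j)) ` {..<m + 1}"
proof (intro equalityI subsetI)
  fix i assume "i \<in> level_idx m"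
  then show "i \<in> (\<lambda>j. (j, m - j)) ` {..<m + 1}"
    by (intro image_eqI[of _ _ "fst i"]) (auto simp: level_idx_def level_def)
qed (auto simp: level_idx_def level_def)

lemma inj_on_level_idx: "inj_on (\<lambda>j. (j, m - j)) A"
  by (auto simp: inj_on_def)

lemma finite_level_idx [simp]: "finite (level_idx m)"
  by (simp add: level_idx_eq)

lemma card_level_idx: "card (level_idx m) = m + 1"
  by (simp only: level_idx_eq card_image[OF inj_on_level_idx] card_lessThan)

lemma hcoeff_level_proj: "hcoeff (level_proj m u) i = (if level i = m then hcoeff u i else 0)"
proof -
  have "hcoeff (level_proj m u) i = (\<Sum>j\<in>level_idx m. if i = j then hcoeff u i else 0)"
    unfolding level_proj_def hcoeff_sum by (intro sum.cong) (auto simp: hcoeff_scaleC hcoeff_hvec)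
  then show ?thesis
    by (simp only: sum.delta'[OF finite_level_idx]) (simp add: level_idx_def)
qed

lemma level_proj_in_Level: "level_proj m u \<in> Level m"
  by (simp add: Level_def hcoeff_level_proj)

lemma level_proj_Level: "v \<in> Level n \<Longrightarrow> level_proj m v = (if m = n then v else 0)"
  by (auto intro!: hcoeff_eqI simp: hcoeff_level_proj hcoeff_zero Level_def)

lemma level_proj_add: "level_proj m (u + v) = level_proj m u + level_proj m v"
  and level_proj_diff: "level_proj m (u - v) = level_proj m u - level_proj m v"
  and level_proj_scaleC: "level_proj m (c *\<^sub>C u) = c *\<^sub>C level_proj m u"
  and level_proj_zero: "level_proj m 0 = 0"
  by (auto intro!: hcoeff_eqI simp: hcoeff_level_proj hcoeff_add hcoeff_diff hcoeff_scaleC hcoeff_zero)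

lemma level_proj_eqI: "(\<And>m. level_proj m u = level_proj m v) \<Longrightarrow> u = v"
proof (rule hcoeff_eqI)
  fix i assume "\<And>m. level_proj m u = level_proj m v"
  then have "hcoeff (level_proj (level i) u) i = hcoeff (level_proj (level i) v) i" by simp
  then show "hcoeff u i = hcoeff v i" by (simp add: hcoeff_level_proj)
qed

lemma norm_level_proj: "(norm (level_proj m u))\<^sup>2 = (\<Sum>i\<in>level_idx m. (cmod (hcoeff u i))\<^sup>2)"
  unfolding level_proj_def by (subst norm_sum_orthogonal) (auto simp: cinner_scaled_hvec norm_scaleC norm_hvec)

lemma norm_Level: "v \<in> Level m \<Longrightarrow> (norm v)\<^sup>2 = (\<Sum>i\<in>level_idx m. (cmod (hcoeff v i))\<^sup>2)"
  using norm_level_proj[of m v] by (simp add: level_proj_Level)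

lemma norm_level_proj_le: "norm (level_proj m u) \<le> norm u"
  by (rule power2_le_imp_le) (simp_all add: norm_level_proj Bessel)

lemma bounded_linear_level_proj: "bounded_linear (level_proj m)"
  by (rule bounded_linear_intro[where K = 1]) (auto simp: level_proj_add scaleR_eq_scaleC level_proj_scaleC norm_level_proj_le)

lemma subspace_Level: "L2.subspace (Level m)"
  by (rule L2.subspaceI) (auto simp: Level_def hcoeff_add hcoeff_scaleC hcoeff_zero)

lemma closed_Level: "closed (Level m)"
proof -
  have "closed {u. hcoeff u i = 0}" for i
    unfolding hcoeff_def
    by (intro closed_Collect_eq linear_continuous_on bounded_linear_cinner_right continuous_on_const)
  moreover have "Level m = (\<Inter>i\<in>{i. level i \<noteq> m}. {u. hcoeff u i = 0})"
    by (auto simp: Level_def)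
  ultimately show ?thesis by auto
qed

lemma cinner_Level: "m \<noteq> n \<Longrightarrow> u \<in> Level m \<Longrightarrow> v \<in> Level n \<Longrightarrow> cinner u v = 0"
proof -
  assume *: "m \<noteq> n" "u \<in> Level m" "v \<in> Level n"
  have "cinner (level_proj m u) v = (\<Sum>i\<in>level_idx m. cnj (hcoeff u i) * hcoeff v i)"
    by (simp add: level_proj_def cinner_sum_left cinner_scaleC_left hcoeff_def)
  also have "\<dots> = 0"
    using * by (intro sum.neutral) (auto simp: level_idx_def Level_def)
  finally show ?thesis using * by (simp add: level_proj_Level)
qed

text \<open>Links the unordered summability over index pairs, in which the domain is defined, with
  ordinary series over the levels, in which the block estimates are made. Nonnegativity reduces both
  to boundedness of finite sums, and a finite set of pairs meets finitely many levels.\<close>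

lemma block_summable:
  fixes F :: "nat \<times> nat \<Rightarrow> real"
  assumes F: "\<And>i. 0 \<le> F i"
  shows "F summable_on UNIV \<longleftrightarrow> summable (\<lambda>m. \<Sum>i\<in>level_idx m. F i)"
proof
  have union: "(\<Sum>m<n. \<Sum>i\<in>level_idx m. F i) = (\<Sum>i\<in>(\<Union>m<n. level_idx m). F i)" for n
    by (rule sum.UNION_disjoint[symmetric]) (simp_all, auto simp: level_idx_def)
  assume "F summable_on UNIV"
  then show "summable (\<lambda>m. \<Sum>i\<in>level_idx m. F i)"
    by (intro summableI_nonneg_bounded[where x = "infsum F UNIV"])
       (auto simp: union F intro!: sum_nonneg finite_sum_le_infsum)
next
  have union: "(\<Sum>m<n. \<Sum>i\<in>level_idx m. F i) = (\<Sum>i\<in>(\<Union>m<n. level_idx m). F i)" for n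
    by (rule sum.UNION_disjoint[symmetric]) (simp_all, auto simp: level_idx_def)
  assume s: "summable (\<lambda>m. \<Sum>i\<in>level_idx m. F i)"
  show "F summable_on UNIV"
  proof (rule nonneg_bdd_above_summable_on[OF F bdd_aboveI2])
    fix X :: "(nat \<times> nat) set" assume "X \<in> {X. X \<subseteq> UNIV \<and> finite X}"
    then have X: "finite X" by simp
    define n where "n = Suc (Max (level ` X))"
    have "X \<subseteq> (\<Union>m<n. level_idx m)"
      using X by (auto simp: n_def level_idx_def less_Suc_eq_le)
    then have "sum F X \<le> (\<Sum>i\<in>(\<Union>m<n. level_idx m). F i)"
      using F by (intro sum_mono2) auto
    also have "\<dots> \<le> (\<Sum>m. \<Sum>i\<in>level_idx m. F i)"
      unfolding union[symmetric] by (intro sum_le_suminf s) (auto intro: sum_nonneg F)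
    finally show "sum F X \<le> (\<Sum>m. \<Sum>i\<in>level_idx m. F i)" .
  qed
qed

lemma osc_dom_iff: "u \<in> osc_dom n \<longleftrightarrow> summable (\<lambda>m. real (m + 1) ^ n * (norm (level_proj m u))\<^sup>2)"
proof -
  have "u \<in> osc_dom n \<longleftrightarrow> summable (\<lambda>m. \<Sum>i\<in>level_idx m. real (level i + 1) ^ n * (cmod (hcoeff u i))\<^sup>2)"
    unfolding osc_dom_def mem_Collect_eq by (rule block_summable) auto
  also have "(\<lambda>m. \<Sum>i\<in>level_idx m. real (level i + 1) ^ n * (cmod (hcoeff u i))\<^sup>2) = (\<lambda>m. real (m + 1) ^ n * (norm (level_proj m u))\<^sup>2)"
    unfolding norm_level_proj sum_distrib_left by (intro ext sum.cong) (auto simp: level_idx_def)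
  finally show ?thesis .
qed

lemma Level_osc_dom: "Level m \<subseteq> osc_dom n"
proof
  fix v assume v: "v \<in> Level m"
  have "summable (\<lambda>k. real (k + 1) ^ n * (norm (level_proj k v))\<^sup>2)"
    by (rule summable_finite[of "{m}"]) (auto simp: level_proj_Level[OF v])
  then show "v \<in> osc_dom n" by (simp add: osc_dom_iff)
qed

lemma Level_summable:
  assumes w: "\<And>m. w m \<in> Level m" and s: "summable (\<lambda>m. (norm (w m))\<^sup>2)"
  shows "\<exists>u. w sums u"
proof -
  have "w summable_on UNIV"
  proof (rule summable_on_orthogonal)
    show "cinner (w i) (w j) = 0" if "i \<noteq> j" for i j
      by (rule cinner_Level[OF that w w])
    show "(\<lambda>m. (norm (w m))\<^sup>2) summable_on UNIV"
      by (rule norm_summable_imp_summable_on) (use s in simp)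
  qed
  then show ?thesis
    unfolding summable_on_def by (auto dest: has_sum_imp_sums)
qed

lemma level_proj_sums_Level:
  assumes w: "\<And>m. w m \<in> Level m" and u: "w sums u"
  shows "level_proj m u = w m"
proof -
  have "(\<lambda>k. level_proj m (w k)) sums level_proj m u"
    using bounded_linear.sums[OF bounded_linear_level_proj u] .
  moreover have "(\<lambda>k. level_proj m (w k)) = (\<lambda>k. if k = m then w k else 0)"
    by (auto simp: fun_eq_iff level_proj_Level[OF w])
  ultimately have "(\<lambda>k. if k = m then w k else 0) sums level_proj m u"
    by (simp only:)
  then show ?thesis
    by (rule sums_unique2[OF _ sums_single])
qed

lemma norm_sums_Level:
  assumes w: "\<And>m. w m \<in> Level m" and u: "w sums u"
  shows "(\<lambda>m. (norm (w m))\<^sup>2) sums (norm u)\<^sup>2"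
proof -
  have "(\<lambda>n. (norm (\<Sum>m<n. w m))\<^sup>2) \<longlonglongrightarrow> (norm u)\<^sup>2"
    using u unfolding sums_def by (intro tendsto_intros)
  moreover have "(norm (\<Sum>m<n. w m))\<^sup>2 = (\<Sum>m<n. (norm (w m))\<^sup>2)" for n
    by (rule norm_sum_orthogonal) (simp_all add: cinner_Level[OF _ w w])
  ultimately show ?thesis by (simp add: sums_def)
qed

lemma level_proj_sums: "(\<lambda>m. level_proj m u) sums u"
proof -
  have "u \<in> osc_dom 0"
    using hcoeff_square_summable by (simp add: osc_dom_def)
  then obtain v where v: "(\<lambda>m. level_proj m u) sums v"
    using Level_summable[of "\<lambda>m. level_proj m u", OF level_proj_in_Level] by (auto simp: osc_dom_iff)
  then have "v = u"
    using level_proj_sums_Level[of "\<lambda>m. level_proj m u", OF level_proj_in_Level v] by (auto intro: level_proj_eqI)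
  with v show ?thesis by simp
qed

lemma norm_level_proj_sums: "(\<lambda>m. (norm (level_proj m u))\<^sup>2) sums (norm u)\<^sup>2"
  by (rule norm_sums_Level[OF level_proj_in_Level level_proj_sums])

lemma hvec_Level: "hvec i \<in> Level (level i)"
  by (auto simp: Level_def hcoeff_hvec)

lemma inj_hvec: "inj hvec"
  by (rule injI) (metis hcoeff_hvec zero_neq_one)

lemma independent_hvec: "L2.independent (hvec ` A)"
  unfolding L2.independent_explicit_finite_subsets
proof (intro allI impI ballI)
  fix S f v assume S: "S \<subseteq> hvec ` A" "finite S" "(\<Sum>v\<in>S. f v *\<^sub>C v) = 0" "v \<in> S"
  have "cinner v (\<Sum>w\<in>S. f w *\<^sub>C w) = (\<Sum>w\<in>S. if w = v then f v else 0)"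
    unfolding cinner_sum_right
  proof (intro sum.cong refl)
    fix w assume "w \<in> S"
    then obtain i j where "w = hvec i" "v = hvec j" using S by blast
    then show "cinner v (f w *\<^sub>C w) = (if w = v then f v else 0)"
      by (auto simp: cinner_scaleC_right cinner_hvec inj_eq[OF inj_hvec])
  qed
  with S show "f v = 0" by simp
qed

lemma span_hvec_level_idx: "L2.span (hvec ` level_idx m) = Level m"
proof
  show "L2.span (hvec ` level_idx m) \<subseteq> Level m"
    by (rule L2.span_minimal[OF _ subspace_Level]) (use hvec_Level in \<open>auto simp: level_idx_def\<close>)
  show "Level m \<subseteq> L2.span (hvec ` level_idx m)"
  proof
    fix v assume v: "v \<in> Level m"
    have "level_proj m v \<in> L2.span (hvec ` level_idx m)"
      unfolding level_proj_def by (intro L2.span_sum L2.span_scale L2.span_base) auto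
    then show "v \<in> L2.span (hvec ` level_idx m)" by (simp add: level_proj_Level[OF v])
  qed
qed

lemma dim_Level: "L2.dim (Level m) = m + 1"
proof -
  have "L2.dim (Level m) = card (hvec ` level_idx m)"
    unfolding span_hvec_level_idx[symmetric] by (intro L2.dim_eq_card[OF _ independent_hvec]) (simp add: L2.span_span)
  also have "\<dots> = m + 1"
    by (simp only: card_image[OF inj_on_subset[OF inj_hvec subset_UNIV]] card_level_idx)
  finally show ?thesis .
qed

section \<open>The perturbation on a level\<close>

lemma V_hcoeff_pair: "u \<in> osc_dom 2 \<Longrightarrow> hcoeff (V u) (p, q) = complex_of_real (sqrt (real q * real (p + 1))) * hcoeff u (p + 1, q - 1)"
  using V_hcoeff[of u "(p, q)"] by (simp add: idx_defs)

lemma V_Level_hcoeff: "v \<in> Level m \<Longrightarrow> hcoeff (V v) (p, q) = complex_of_real (sqrt (real q * real (p + 1))) * hcoeff v (p + 1, q - 1)"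
  using Level_osc_dom V_hcoeff_pair by blast

lemma V_Level: "v \<in> Level m \<Longrightarrow> V v \<in> Level m"
proof -
  assume v: "v \<in> Level m"
  have "hcoeff (V v) (p, q) = 0" if "p + q \<noteq> m" for p q
    using v that by (cases q) (auto simp: V_Level_hcoeff[OF v] Level_def level_def)
  then show ?thesis by (auto simp: Level_def level_def)
qed

lemma Level_add: "u \<in> Level m \<Longrightarrow> v \<in> Level m \<Longrightarrow> u + v \<in> Level m"
  and Level_scaleC: "u \<in> Level m \<Longrightarrow> c *\<^sub>C u \<in> Level m"
  and Level_zero: "0 \<in> Level m"
  by (auto simp: Level_def hcoeff_add hcoeff_scaleC hcoeff_zero)

lemma Level_sum: "(\<And>k. k \<in> A \<Longrightarrow> f k \<in> Level m) \<Longrightarrow> (\<Sum>k\<in>A. f k) \<in> Level m"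
  by (auto simp: Level_def hcoeff_sum)

text \<open>\<open>V\<close> only moves coefficients within the level and multiplies each by
  \<open>sqrt (q * (p + 1))\<close>. The arithmetic-geometric mean inequality, with
  \<open>q + (p + 1) = m + 1\<close>, bounds this weight by half of \<open>m + 1\<close>; the
  threshold \<open>|g| < 2\<close> has its origin here.\<close>

lemma norm_V_Level_le:
  assumes v: "v \<in> Level m"
  shows "norm (V v) \<le> real (m + 1) / 2 * norm v"
proof (rule power2_le_imp_le)
  let ?h = "\<lambda>i::nat \<times> nat. (fst i + 1, snd i - 1)"
  have "(norm (V v))\<^sup>2 = (\<Sum>i\<in>level_idx m. (cmod (hcoeff (V v) i))\<^sup>2)"
    by (rule norm_Level[OF V_Level[OF v]])
  also have "\<dots> = (\<Sum>i\<in>level_idx m. (real (snd i) * real (fst i + 1)) * (cmod (hcoeff v (?h i)))\<^sup>2)"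
  proof (intro sum.cong refl)
    fix i :: "nat \<times> nat"
    show "(cmod (hcoeff (V v) i))\<^sup>2 = (real (snd i) * real (fst i + 1)) * (cmod (hcoeff v (?h i)))\<^sup>2"
      using V_Level_hcoeff[OF v, of "fst i" "snd i"] by (simp add: norm_mult power_mult_distrib)
  qed
  \<comment> \<open>Indices with second entry 0 have weight 0 and are dropped before reindexing:
    truncated subtraction would make \<open>?h\<close> move them out of the level.\<close>
  also have "\<dots> = (\<Sum>i\<in>{i \<in> level_idx m. snd i > 0}. (real (snd i) * real (fst i + 1)) * (cmod (hcoeff v (?h i)))\<^sup>2)"
    by (intro sum.mono_neutral_right) auto
  also have "\<dots> \<le> (\<Sum>i\<in>{i \<in> level_idx m. snd i > 0}. (real (m + 1) / 2)\<^sup>2 * (cmod (hcoeff v (?h i)))\<^sup>2)"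
  proof (intro sum_mono mult_right_mono)
    fix i assume "i \<in> {i \<in> level_idx m. snd i > 0}"
    then have m: "real (m + 1) = real (snd i) + real (fst i + 1)"
      by (simp add: level_idx_def level_def)
    show "real (snd i) * real (fst i + 1) \<le> (real (m + 1) / 2)\<^sup>2"
      unfolding m using sum_squares_bound[of "real (snd i)" "real (fst i + 1)"]
      by (simp add: power2_eq_square field_simps)
  qed auto
  also have "\<dots> = (real (m + 1) / 2)\<^sup>2 * (\<Sum>i\<in>?h ` {i \<in> level_idx m. snd i > 0}. (cmod (hcoeff v i))\<^sup>2)"
    unfolding sum_distrib_left[symmetric]
    by (subst sum.reindex) (auto simp: inj_on_def prod_eq_iff)
  also have "\<dots> \<le> (real (m + 1) / 2)\<^sup>2 * (\<Sum>i\<in>level_idx m. (cmod (hcoeff v i))\<^sup>2)"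
    by (intro mult_left_mono sum_mono2[OF finite_level_idx]) (auto simp: level_idx_def level_def)
  also have "\<dots> = (real (m + 1) / 2 * norm v)\<^sup>2"
    by (simp only: norm_Level[OF v] power_mult_distrib)
  finally show "(norm (V v))\<^sup>2 \<le> (real (m + 1) / 2 * norm v)\<^sup>2" .
qed auto

definition igV :: "real \<Rightarrow> l2 \<Rightarrow> l2" where
  "igV g v = (\<i> * complex_of_real g) *\<^sub>C V v"

lemma igV_Level: "v \<in> Level m \<Longrightarrow> igV g v \<in> Level m"
  by (simp add: igV_def Level_scaleC V_Level)

lemma igV_add: "u \<in> Level m \<Longrightarrow> v \<in> Level m \<Longrightarrow> igV g (u + v) = igV g u + igV g v"
  by (rule hcoeff_eqI) (auto simp: igV_def hcoeff_scaleC hcoeff_add V_Level_hcoeff[OF Level_add] V_Level_hcoeff algebra_simps)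

lemma igV_scaleC: "u \<in> Level m \<Longrightarrow> igV g (c *\<^sub>C u) = c *\<^sub>C igV g u"
  by (rule hcoeff_eqI) (auto simp: igV_def hcoeff_scaleC V_Level_hcoeff[OF Level_scaleC] V_Level_hcoeff)

lemma igV_power_Level: "v \<in> Level m \<Longrightarrow> (igV g ^^ k) v \<in> Level m"
  by (induction k) (auto intro: igV_Level)

lemma igV_power_add: "u \<in> Level m \<Longrightarrow> v \<in> Level m \<Longrightarrow> (igV g ^^ k) (u + v) = (igV g ^^ k) u + (igV g ^^ k) v"
  by (induction k) (auto simp: igV_add[OF igV_power_Level igV_power_Level])

lemma igV_power_scaleC: "u \<in> Level m \<Longrightarrow> (igV g ^^ k) (c *\<^sub>C u) = c *\<^sub>C (igV g ^^ k) u"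
  by (induction k) (auto simp: igV_scaleC[OF igV_power_Level])

lemma igV_sum: "(\<And>k. k \<in> A \<Longrightarrow> f k \<in> Level m) \<Longrightarrow> igV g (\<Sum>k\<in>A. f k) = (\<Sum>k\<in>A. igV g (f k))"
proof (induction A rule: infinite_finite_induct)
  case (insert x F)
  have "igV g (f x + sum f F) = igV g (f x) + igV g (sum f F)"
    by (rule igV_add[of _ m]) (auto intro: Level_sum insert.prems)
  with insert show ?case by simp
qed (use igV_scaleC[OF Level_zero, of g 0] in auto)

text \<open>Each application of \<open>V\<close> raises the second index, so after \<open>m + 1\<close> steps nothing is left on level \<open>m\<close>.\<close>

lemma igV_power_nilpotent:
  assumes v: "v \<in> Level m"
  shows "(igV g ^^ (m + 1)) v = 0"
proof -
  have low: "hcoeff ((igV g ^^ k) v) (p, q) = 0" if "q < k" for k p q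
    using that
  proof (induction k arbitrary: p q)
    case (Suc k)
    have "hcoeff ((igV g ^^ Suc k) v) (p, q) = (\<i> * complex_of_real g) *
        (complex_of_real (sqrt (real q * real (p + 1))) * hcoeff ((igV g ^^ k) v) (p + 1, q - 1))"
    proof -
      have "(igV g ^^ Suc k) v = (\<i> * complex_of_real g) *\<^sub>C V ((igV g ^^ k) v)"
        by (simp add: igV_def)
      then show ?thesis
        by (simp only: hcoeff_scaleC V_Level_hcoeff[OF igV_power_Level[OF v]])
    qed
    also have "\<dots> = 0"
      using Suc by (cases q) auto
    finally show ?case .
  qed simp
  show ?thesis
  proof (rule hcoeff_eqI, clarify)
    fix p q
    show "hcoeff ((igV g ^^ (m + 1)) v) (p, q) = hcoeff 0 (p, q)"
    proof (cases "p + q = m")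
      case True
      then show ?thesis using low[of q "m + 1" p] by (simp add: hcoeff_zero)
    next
      case False
      then show ?thesis
        using igV_power_Level[OF v, where k = "m + 1"] by (simp add: Level_def level_def hcoeff_zero del: funpow.simps)
    qed
  qed
qed

lemma norm_igV_le:
  assumes v: "v \<in> Level m"
  shows "norm (igV g v) \<le> \<bar>g\<bar> / 2 * real (m + 1) * norm v"
proof -
  have "norm (igV g v) = \<bar>g\<bar> * norm (V v)"
    by (simp add: igV_def norm_scaleC norm_mult)
  also have "\<dots> \<le> \<bar>g\<bar> * (real (m + 1) / 2 * norm v)"
    by (intro mult_left_mono norm_V_Level_le v) auto
  finally show ?thesis by simp
qed

lemma norm_igV_power_le:
  assumes v: "v \<in> Level m"
  shows "norm ((igV g ^^ k) v) \<le> (\<bar>g\<bar> / 2 * real (m + 1)) ^ k * norm v"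
proof (induction k)
  case (Suc k)
  have "norm ((igV g ^^ Suc k) v) \<le> (\<bar>g\<bar> / 2 * real (m + 1)) * norm ((igV g ^^ k) v)"
    using norm_igV_le[OF igV_power_Level[OF v]] by simp
  also have "\<dots> \<le> (\<bar>g\<bar> / 2 * real (m + 1)) * ((\<bar>g\<bar> / 2 * real (m + 1)) ^ k * norm v)"
    by (intro mult_left_mono Suc) auto
  finally show ?case by (simp add: mult_ac)
qed simp

text \<open>\<open>H g\<close> commutes with the level projections on its whole domain, so the
  resolvent equation decouples into finite-dimensional ones.\<close>

lemma level_proj_H:
  assumes u: "u \<in> osc_dom 2"
  shows "level_proj m (H g u) = of_nat (m + 1) *\<^sub>C level_proj m u + igV g (level_proj m u)"
proof (rule hcoeff_eqI, clarify)
  fix p q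
  show "hcoeff (level_proj m (H g u)) (p, q) = hcoeff (of_nat (m + 1) *\<^sub>C level_proj m u + igV g (level_proj m u)) (p, q)"
    by (cases q) (auto simp: hcoeff_level_proj hcoeff_add hcoeff_scaleC igV_def H_hcoeff[OF u] V_hcoeff_pair[OF u] V_Level_hcoeff[OF level_proj_in_Level] level_def)
qed

lemma H_Level: "v \<in> Level m \<Longrightarrow> H g v = of_nat (m + 1) *\<^sub>C v + igV g v"
proof -
  assume v: "v \<in> Level m"
  have u: "v \<in> osc_dom 2" using v Level_osc_dom by blast
  show ?thesis
  proof (rule level_proj_eqI)
    fix n
    have "igV g 0 = 0" using igV_scaleC[OF Level_zero, of g 0] by simp
    then show "level_proj n (H g v) = level_proj n (of_nat (m + 1) *\<^sub>C v + igV g v)"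
      by (simp add: level_proj_H[OF u] level_proj_add level_proj_scaleC level_proj_Level[OF v] level_proj_Level[OF igV_Level[OF v]])
  qed
qed

section \<open>The resolvent of one block\<close>

text \<open>The geometric series for the inverse of \<open>z - (m + 1) - igV g\<close>. Nilpotency
  stops it after \<open>m + 1\<close> terms, so it is an exact inverse for every \<open>z\<close>
  other than \<open>m + 1\<close>, however large \<open>igV g\<close> is compared with
  \<open>z - (m + 1)\<close>.\<close>

definition level_res :: "real \<Rightarrow> nat \<Rightarrow> complex \<Rightarrow> l2 \<Rightarrow> l2" where
  "level_res g m z v = (\<Sum>k<m + 1. (1 / (z - of_nat (m + 1)) ^ (k + 1)) *\<^sub>C (igV g ^^ k) v)"

lemma level_res_Level: "v \<in> Level m \<Longrightarrow> level_res g m z v \<in> Level m"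
  unfolding level_res_def by (intro Level_sum Level_scaleC igV_power_Level)

lemma level_res_add: "u \<in> Level m \<Longrightarrow> v \<in> Level m \<Longrightarrow> level_res g m z (u + v) = level_res g m z u + level_res g m z v"
  unfolding level_res_def by (simp add: igV_power_add L2.scale_right_distrib sum.distrib del: sum.lessThan_Suc)

lemma level_res_scaleC: "u \<in> Level m \<Longrightarrow> level_res g m z (c *\<^sub>C u) = c *\<^sub>C level_res g m z u"
  unfolding level_res_def by (simp add: igV_power_scaleC L2.scale_sum_right mult.commute del: sum.lessThan_Suc)

text \<open>Applying the two parts of the operator to the series produces the same terms shifted by
  one, so the difference telescopes; the last term vanishes by nilpotency.\<close>

lemma level_res_right_inverse:
  assumes v: "v \<in> Level m" and z: "z \<noteq> of_nat (m + 1)"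
  shows "(z - of_nat (m + 1)) *\<^sub>C level_res g m z v - igV g (level_res g m z v) = v"
proof -
  define d where "d = z - of_nat (m + 1)"
  have d: "d \<noteq> 0" using z by (simp add: d_def)
  define t where "t k = (1 / d ^ k) *\<^sub>C (igV g ^^ k) v" for k
  have "d *\<^sub>C level_res g m z v = (\<Sum>k<m + 1. t k)"
    unfolding level_res_def d_def[symmetric] L2.scale_sum_right t_def using d by (intro sum.cong) auto
  moreover have "igV g (level_res g m z v) = (\<Sum>k<m + 1. t (Suc k))"
    unfolding level_res_def d_def[symmetric] t_def
    by (subst igV_sum[OF Level_scaleC[OF igV_power_Level[OF v]]]) (simp add: igV_scaleC[OF igV_power_Level[OF v]] del: sum.lessThan_Suc)
  ultimately have "d *\<^sub>C level_res g m z v - igV g (level_res g m z v) = (\<Sum>k<m + 1. t k - t (Suc k))"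
    by (simp only: sum_subtractf)
  also have "\<dots> = t 0 - t (m + 1)"
    by (rule sum_lessThan_telescope')
  also have "\<dots> = v"
    using igV_power_nilpotent[OF v, of g] by (simp add: t_def del: funpow.simps)
  finally show ?thesis by (simp only: d_def)
qed

lemma level_res_commutes_igV: "v \<in> Level m \<Longrightarrow> level_res g m z (igV g v) = igV g (level_res g m z v)"
  unfolding level_res_def by (subst igV_sum[OF Level_scaleC[OF igV_power_Level]])
    (simp_all add: igV_scaleC[OF igV_power_Level] funpow_swap1 del: sum.lessThan_Suc)

lemma level_res_left_inverse:
  assumes v: "v \<in> Level m" and z: "z \<noteq> of_nat (m + 1)"
  shows "level_res g m z ((z - of_nat (m + 1)) *\<^sub>C v - igV g v) = v"
proof -
  have "(z - of_nat (m + 1)) *\<^sub>C v - igV g v = (z - of_nat (m + 1)) *\<^sub>C v + (- 1) *\<^sub>C igV g v"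
    by (simp add: uminus_l2_eq_scaleC[symmetric])
  then have "level_res g m z ((z - of_nat (m + 1)) *\<^sub>C v - igV g v) = (z - of_nat (m + 1)) *\<^sub>C level_res g m z v + (- 1) *\<^sub>C level_res g m z (igV g v)"
    by (simp only: level_res_add[OF Level_scaleC[OF v] Level_scaleC[OF igV_Level[OF v]]] level_res_scaleC[OF v] level_res_scaleC[OF igV_Level[OF v]])
  then show ?thesis
    using level_res_right_inverse[OF v z, of g] by (simp add: level_res_commutes_igV[OF v] uminus_l2_eq_scaleC[symmetric])
qed

text \<open>
  On high levels the bound \<open>\<bar>g\<bar> / 2 < 1\<close> lets the diagonal part dominate the nilpotent part; the
  finitely many low levels are estimated by the explicit formula.
\<close>

lemma level_res_bound:
  assumes g: "\<bar>g\<bar> < 2" and z: "\<And>m. z \<noteq> of_nat (m + 1)"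
  obtains C where "C \<ge> 0" "\<And>m v. v \<in> Level m \<Longrightarrow> real (m + 1) * norm (level_res g m z v) \<le> C * norm v"
proof -
  define \<delta> where "\<delta> = \<bar>g\<bar> / 2"
  have \<delta>: "0 \<le> \<delta>" "\<delta> < 1" using g by (auto simp: \<delta>_def)
  \<comment> \<open>Chosen so that for \<open>m \<ge> M\<close> the number \<open>cmod z\<close>
    uses up at most half of the gap \<open>(1 - \<delta>) * (m + 1)\<close> left by the
    perturbation; hence the constant \<open>2 / (1 - \<delta>)\<close>.\<close>
  obtain M :: nat where M: "2 * cmod z / (1 - \<delta>) \<le> real M"
    using real_arch_simple by blast
  define K where "K m = (\<Sum>k<m + 1. cmod (1 / (z - of_nat (m + 1)) ^ (k + 1)) * (\<delta> * real (m + 1)) ^ k)" for m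
  have K: "0 \<le> K m" for m
    unfolding K_def using \<delta> by (intro sum_nonneg) auto
  have small: "norm (level_res g m z v) \<le> K m * norm v" if v: "v \<in> Level m" for m v
  proof -
    have "norm (level_res g m z v) \<le> (\<Sum>k<m + 1. cmod (1 / (z - of_nat (m + 1)) ^ (k + 1)) * ((\<delta> * real (m + 1)) ^ k * norm v))"
      unfolding level_res_def
      by (rule order_trans[OF norm_sum], unfold norm_scaleC, intro sum_mono mult_left_mono)
         (use norm_igV_power_le[OF v] in \<open>auto simp: \<delta>_def\<close>)
    also have "\<dots> = K m * norm v"
      by (simp only: K_def sum_distrib_right mult.assoc)
    finally show ?thesis .
  qed
  have large: "real (m + 1) * norm (level_res g m z v) \<le> 2 / (1 - \<delta>) * norm v" if v: "v \<in> Level m" and m: "M \<le> m" for m v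
  proof -
    let ?w = "level_res g m z v" and ?n = "real (m + 1)"
    have "(z - of_nat (m + 1)) *\<^sub>C ?w = v + igV g ?w"
      using level_res_right_inverse[OF v z, of g] by (simp add: diff_eq_eq)
    then have "cmod (z - of_nat (m + 1)) * norm ?w \<le> norm v + norm (igV g ?w)"
      by (metis norm_scaleC norm_triangle_ineq)
    moreover have "norm (igV g ?w) \<le> \<delta> * ?n * norm ?w"
      using norm_igV_le[OF level_res_Level[OF v]] by (simp add: \<delta>_def)
    moreover have "(?n - cmod z) * norm ?w \<le> cmod (z - of_nat (m + 1)) * norm ?w"
    proof (rule mult_right_mono)
      have "cmod (of_nat (m + 1)) \<le> cmod z + cmod (of_nat (m + 1) - z)"
        using norm_triangle_ineq[of z "of_nat (m + 1) - z"] by simp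
      then show "?n - cmod z \<le> cmod (z - of_nat (m + 1))"
        by (simp only: norm_of_nat norm_minus_commute)
    qed simp
    ultimately have 1: "((1 - \<delta>) * ?n - cmod z) * norm ?w \<le> norm v"
      by (simp add: algebra_simps)
    have "2 * cmod z / (1 - \<delta>) \<le> ?n"
      using M m by linarith
    then have "cmod z \<le> (1 - \<delta>) * ?n / 2"
      using \<delta> by (simp add: pos_divide_le_eq mult.commute)
    then have "(1 - \<delta>) * ?n / 2 * norm ?w \<le> ((1 - \<delta>) * ?n - cmod z) * norm ?w"
      by (intro mult_right_mono) auto
    with 1 have "(1 - \<delta>) * ?n / 2 * norm ?w \<le> norm v" by linarith
    then have "2 / (1 - \<delta>) * ((1 - \<delta>) * ?n / 2 * norm ?w) \<le> 2 / (1 - \<delta>) * norm v"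
      using \<delta> by (intro mult_left_mono) auto
    then show ?thesis
      using \<delta> by simp
  qed
  define C where "C = 2 / (1 - \<delta>) + (\<Sum>m<M. real (m + 1) * K m)"
  have s: "0 \<le> (\<Sum>m<M. real (m + 1) * K m)"
    using K by (intro sum_nonneg mult_nonneg_nonneg) auto
  have C: "C \<ge> 0" using \<delta> s by (simp add: C_def)
  moreover have "real (m + 1) * norm (level_res g m z v) \<le> C * norm v" if v: "v \<in> Level m" for m v
  proof (cases "M \<le> m")
    case True
    have "2 / (1 - \<delta>) * norm v \<le> C * norm v"
      using s by (intro mult_right_mono) (auto simp: C_def)
    with large[OF v True] show ?thesis by linarith
  next
    case False
    have "real (m + 1) * norm (level_res g m z v) \<le> real (m + 1) * (K m * norm v)"
      by (intro mult_left_mono small v) auto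
    also have "\<dots> = (real (m + 1) * K m) * norm v" by simp
    also have "\<dots> \<le> C * norm v"
    proof (rule mult_right_mono)
      have "real (m + 1) * K m \<le> (\<Sum>m<M. real (m + 1) * K m)"
        using False K by (intro member_le_sum) auto
      then show "real (m + 1) * K m \<le> C"
        using \<delta> by (simp add: C_def add_increasing)
    qed simp
    finally show ?thesis .
  qed
  ultimately show ?thesis by (rule that)
qed

section \<open>Resolvent and spectrum\<close>

lemma level_proj_shift:
  assumes "u \<in> osc_dom 2"
  shows "level_proj m (z *\<^sub>C u - H g u) = (z - of_nat (m + 1)) *\<^sub>C level_proj m u - igV g (level_proj m u)"
  unfolding level_proj_diff level_proj_scaleC level_proj_H[OF assms] L2.scale_left_diff_distrib by (simp only: diff_diff_eq)

lemma level_proj_solution: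
  assumes "u \<in> osc_dom 2" "z *\<^sub>C u - H g u = f" "z \<noteq> of_nat (m + 1)"
  shows "level_proj m u = level_res g m z (level_proj m f)"
  using level_res_left_inverse[OF level_proj_in_Level assms(3), of g u] level_proj_shift[OF assms(1), of m z g] assms(2) by simp

text \<open>The equation is solved level by level. The factor \<open>m + 1\<close> gained in the
  resolvent bound is exactly the weight that puts the sum of the block solutions into the operator
  domain.\<close>

lemma ex_solution:
  assumes g: "\<bar>g\<bar> < 2" and z: "\<And>m. z \<noteq> of_nat (m + 1)"
  shows "\<exists>u\<in>osc_dom 2. z *\<^sub>C u - H g u = f"
proof -
  obtain C where C: "C \<ge> 0" "\<And>m v. v \<in> Level m \<Longrightarrow> real (m + 1) * norm (level_res g m z v) \<le> C * norm v"
    using level_res_bound[OF g z] by metis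
  define w where "w m = level_res g m z (level_proj m f)" for m
  have w: "w m \<in> Level m" for m
    by (simp add: w_def level_res_Level level_proj_in_Level)
  have b: "real (m + 1) ^ 2 * (norm (w m))\<^sup>2 \<le> C\<^sup>2 * (norm (level_proj m f))\<^sup>2" for m
    using power_mono[OF C(2)[OF level_proj_in_Level, of m f], of 2] by (simp add: w_def power_mult_distrib)
  have s: "summable (\<lambda>m. C\<^sup>2 * (norm (level_proj m f))\<^sup>2)"
    by (intro summable_mult sums_summable[OF norm_level_proj_sums])
  have s2: "summable (\<lambda>m. real (m + 1) ^ 2 * (norm (w m))\<^sup>2)"
    by (rule summable_comparison_test'[OF s, of 0]) (use b in simp)
  have "(norm (w m))\<^sup>2 \<le> real (m + 1) ^ 2 * (norm (w m))\<^sup>2" for m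
    using mult_right_mono[of 1 "real (m + 1) ^ 2" "(norm (w m))\<^sup>2"] by (simp add: one_le_power)
  then have "summable (\<lambda>m. (norm (w m))\<^sup>2)"
    by (intro summable_comparison_test'[OF s2, of 0]) simp
  then obtain u where u: "w sums u"
    using Level_summable[OF w] by blast
  have Qu: "level_proj m u = w m" for m
    by (rule level_proj_sums_Level[OF w u])
  have dom: "u \<in> osc_dom 2"
    using s2 by (simp add: osc_dom_iff Qu)
  have "z *\<^sub>C u - H g u = f"
  proof (rule level_proj_eqI)
    show "level_proj m (z *\<^sub>C u - H g u) = level_proj m f" for m
      unfolding level_proj_shift[OF dom] Qu w_def by (rule level_res_right_inverse[OF level_proj_in_Level z])
  qed
  with dom show ?thesis by blast
qed

lemma bij_betw_shift:
  assumes g: "\<bar>g\<bar> < 2" and z: "\<And>m. z \<noteq> of_nat (m + 1)"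
  shows "bij_betw (\<lambda>u. z *\<^sub>C u - H g u) (osc_dom 2) UNIV"
  unfolding bij_betw_def
proof
  show "inj_on (\<lambda>u. z *\<^sub>C u - H g u) (osc_dom 2)"
  proof (rule inj_onI)
    fix u v assume u: "u \<in> osc_dom 2" and v: "v \<in> osc_dom 2" and eq: "z *\<^sub>C u - H g u = z *\<^sub>C v - H g v"
    have "level_proj m u = level_proj m v" for m
      using level_proj_solution[OF u eq z] level_proj_solution[OF v refl z] by (simp only:)
    then show "u = v"
      by (rule level_proj_eqI)
  qed
  show "(\<lambda>u. z *\<^sub>C u - H g u) ` osc_dom 2 = UNIV"
  proof (intro equalityI subset_UNIV subsetI)
    fix f
    obtain u where "u \<in> osc_dom 2" "f = z *\<^sub>C u - H g u"
      using ex_solution[OF g z, of f] by blast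
    then show "f \<in> (\<lambda>u. z *\<^sub>C u - H g u) ` osc_dom 2"
      by (rule rev_image_eqI)
  qed
qed

lemma resolvent_properties:
  assumes "bij_betw (\<lambda>u. z *\<^sub>C u - T u) D UNIV"
  shows "resolvent D T z f \<in> D" "z *\<^sub>C resolvent D T z f - T (resolvent D T z f) = f"
    and "u \<in> D \<Longrightarrow> resolvent D T z (z *\<^sub>C u - T u) = u"
proof -
  show "resolvent D T z f \<in> D"
    unfolding resolvent_def using assms by (intro inv_into_into) (auto simp: bij_betw_def)
  show "z *\<^sub>C resolvent D T z f - T (resolvent D T z f) = f"
    unfolding resolvent_def using bij_betw_inv_into_right[OF assms, of f] by simp
  show "resolvent D T z (z *\<^sub>C u - T u) = u" if "u \<in> D"
    unfolding resolvent_def using bij_betw_inv_into_left[OF assms that] .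
qed

lemma level_proj_resolvent:
  assumes g: "\<bar>g\<bar> < 2" and z: "\<And>m. z \<noteq> of_nat (m + 1)"
  shows "level_proj m (resolvent (osc_dom 2) (H g) z f) = level_res g m z (level_proj m f)"
  using level_proj_solution[OF resolvent_properties(1,2)[OF bij_betw_shift[OF g z]] z] .

text \<open>Boundedness is the part that cannot be seen on a single block: it needs the constant
  \<open>C\<close> to be independent of the level, after which Pythagoras over the levels transfers
  it to the whole space.\<close>

lemma in_resolvent_set:
  assumes g: "\<bar>g\<bar> < 2" and z: "\<And>m. z \<noteq> of_nat (m + 1)"
  shows "z \<in> resolvent_set (osc_dom 2) (H g)"
proof -
  let ?S = "resolvent (osc_dom 2) (H g) z"
  obtain C where C: "C \<ge> 0" "\<And>m v. v \<in> Level m \<Longrightarrow> real (m + 1) * norm (level_res g m z v) \<le> C * norm v"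
    using level_res_bound[OF g z] by metis
  note QS = level_proj_resolvent[OF g z]
  have "bounded_linear ?S"
  proof (rule bounded_linear_intro[where K = C])
    show "?S (x + y) = ?S x + ?S y" for x y
      by (rule level_proj_eqI) (simp add: QS level_proj_add level_res_add[OF level_proj_in_Level level_proj_in_Level])
    show "?S (c *\<^sub>R x) = c *\<^sub>R ?S x" for c x
      by (rule level_proj_eqI) (simp add: scaleR_eq_scaleC QS level_proj_scaleC level_res_scaleC[OF level_proj_in_Level])
    show "norm (?S x) \<le> norm x * C" for x
    proof (rule power2_le_imp_le)
      have "(norm (level_proj m (?S x)))\<^sup>2 \<le> C\<^sup>2 * (norm (level_proj m x))\<^sup>2" for m
      proof -
        have "norm (level_res g m z (level_proj m x)) \<le> real (m + 1) * norm (level_res g m z (level_proj m x))"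
          by (simp add: mult_le_cancel_right1)
        also have "\<dots> \<le> C * norm (level_proj m x)"
          by (rule C(2)[OF level_proj_in_Level])
        finally have "(norm (level_res g m z (level_proj m x)))\<^sup>2 \<le> (C * norm (level_proj m x))\<^sup>2"
          by (intro power_mono) auto
        then show ?thesis
          by (simp add: QS power_mult_distrib)
      qed
      then have "(norm (?S x))\<^sup>2 \<le> C\<^sup>2 * (norm x)\<^sup>2"
        by (rule sums_le[OF _ norm_level_proj_sums sums_mult[OF norm_level_proj_sums]])
      then show "(norm (?S x))\<^sup>2 \<le> (norm x * C)\<^sup>2"
        by (simp add: power_mult_distrib mult.commute)
      show "0 \<le> norm x * C" using C by simp
    qed
  qed
  then show ?thesis
    by (simp add: resolvent_set_def bij_betw_shift[OF g z])
qed

text \<open>The first factor is the ground state, which \<open>a1\<close> annihilates. These vectors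
  are the eigenvectors on the levels.\<close>

lemma V_hvec_0: "V (hvec (0, m)) = 0"
proof (rule hcoeff_eqI, clarify)
  fix p q
  have "hvec (0, m) \<in> Level m" using hvec_Level[of "(0, m)"] by (simp add: level_def)
  then show "hcoeff (V (hvec (0, m))) (p, q) = hcoeff 0 (p, q)"
    by (simp only: V_Level_hcoeff) (simp add: hcoeff_hvec hcoeff_zero)
qed

lemma hvec_0_eigenvector: "hvec (0, m) \<in> eigenspace (osc_dom 2) (H g) (of_nat (m + 1))"
proof -
  have v: "hvec (0, m) \<in> Level m" using hvec_Level[of "(0, m)"] by (simp add: level_def)
  then show ?thesis
    using Level_osc_dom[of m 2] H_Level[OF v, of g] by (auto simp: eigenspace_def igV_def V_hvec_0)
qed

lemma hvec_nonzero: "hvec i \<noteq> 0"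
  using norm_hvec[of i] by auto

lemma in_osc_dom_zero: "0 \<in> osc_dom n"
  using Level_osc_dom Level_zero by blast

lemma H_zero: "H g 0 = 0"
  using H_Level[OF Level_zero, of g 0] igV_scaleC[OF Level_zero, of g 0] by simp

lemma eigenvalue_not_in_resolvent_set:
  assumes "z \<in> eigenvalues (osc_dom 2) (H g)"
  shows "z \<notin> resolvent_set (osc_dom 2) (H g)"
proof
  assume "z \<in> resolvent_set (osc_dom 2) (H g)"
  then have inj: "inj_on (\<lambda>u. z *\<^sub>C u - H g u) (osc_dom 2)"
    by (simp add: resolvent_set_def bij_betw_def)
  obtain u where "u \<in> osc_dom 2" "H g u = z *\<^sub>C u" "u \<noteq> 0"
    using assms by (auto simp: eigenvalues_def eigenspace_def)
  then show False
    using inj_onD[OF inj, of u 0] by (simp add: H_zero in_osc_dom_zero)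
qed

lemma spectrum_H:
  assumes g: "\<bar>g\<bar> < 2"
  shows "spectrum (osc_dom 2) (H g) = range (\<lambda>m::nat. of_nat m + 1)"
    and "eigenvalues (osc_dom 2) (H g) = range (\<lambda>m::nat. of_nat m + 1)"
proof -
  have 1: "range (\<lambda>m::nat. of_nat m + 1) \<subseteq> eigenvalues (osc_dom 2) (H g)"
    using hvec_0_eigenvector[of _ g] hvec_nonzero unfolding eigenvalues_def by (auto intro!: bexI simp: add.commute)
  have 2: "eigenvalues (osc_dom 2) (H g) \<subseteq> spectrum (osc_dom 2) (H g)"
    using eigenvalue_not_in_resolvent_set by (auto simp: spectrum_def)
  have 3: "spectrum (osc_dom 2) (H g) \<subseteq> range (\<lambda>m::nat. of_nat m + 1)"
  proof
    fix z assume "z \<in> spectrum (osc_dom 2) (H g)"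
    then have "\<not> (\<forall>m. z \<noteq> of_nat (m + 1))"
      using in_resolvent_set[OF g, of z] by (auto simp: spectrum_def)
    then show "z \<in> range (\<lambda>m::nat. of_nat m + 1)" by (auto simp: add.commute)
  qed
  show "spectrum (osc_dom 2) (H g) = range (\<lambda>m::nat. of_nat m + 1)"
    and "eigenvalues (osc_dom 2) (H g) = range (\<lambda>m::nat. of_nat m + 1)"
    using 1 2 3 by auto
qed

lemma dist_of_nat_complex: "m \<noteq> n \<Longrightarrow> 1 \<le> dist (of_nat m + 1 :: complex) (of_nat n + 1)"
proof -
  assume "m \<noteq> n"
  have "dist (of_nat m + 1 :: complex) (of_nat n + 1) = cmod (of_int (int m - int n))"
    by (simp add: dist_norm)
  also have "\<dots> = \<bar>of_int (int m - int n)\<bar>"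
    by (simp only: norm_of_int)
  also have "1 \<le> \<dots>"
    using \<open>m \<noteq> n\<close> by linarith
  finally show ?thesis .
qed

text \<open>Provides an admissible radius, so that the choice in \<open>riesz_radius\<close> really
  satisfies its condition.\<close>

lemma spectrum_isolated:
  assumes "\<bar>g\<bar> < 2"
  shows "cball (of_nat m + 1) (1/2) \<inter> spectrum (osc_dom 2) (H g) \<subseteq> {of_nat m + 1}"
proof
  fix z assume "z \<in> cball (of_nat m + 1) (1/2) \<inter> spectrum (osc_dom 2) (H g)"
  then obtain n :: nat where "z = of_nat n + 1" "dist (of_nat m + 1) z \<le> 1/2"
    using spectrum_H(1)[OF assms] by auto
  then show "z \<in> {of_nat m + 1}"
    using dist_of_nat_complex[of m n] by (cases "m = n") auto
qed

section \<open>Riesz projections\<close>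

lemma bounded_bilinear_scaleC: "bounded_bilinear (\<lambda>(c::complex) (u::l2). c *\<^sub>C u)"
proof
  show "\<exists>K. \<forall>(a::complex) (b::l2). norm (a *\<^sub>C b) \<le> norm a * norm b * K"
    by (rule exI[of _ 1]) (simp add: norm_scaleC)
qed (auto simp: L2.scale_left_distrib L2.scale_right_distrib scaleR_eq_scaleC scaleR_conv_of_real mult.commute)

text \<open>
  If \<open>x\<close> and \<open>y\<close> are the values at \<open>u\<close> of the resolvents at \<open>z\<close> and \<open>z0\<close>, then \<open>x - y\<close> is the value at
  \<open>(z0 - z) x\<close> of the resolvent at \<open>z0\<close>.
\<close>

lemma continuous_on_resolvent:
  "continuous_on (resolvent_set D T) (\<lambda>z. resolvent D T z u)"
  unfolding continuous_on_def
proof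
  fix z0 assume z0: "z0 \<in> resolvent_set D T"
  let ?R0 = "resolvent D T z0"
  have bl: "bounded_linear ?R0" and bij0: "bij_betw (\<lambda>u. z0 *\<^sub>C u - T u) D UNIV"
    using z0 by (auto simp: resolvent_set_def)
  obtain C where C: "C > 0" "\<And>x. norm (?R0 x) \<le> norm x * C"
    using bounded_linear.pos_bounded[OF bl] by blast
  have est: "norm (resolvent D T z u - ?R0 u) \<le> (2 * C * norm (?R0 u)) * dist z z0"
    if z: "z \<in> resolvent_set D T" and d: "dist z z0 < 1 / (2 * C)" for z
  proof -
    define x where "x = resolvent D T z u"
    have "bij_betw (\<lambda>u. z *\<^sub>C u - T u) D UNIV" using z by (simp add: resolvent_set_def)
    note x = resolvent_properties(1,2)[OF this, of u, folded x_def]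
    have "z0 *\<^sub>C x - T x = u + (z0 - z) *\<^sub>C x"
      using x(2) by (simp add: L2.scale_left_diff_distrib algebra_simps)
    then have "x = ?R0 (u + (z0 - z) *\<^sub>C x)"
      using resolvent_properties(3)[OF bij0 x(1)] by simp
    then have eq: "x - ?R0 u = ?R0 ((z0 - z) *\<^sub>C x)"
      by (metis add_diff_cancel_left' linear_add[OF bounded_linear.linear[OF bl]])
    have n: "norm (x - ?R0 u) \<le> C * dist z z0 * norm x"
      unfolding eq using C(2)[of "(z0 - z) *\<^sub>C x"] by (simp add: norm_scaleC dist_norm norm_minus_commute mult_ac)
    \<comment> \<open>The restriction on the distance lets half of \<open>norm x\<close> be absorbed
      on the left of the resolvent estimate, which bounds \<open>norm x\<close> uniformly for
      \<open>z\<close> near \<open>z0\<close>.\<close>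
    have "C * dist z z0 \<le> 1 / 2"
      using d C(1) by (simp add: field_simps)
    then have "C * dist z z0 * norm x \<le> 1 / 2 * norm x"
      by (intro mult_right_mono) auto
    moreover have "norm x \<le> norm (?R0 u) + norm (x - ?R0 u)"
      using norm_triangle_ineq[of "?R0 u" "x - ?R0 u"] by simp
    ultimately have "norm x \<le> 2 * norm (?R0 u)"
      using n by linarith
    then have "C * dist z z0 * norm x \<le> C * dist z z0 * (2 * norm (?R0 u))"
      using C(1) by (intro mult_left_mono) auto
    with n show ?thesis by (simp add: x_def mult_ac)
  qed
  have "((\<lambda>z. resolvent D T z u - ?R0 u) \<longlongrightarrow> 0) (at z0 within resolvent_set D T)"
  proof (rule Lim_null_comparison)
    have "\<forall>\<^sub>F z in at z0 within resolvent_set D T. z \<in> resolvent_set D T \<and> dist z z0 < 1 / (2 * C)"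
      using C(1) by (auto simp: eventually_at intro!: exI[of _ "1 / (2 * C)"])
    then show "\<forall>\<^sub>F z in at z0 within resolvent_set D T. norm (resolvent D T z u - ?R0 u) \<le> (2 * C * norm (?R0 u)) * dist z z0"
      by eventually_elim (use est in blast)
    show "((\<lambda>z. (2 * C * norm (?R0 u)) * dist z z0) \<longlongrightarrow> 0) (at z0 within resolvent_set D T)"
      by (auto intro!: tendsto_eq_intros)
  qed
  then show "((\<lambda>z. resolvent D T z u) \<longlongrightarrow> ?R0 u) (at z0 within resolvent_set D T)"
    by (simp only: LIM_zero_iff)
qed

text \<open>Three reasons for the value: if \<open>a\<close> is outside the disc, the integrand is
  holomorphic on it; at the centre the simple pole gives the residue; a pole of higher order has a
  primitive on the punctured plane.\<close>

lemma has_contour_integral_circlepath_power: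
  assumes r: "0 < r" and a: "a = z \<or> a \<notin> cball z r"
  shows "((\<lambda>w. 1 / (w - a) ^ (k + 1)) has_contour_integral (if a = z \<and> k = 0 then 2 * of_real pi * \<i> else 0)) (circlepath z r)"
proof (cases "a = z")
  case False
  have "((\<lambda>w. 1 / (w - a) ^ (k + 1)) has_contour_integral 0) (circlepath z r)"
    using a False r by (intro Cauchy_theorem_convex_simple[of _ "cball z r"]) (auto intro!: holomorphic_intros)
  with False show ?thesis by simp
next
  case True
  show ?thesis
  proof (cases "k = 0")
    assume "k = 0"
    then show ?thesis
      using Cauchy_integral_circlepath_simple[of "\<lambda>_. 1" z r z] r True by simp
  next
    assume k: "k \<noteq> 0"
    have "((\<lambda>w. 1 / (w - z) ^ (k + 1)) has_contour_integral 0) (circlepath z r)"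
    proof (rule Cauchy_theorem_primitive[where S = "- {z}" and f = "\<lambda>w. (- 1 / of_nat k) * (1 / (w - z) ^ k)"])
      fix w assume w: "w \<in> - {z}"
      obtain j where j: "k = Suc j" using k by (cases k) auto
      have "((\<lambda>w. (- 1 / of_nat k) * inverse ((w - z) ^ k)) has_field_derivative
          (- 1 / of_nat k) * - (inverse ((w - z) ^ k) * (of_nat k * (w - z) ^ (k - 1)) * inverse ((w - z) ^ k))) (at w within - {z})"
        using w by (auto intro!: derivative_eq_intros)
      moreover have "(- 1 / of_nat k) * - (inverse ((w - z) ^ k) * (of_nat k * (w - z) ^ (k - 1)) * inverse ((w - z) ^ k)) = 1 / (w - z) ^ (k + 1)"
      proof -
        have "(- 1 / of_nat k) * - (inverse (x ^ k) * (of_nat k * x ^ (k - 1)) * inverse (x ^ k)) = 1 / x ^ (k + 1)"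
          if "x \<noteq> 0" for x :: complex
          using that unfolding j by (simp add: field_simps del: of_nat_Suc)
        then show ?thesis using w by simp
      qed
      ultimately show "((\<lambda>w. (- 1 / of_nat k) * (1 / (w - z) ^ k)) has_field_derivative 1 / (w - z) ^ (k + 1)) (at w within - {z})"
        by (simp add: inverse_eq_divide)
    qed (use r in auto)
    with k True show ?thesis by simp
  qed
qed

text \<open>Nothing is known of the chosen radius except that it is positive and the closed disc
  meets the spectrum only in its centre. Bounded level projections pass through the vector-valued
  integral, and on level \<open>n\<close> the resolvent is a finite sum of negative powers of
  \<open>\<zeta> - (n + 1)\<close> with constant vectors. Only the simple pole on level
  \<open>m\<close> contributes, so the nilpotent part leaves no trace in the projection.\<close>

lemma riesz_projection_H:
  assumes g: "\<bar>g\<bar> < 2"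
  shows "riesz_projection (osc_dom 2) (H g) (of_nat m + 1) u = level_proj m u"
proof -
  let ?D = "osc_dom 2" and ?T = "H g"
  define z where "z = (of_nat m + 1 :: complex)"
  define r where "r = riesz_radius ?D ?T z"
  have "0 < (1/2::real) \<and> cball z (1/2) \<inter> spectrum ?D ?T \<subseteq> {z}"
    using spectrum_isolated[OF g] by (simp add: z_def)
  then have r: "0 < r" "cball z r \<inter> spectrum ?D ?T \<subseteq> {z}"
    unfolding r_def riesz_radius_def using someI[of "\<lambda>r. 0 < r \<and> cball z r \<inter> spectrum ?D ?T \<subseteq> {z}" "1/2"] by blast+
  let ?\<gamma> = "circlepath z r"
  let ?d = "\<lambda>t. vector_derivative ?\<gamma> (at t)"
  let ?F = "\<lambda>t. ?d t *\<^sub>C resolvent ?D ?T (?\<gamma> t) u"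
  have sphere: "?\<gamma> t \<in> sphere z r" if "t \<in> {0..1}" for t
    using path_image_circlepath_nonneg[of r z] r(1) that unfolding path_image_def by auto
  have res: "?\<gamma> t \<in> resolvent_set ?D ?T" if "t \<in> {0..1}" for t
  proof -
    have "?\<gamma> t \<in> cball z r" "?\<gamma> t \<noteq> z"
      using sphere[OF that] r(1) by auto
    then show ?thesis
      using r(2) by (auto simp: spectrum_def)
  qed
  have nat: "?\<gamma> t \<noteq> of_nat (n + 1)" if "t \<in> {0..1}" for t n
    using res[OF that] spectrum_H(1)[OF g] by (auto simp: spectrum_def)
  have cont\<gamma>: "continuous_on {0..1} ?\<gamma>"
    using path_circlepath[of z r] by (simp add: path_def)
  have contd: "continuous_on {0..1} ?d"
    unfolding vector_derivative_circlepath by (intro continuous_intros)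
  \<comment> \<open>Continuity of the resolvent gives the integrability of the
    \<open>l2\<close>-valued integrand that allows bounded operators to be taken inside the
    integral.\<close>
  have "continuous_on {0..1} ?F"
    by (intro bounded_bilinear.continuous_on[OF bounded_bilinear_scaleC] contd
        continuous_on_compose2[OF continuous_on_resolvent cont\<gamma>]) (use res in auto)
  then have int: "?F integrable_on {0..1}"
    by (rule integrable_continuous_interval)
  have QF: "level_proj n (integral {0..1} ?F) = (if n = m then (2 * of_real pi * \<i>) *\<^sub>C level_proj m u else 0)" for n
  proof -
    define a where "a = (of_nat (n + 1) :: complex)"
    define c where "c k = (if a = z \<and> k = 0 then 2 * of_real pi * \<i> else 0 :: complex)" for k :: nat
    have az: "a = z \<longleftrightarrow> n = m"
      by (auto simp: a_def z_def add.commute)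
    have a: "a = z \<or> a \<notin> cball z r"
      using r(2) spectrum_H(1)[OF g] by (auto simp: a_def add.commute)
    have "((\<lambda>t. (1 / (?\<gamma> t - a) ^ (k + 1) * ?d t) *\<^sub>C (igV g ^^ k) (level_proj n u)) has_integral c k *\<^sub>C (igV g ^^ k) (level_proj n u)) {0..1}" for k
      using has_integral_linear[OF has_contour_integral_circlepath_power[OF r(1) a, of k, unfolded has_contour_integral] bounded_linear_scaleC_left]
      by (simp add: o_def c_def)
    then have "((\<lambda>t. \<Sum>k<n + 1. (1 / (?\<gamma> t - a) ^ (k + 1) * ?d t) *\<^sub>C (igV g ^^ k) (level_proj n u)) has_integral
        (\<Sum>k<n + 1. c k *\<^sub>C (igV g ^^ k) (level_proj n u))) {0..1}"
      by (intro has_integral_sum) auto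
    moreover have "level_proj n (?F t) = (\<Sum>k<n + 1. (1 / (?\<gamma> t - a) ^ (k + 1) * ?d t) *\<^sub>C (igV g ^^ k) (level_proj n u))" if "t \<in> {0..1}" for t
      unfolding level_proj_scaleC level_proj_resolvent[OF g nat[OF that]] level_res_def a_def[symmetric] L2.scale_sum_right
      by (intro sum.cong) (simp_all add: mult.commute)
    ultimately have "((\<lambda>t. level_proj n (?F t)) has_integral (\<Sum>k<n + 1. c k *\<^sub>C (igV g ^^ k) (level_proj n u))) {0..1}"
      using has_integral_cong[of "{0..1}" "\<lambda>t. level_proj n (?F t)"] by (simp del: sum.lessThan_Suc)
    then have "integral {0..1} (\<lambda>t. level_proj n (?F t)) = (\<Sum>k<n + 1. c k *\<^sub>C (igV g ^^ k) (level_proj n u))"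
      by (rule integral_unique)
    moreover have "(\<Sum>k<n + 1. c k *\<^sub>C (igV g ^^ k) (level_proj n u)) = (\<Sum>k<n + 1. if k = 0 then c 0 *\<^sub>C level_proj n u else 0)"
      by (intro sum.cong) (auto simp: c_def)
    moreover have "integral {0..1} (\<lambda>t. level_proj n (?F t)) = level_proj n (integral {0..1} ?F)"
      using integral_linear[OF int bounded_linear_level_proj] by (simp add: o_def)
    ultimately show ?thesis
      by (simp add: c_def az del: sum.lessThan_Suc)
  qed
  show ?thesis
  proof (rule level_proj_eqI)
    fix n
    show "level_proj n (riesz_projection ?D ?T (of_nat m + 1) u) = level_proj n (level_proj m u)"
      unfolding riesz_projection_def contour_integral_l2_def z_def[symmetric] r_def[symmetric] level_proj_scaleC QF
      by (simp add: level_proj_Level[OF level_proj_in_Level])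
  qed
qed

lemma generalized_eigenspace_H:
  assumes "\<bar>g\<bar> < 2"
  shows "generalized_eigenspace (osc_dom 2) (H g) (of_nat m + 1) = Level m"
proof -
  have "range (level_proj m) = Level m"
    using level_proj_in_Level[of m] level_proj_Level[of _ m m] by (auto simp: image_iff) metis
  then show ?thesis
    by (simp add: generalized_eigenspace_def riesz_projection_H[OF assms])
qed

text \<open>On the other levels the block is invertible at \<open>m + 1\<close>, so an eigenvector
  lives on level \<open>m\<close> and, as \<open>g \<noteq> 0\<close>, is annihilated by
  \<open>V\<close> there. The weights of \<open>V\<close> then force every coefficient with positive
  first index to vanish. For \<open>g = 0\<close> the whole level would be the eigenspace.\<close>

lemma eigenspace_H:
  assumes g: "\<bar>g\<bar> < 2" "g \<noteq> 0"
  shows "eigenspace (osc_dom 2) (H g) (of_nat m + 1) = L2.span {hvec (0, m)}"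
proof
  show "L2.span {hvec (0, m)} \<subseteq> eigenspace (osc_dom 2) (H g) (of_nat m + 1)"
  proof
    fix u assume "u \<in> L2.span {hvec (0, m)}"
    then obtain c where u: "u = c *\<^sub>C hvec (0, m)"
      by (auto simp: L2.span_singleton)
    have v: "hvec (0, m) \<in> Level m" using hvec_Level[of "(0, m)"] by (simp add: level_def)
    have "igV g (hvec (0, m)) = 0" by (simp add: igV_def V_hvec_0)
    then show "u \<in> eigenspace (osc_dom 2) (H g) (of_nat m + 1)"
      using Level_osc_dom[of m 2] Level_scaleC[OF v, of c] H_Level[OF Level_scaleC[OF v, of c], of g] igV_scaleC[OF v, of g c]
      by (auto simp: eigenspace_def u add.commute)
  qed
  show "eigenspace (osc_dom 2) (H g) (of_nat m + 1) \<subseteq> L2.span {hvec (0, m)}"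
  proof
    fix u assume "u \<in> eigenspace (osc_dom 2) (H g) (of_nat m + 1)"
    then have u: "u \<in> osc_dom 2" "of_nat (m + 1) *\<^sub>C u - H g u = 0"
      by (auto simp: eigenspace_def add.commute)
    have zero: "level_proj n u = 0" if "n \<noteq> m" for n
    proof -
      have "(of_nat (m + 1) :: complex) \<noteq> of_nat (n + 1)" using that by simp
      then have "level_proj n u = level_res g n (of_nat (m + 1)) (level_proj n 0)"
        using level_proj_solution[OF u] by blast
      also have "\<dots> = 0"
        using level_res_scaleC[OF Level_zero, of g n "of_nat (m + 1)" 0] by (simp add: level_proj_zero)
      finally show ?thesis .
    qed
    have uL: "u = level_proj m u"
    proof (rule level_proj_eqI)
      show "level_proj k u = level_proj k (level_proj m u)" for k
        using zero[of k] by (cases "k = m") (simp_all add: level_proj_Level[OF level_proj_in_Level])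
    qed
    have "igV g (level_proj m u) = 0"
      using level_proj_shift[OF u(1), of m "of_nat (m + 1)" g] u(2) by (simp add: level_proj_zero)
    then have "igV g u = 0"
      by (simp only: uL[symmetric])
    then have V: "V u = 0"
      using g(2) by (simp add: igV_def)
    have "u = hcoeff u (0, m) *\<^sub>C hvec (0, m)"
    proof (rule hcoeff_eqI, clarify)
      fix p q
      show "hcoeff u (p, q) = hcoeff (hcoeff u (0, m) *\<^sub>C hvec (0, m)) (p, q)"
      proof (cases p)
        case 0
        have "hcoeff u (0, q) = 0" if "q \<noteq> m"
          using arg_cong[OF uL, of "\<lambda>x. hcoeff x (0, q)"] that by (simp add: hcoeff_level_proj level_def)
        then show ?thesis using 0 by (auto simp: hcoeff_scaleC hcoeff_hvec)
      next
        case (Suc p')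
        have "complex_of_real (sqrt (real (Suc q) * real (p' + 1))) * hcoeff u (p' + 1, Suc q - 1) = 0"
          using V_hcoeff_pair[OF u(1), of p' "Suc q"] V by (simp add: hcoeff_zero)
        then have "hcoeff u (p, q) = 0"
          using Suc by (simp del: of_nat_Suc)
        then show ?thesis using Suc by (simp add: hcoeff_scaleC hcoeff_hvec)
      qed
    qed
    then show "u \<in> L2.span {hvec (0, m)}"
      by (metis L2.span_base L2.span_scale insertI1)
  qed
qed

section \<open>The matrix representation\<close>

text \<open>Block by block, \<open>norm (H g v)\<close> lies between \<open>1 - \<delta>\<close> and
  \<open>1 + \<delta>\<close> times \<open>(m + 1) * norm v\<close>. As \<open>\<delta> < 1\<close>,
  summability of the squared images is therefore the same condition as membership in the oscillator
  domain, which makes the domain maximal.\<close>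

lemma H_direct_sum:
  assumes g: "\<bar>g\<bar> < 2"
  shows "operator_direct_sum (osc_dom 2) (H g) Level"
  unfolding operator_direct_sum_def invariant_subspace_def
proof (intro conjI allI impI)
  show "L2.subspace (Level m)" "Level m \<subseteq> osc_dom 2" for m
    by (rule subspace_Level Level_osc_dom)+
  show "H g ` Level m \<subseteq> Level m" for m
    by (auto simp: H_Level intro!: Level_add Level_scaleC igV_Level)
next
  fix w u assume w: "\<forall>m. w m \<in> Level m" and u: "w sums u"
  have Qu: "level_proj m u = w m" for m
    using level_proj_sums_Level[OF _ u] w by blast
  define \<delta> where "\<delta> = \<bar>g\<bar> / 2"
  have \<delta>: "0 \<le> \<delta>" "\<delta> < 1" using g by (auto simp: \<delta>_def)
  have up: "norm (H g (w m)) \<le> (1 + \<delta>) * (real (m + 1) * norm (w m))"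
    and low: "(1 - \<delta>) * (real (m + 1) * norm (w m)) \<le> norm (H g (w m))" for m
  proof -
    have v: "w m \<in> Level m" using w by blast
    have n: "norm (of_nat (m + 1) *\<^sub>C w m) = real (m + 1) * norm (w m)"
      by (simp only: norm_scaleC norm_of_nat)
    have igV: "norm (igV g (w m)) \<le> \<delta> * (real (m + 1) * norm (w m))"
      using norm_igV_le[OF v, of g] by (simp add: \<delta>_def)
    show "norm (H g (w m)) \<le> (1 + \<delta>) * (real (m + 1) * norm (w m))"
      using norm_triangle_ineq[of "of_nat (m + 1) *\<^sub>C w m" "igV g (w m)"] igV unfolding H_Level[OF v] n
      by (simp only: distrib_right mult_1)
    show "(1 - \<delta>) * (real (m + 1) * norm (w m)) \<le> norm (H g (w m))"
      using norm_diff_ineq[of "of_nat (m + 1) *\<^sub>C w m" "igV g (w m)"] igV unfolding H_Level[OF v] n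
      by (simp only: left_diff_distrib mult_1)
  qed
  have up2: "(norm (H g (w m)))\<^sup>2 \<le> (1 + \<delta>)\<^sup>2 * (real (m + 1) ^ 2 * (norm (w m))\<^sup>2)" for m
    using power_mono[OF up, of m 2] by (simp only: power_mult_distrib norm_ge_zero)
  have low2: "(1 - \<delta>)\<^sup>2 * (real (m + 1) ^ 2 * (norm (w m))\<^sup>2) \<le> (norm (H g (w m)))\<^sup>2" for m
    using power_mono[OF low, of m 2] \<delta> by (simp add: power_mult_distrib)
  show dom: "u \<in> osc_dom 2 \<longleftrightarrow> summable (\<lambda>m. (norm (H g (w m)))\<^sup>2)"
  proof
    assume "u \<in> osc_dom 2"
    then have "summable (\<lambda>m. (1 + \<delta>)\<^sup>2 * (real (m + 1) ^ 2 * (norm (w m))\<^sup>2))"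
      by (intro summable_mult) (simp add: osc_dom_iff Qu)
    then show "summable (\<lambda>m. (norm (H g (w m)))\<^sup>2)"
      by (rule summable_comparison_test'[of _ 0]) (use up2 in simp)
  next
    assume "summable (\<lambda>m. (norm (H g (w m)))\<^sup>2)"
    then have "summable (\<lambda>m. (1 - \<delta>)\<^sup>2 * (real (m + 1) ^ 2 * (norm (w m))\<^sup>2))"
      by (rule summable_comparison_test'[of _ 0]) (use low2 in simp)
    then have "summable (\<lambda>m. 1 / (1 - \<delta>)\<^sup>2 * ((1 - \<delta>)\<^sup>2 * (real (m + 1) ^ 2 * (norm (w m))\<^sup>2)))"
      by (rule summable_mult)
    then have "summable (\<lambda>m. real (m + 1) ^ 2 * (norm (w m))\<^sup>2)"
      using \<delta> by simp
    then show "u \<in> osc_dom 2"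
      by (simp add: osc_dom_iff Qu)
  qed
  show "(\<lambda>m. H g (w m)) sums H g u" if "u \<in> osc_dom 2"
  proof -
    have "level_proj m (H g u) = H g (w m)" for m
      unfolding level_proj_H[OF that] Qu using H_Level[of "w m" m g] w by simp
    then show ?thesis
      using level_proj_sums[of "H g u"] by simp
  qed
qed

lemma Level_orthogonal_decomposition: "orthogonal_decomposition Level"
  unfolding orthogonal_decomposition_def
proof (intro conjI allI impI)
  show "\<exists>w. (\<forall>m. w m \<in> Level m) \<and> w sums u" for u
    using level_proj_in_Level level_proj_sums by (intro exI[of _ "\<lambda>m. level_proj m u"]) simp
qed (simp_all only: subspace_Level closed_Level cinner_Level)

text \<open>Ordering the basis by the first index, which \<open>V\<close> lowers by one, places the
  nilpotent part on the superdiagonal.\<close>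

lemma Level_orthonormal_basis: "orthonormal_basis (Level m) (m + 1) (\<lambda>j. hvec (j, m - j))"
proof -
  have "(\<lambda>j. hvec (j, m - j)) ` {..<m + 1} = hvec ` level_idx m"
    unfolding level_idx_eq by (simp only: image_image)
  then show ?thesis
    unfolding orthonormal_basis_def by (simp only: span_hvec_level_idx) (auto simp: cinner_hvec)
qed

text \<open>In column \<open>i + 1\<close> the operator \<open>a1\<close> contributes
  \<open>sqrt (i + 1)\<close> and \<open>a2_star\<close> contributes \<open>sqrt (m - i)\<close>;
  their product is the entry of row \<open>i\<close>.\<close>

lemma H_represented_by: "represented_by (H g) (m + 1) (\<lambda>j. hvec (j, m - j)) (H_mat g m)"
  unfolding represented_by_def
proof (intro conjI allI impI)
  show "H_mat g m \<in> carrier_mat (m + 1) (m + 1)"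
    by (simp add: H_mat_def D_mat_def)
  fix j assume j: "j < m + 1"
  let ?e = "\<lambda>j. hvec (j, m - j)"
  have v: "?e j \<in> Level m"
    using hvec_Level[of "(j, m - j)"] j by (simp add: level_def)
  have entry: "H_mat g m $$ (i, j) = (if i = j then of_nat (m + 1) else 0)
      + (\<i> * complex_of_real g) * (if j = i + 1 then complex_of_real (sqrt (real ((i + 1) * (m - i)))) else 0)"
    if "i < m + 1" for i
    using that j by (auto simp: H_mat_def D_mat_def)
  show "H g (?e j) = (\<Sum>i<m + 1. (H_mat g m $$ (i, j)) *\<^sub>C ?e i)"
  proof (rule hcoeff_eqI, clarify)
    fix p q
    have "hcoeff (\<Sum>i<m + 1. (H_mat g m $$ (i, j)) *\<^sub>C ?e i) (p, q)
        = (\<Sum>i<m + 1. if p = i then (if q = m - p then H_mat g m $$ (p, j) else 0) else 0)"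
      unfolding hcoeff_sum by (intro sum.cong) (auto simp: hcoeff_scaleC hcoeff_hvec)
    also have "\<dots> = (if p < m + 1 \<and> q = m - p then H_mat g m $$ (p, j) else 0)"
      by (simp only: sum.delta'[OF finite_lessThan]) simp
    also have "\<dots> = hcoeff (H g (?e j)) (p, q)"
    proof (cases "p < m + 1 \<and> q = m - p")
      case True
      then have "hcoeff (H g (?e j)) (p, q) = of_nat (m + 1) * (if p = j then 1 else 0)
          + \<i> * complex_of_real g * (complex_of_real (sqrt (real (m - p) * real (p + 1))) * (if p + 1 = j \<and> m - p - 1 = m - j then 1 else 0))"
        using j by (simp add: H_Level[OF v] hcoeff_add hcoeff_scaleC igV_def V_Level_hcoeff[OF v] hcoeff_hvec)
      also have "\<dots> = H_mat g m $$ (p, j)"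
      proof -
        have "real (m - p) * real (p + 1) = real ((p + 1) * (m - p))"
          by (simp only: of_nat_mult mult.commute)
        then show ?thesis
          using True j by (subst entry) (auto simp del: of_nat_mult of_nat_add of_nat_Suc of_nat_diff)
      qed
      finally show ?thesis using True by simp
    next
      case False
      then have "p + q \<noteq> m" by auto
      then have "hcoeff (H g (?e j)) (p, q) = 0"
        using Level_add[OF Level_scaleC[OF v] igV_Level[OF v]] unfolding H_Level[OF v] by (simp add: Level_def level_def)
      then show ?thesis by (simp only: False if_False)
    qed
    finally show "hcoeff (H g (?e j)) (p, q) = hcoeff (\<Sum>i<m + 1. (H_mat g m $$ (i, j)) *\<^sub>C ?e i) (p, q)" ..
  qed
qed

section \<open>The exact order of nilpotency\<close>

text \<open>Each multiplication moves the nonzero entries one superdiagonal further. At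
  \<open>k = m + 1\<close> they have left the matrix, while at \<open>k = m\<close> a product of
  positive numbers remains in the corner.\<close>

lemma D_mat_power:
  assumes "i < m + 1" "j < m + 1"
  shows "(D_mat m ^\<^sub>m k) $$ (i, j) = (if j = i + k then (\<Prod>l<k. complex_of_real (sqrt (real ((i + l + 1) * (m - (i + l)))))) else 0)"
  using assms
proof (induction k arbitrary: j)
  case 0
  then show ?case by (simp add: D_mat_def)
next
  case (Suc k)
  have D: "D_mat m \<in> carrier_mat (m + 1) (m + 1)" by (simp add: D_mat_def)
  then have Dk: "D_mat m ^\<^sub>m k \<in> carrier_mat (m + 1) (m + 1)" by (rule pow_carrier_mat)
  let ?P = "\<Prod>l<k. complex_of_real (sqrt (real ((i + l + 1) * (m - (i + l)))))"
  have "(D_mat m ^\<^sub>m Suc k) $$ (i, j) = (\<Sum>h<m + 1. (D_mat m ^\<^sub>m k) $$ (i, h) * D_mat m $$ (h, j))"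
    using Suc.prems D Dk by (simp add: scalar_prod_def atLeast0LessThan)
  also have "\<dots> = (\<Sum>h<m + 1. if h = i + k then ?P * D_mat m $$ (i + k, j) else 0)"
    by (intro sum.cong) (use Suc in auto)
  also have "\<dots> = (if i + k < m + 1 then ?P * D_mat m $$ (i + k, j) else 0)"
    by (simp only: sum.delta[OF finite_lessThan]) simp
  also have "\<dots> = (if j = i + Suc k then (\<Prod>l<Suc k. complex_of_real (sqrt (real ((i + l + 1) * (m - (i + l)))))) else 0)"
    using Suc.prems by (auto simp: D_mat_def)
  finally show ?case .
qed

lemma D_mat_nilpotent:
  "D_mat m ^\<^sub>m (m + 1) = 0\<^sub>m (m + 1) (m + 1)" "D_mat m ^\<^sub>m m \<noteq> 0\<^sub>m (m + 1) (m + 1)"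
proof -
  have D: "D_mat m ^\<^sub>m k \<in> carrier_mat (m + 1) (m + 1)" for k
    by (rule pow_carrier_mat) (simp add: D_mat_def)
  show "D_mat m ^\<^sub>m (m + 1) = 0\<^sub>m (m + 1) (m + 1)"
  proof (rule eq_matI)
    fix i j assume "i < dim_row (0\<^sub>m (m + 1) (m + 1) :: complex mat)" "j < dim_col (0\<^sub>m (m + 1) (m + 1) :: complex mat)"
    then show "(D_mat m ^\<^sub>m (m + 1)) $$ (i, j) = 0\<^sub>m (m + 1) (m + 1) $$ (i, j)"
      using D_mat_power[of i m j "m + 1"] by (simp del: pow_mat.simps)
  qed (use D[of "m + 1"] in \<open>auto simp del: pow_mat.simps\<close>)
  have "(D_mat m ^\<^sub>m m) $$ (0, m) = (\<Prod>l<m. complex_of_real (sqrt (real ((l + 1) * (m - l)))))"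
    using D_mat_power[of 0 m m m] by simp
  also have "\<dots> \<noteq> 0"
  proof
    assume "(\<Prod>l<m. complex_of_real (sqrt (real ((l + 1) * (m - l))))) = 0"
    then obtain l where "l < m" "complex_of_real (sqrt (real ((l + 1) * (m - l)))) = 0"
      by (auto simp only: prod_zero_iff[OF finite_lessThan] lessThan_iff)
    then have "(l + 1) * (m - l) = 0" "l < m"
      by (simp_all only: of_real_eq_0_iff real_sqrt_eq_zero_cancel_iff of_nat_eq_0_iff)
    then show False by simp
  qed
  finally have ne: "(D_mat m ^\<^sub>m m) $$ (0, m) \<noteq> 0" .
  show "D_mat m ^\<^sub>m m \<noteq> 0\<^sub>m (m + 1) (m + 1)"
  proof
    assume "D_mat m ^\<^sub>m m = 0\<^sub>m (m + 1) (m + 1)"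
    with ne show False by simp
  qed
qed

text \<open>Geometric multiplicity 1 is claimed for \<open>g \<noteq> 0\<close>: at
  \<open>g = 0\<close> the eigenspace for \<open>m + 1\<close> is the entire level, of dimension
  \<open>m + 1\<close>. Nilpotency of order exactly \<open>m + 1\<close> is expressed by the
  vanishing of that power together with the nonvanishing of the preceding one.\<close>

theorem theorem2:
  fixes g :: real
  assumes "\<bar>g\<bar> < 2"
  shows "discrete_spectrum H0_dom (H g)
    \<and> eigenvalues H0_dom (H g) = range (\<lambda>m::nat. of_nat m + 1)
    \<and> (g \<noteq> 0 \<longrightarrow> (\<forall>m::nat. geometric_multiplicity H0_dom (H g) (of_nat m + 1) = 1))
    \<and> (\<forall>m::nat. algebraic_multiplicity H0_dom (H g) (of_nat m + 1) = m + 1)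
    \<and> (\<exists>S :: nat \<Rightarrow> l2 set.
          (\<forall>m. L2.dim (S m) = m + 1 \<and> invariant_subspace H0_dom (H g) (S m))
          \<and> orthogonal_decomposition S
          \<and> operator_direct_sum H0_dom (H g) S
          \<and> (\<forall>m. \<exists>e. orthonormal_basis (S m) (m + 1) e
                   \<and> represented_by (H g) (m + 1) e (H_mat g m)))
    \<and> (\<forall>m. D_mat m ^\<^sub>m (m + 1) = 0\<^sub>m (m + 1) (m + 1)
           \<and> D_mat m ^\<^sub>m m \<noteq> 0\<^sub>m (m + 1) (m + 1))"
proof -
  note gen = generalized_eigenspace_H[OF assms]
  have A: "discrete_spectrum (osc_dom 2) (H g)"
    unfolding discrete_spectrum_def
  proof
    fix z assume z: "z \<in> spectrum (osc_dom 2) (H g)"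
    then obtain m :: nat where m: "z = of_nat m + 1"
      using spectrum_H(1)[OF assms] by auto
    have "ball z (1/2) \<inter> spectrum (osc_dom 2) (H g) = {z}"
      using spectrum_isolated[OF assms, of m] z unfolding m by force
    then have "z isolated_in spectrum (osc_dom 2) (H g)"
      unfolding isolated_in_def using z open_ball by blast
    moreover have "finite_dim (generalized_eigenspace (osc_dom 2) (H g) z)"
      unfolding m gen finite_dim_def span_hvec_level_idx[symmetric] by (intro exI[of _ "hvec ` level_idx m"]) auto
    ultimately show "z isolated_in spectrum (osc_dom 2) (H g) \<and> z \<in> eigenvalues (osc_dom 2) (H g)
        \<and> finite_dim (generalized_eigenspace (osc_dom 2) (H g) z)"
      using z spectrum_H[OF assms] by simp
  qed
  have B: "geometric_multiplicity (osc_dom 2) (H g) (of_nat m + 1) = 1" if "g \<noteq> 0" for m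
    unfolding geometric_multiplicity_def eigenspace_H[OF assms that]
    using L2.dim_eq_card_independent[OF independent_hvec[of "{(0, m)}"]] by simp
  have C: "algebraic_multiplicity (osc_dom 2) (H g) (of_nat m + 1) = m + 1" for m
    by (simp only: algebraic_multiplicity_def gen dim_Level)
  have E: "\<exists>S. (\<forall>m. L2.dim (S m) = m + 1 \<and> invariant_subspace (osc_dom 2) (H g) (S m))
          \<and> orthogonal_decomposition S
          \<and> operator_direct_sum (osc_dom 2) (H g) S
          \<and> (\<forall>m. \<exists>e. orthonormal_basis (S m) (m + 1) e
                   \<and> represented_by (H g) (m + 1) e (H_mat g m))"
  proof (intro exI[of _ Level] conjI allI)
    show "invariant_subspace (osc_dom 2) (H g) (Level m)" for m
      using H_direct_sum[OF assms] by (simp add: operator_direct_sum_def)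
    show "\<exists>e. orthonormal_basis (Level m) (m + 1) e \<and> represented_by (H g) (m + 1) e (H_mat g m)" for m
      using Level_orthonormal_basis H_represented_by by blast
  qed (fact dim_Level Level_orthogonal_decomposition H_direct_sum[OF assms])+
  show ?thesis
    unfolding H0_dom_eq
    by (intro conjI allI impI A B C E D_mat_nilpotent spectrum_H(2)[OF assms])
qed

end
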